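(* Let $G$ be a locally compact second countable group with a continuous isometric action, Roller non-elementary and Roller minimal, on a complete separable irreducible median space $X$ of finite rank, and let $B$ be a $G$-boundary. Then there exists a unique (up to equality almost everywhere) $G$-equivariant measurable map $\phi:B\to\partial_r X$.
   Context: A metric space $(X,d)$ is a median space if for all $x,y,z\in X$ the intersection $[x,y]\cap[x,z]\cap[y,z]$ is a single point $m(x,y,z)$, where $[a,b]=\{c\in X: d(a,b)=d(a,c)+d(c,b)\}$. A subset $A$ is convex if $[a,b]\subseteq A$ for all $a,b\in A$. A halfspace is a subset $\mathfrak h$ such that $\mathfrak h$ and its complement $\mathfrak h^c$ are convex. Two halfspaces are transverse if each of $\mathfrak h_1,\mathfrak h_1^c$ meets each of $\mathfrak h_2,\mathfrak h_2^c$. The rank is the maximal number of pairwise transverse halfspaces. $X$ is irreducible if it is not the $\ell^1$-product of two median spaces neither of which is a single point. Two disjoint halfspaces are strongly separated if no halfspace is transverse to both. For $X$ complete of finite rank, the Roller compactification $\bar X$ is the closure of the image of $X\to\prod_{a,b\in X}[a,b]$, $x\mapsto(m(x,a,b))_{a,b}$, in the product topology; it is a compact median algebra with coordinatewise median operation $m$, with intervals $[x,y]=\{z: m(x,y,z)=z\}$ and convexity defined via these. $X$ is identified with its image and $\partial X=\bar X\setminus X$. Isometries of $X$ extend to $\bar X$. For a halfspace $\mathfrak h$ of $X$, $\tilde{\mathfrak h}=\{x\in\bar X: m(x,a,b)\in\mathfrak h\ \forall a\in\mathfrak h, b\in\mathfrak h^c\}$. A point $x\in\partial X$ is regular if there is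 a sequence of halfspaces $(\mathfrak h_i)_{i\in\mathbb N}$ of $X$ and $r>0$ such that for all $i$: $x\in\tilde{\mathfrak h}_i$, $\mathfrak h_{i+1}\subseteq\mathfrak h_i$, and $\mathfrak h_i^c,\mathfrak h_{i+1}$ are strongly separated with $d(\mathfrak h_i^c,\mathfrak h_{i+1})>r$. The regular boundary $\partial_rX$ is the set of regular points. An isometric action on $X$ ($X$ not a single point) is Roller minimal if $\bar X$ contains no nonempty proper invariant closed convex subset, and Roller non-elementary if there is no finite orbit in $\bar X$. A $G$-boundary is a standard probability space $B$ with a measure class preserving $G$-action such that (i) $G\curvearrowright B$ is amenable in the sense of Zimmer, and (ii) the diagonal action $G\curvearrowright B\times B$ is isometrically ergodic: for every separable metric space $Z$ with a continuous isometric $G$-action, every $G$-equivariant measurable map $B\times B\to Z$ is (essentially) constant. Equivariance of measurable maps is understood almost everywhere. *)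

theory Defs
  imports "HOL-Probability.Probability_Measure" "HOL-Library.Extended_Nat"
begin

section \<open>Group actions\<close>

text \<open>
  Topological groups are those of the class \<^class>\<open>topological_group_add\<close>. The group operation is
  written additively but is not assumed commutative: \<open>g + h\<close>, \<open>0\<close> and \<open>- g\<close> stand for product,
  identity and inverse.
\<close>

definition action_on :: "('g::group_add \<Rightarrow> 'a \<Rightarrow> 'a) \<Rightarrow> 'a set \<Rightarrow> bool" where
  "action_on act S \<longleftrightarrow>
     (\<forall>g. \<forall>x\<in>S. act g x \<in> S) \<and>
     (\<forall>x\<in>S. act 0 x = x) \<and>
     (\<forall>g h. \<forall>x\<in>S. act (g + h) x = act g (act h x))"

definition continuous_isometric_action ::
  "('g::topological_group_add \<Rightarrow> 'a \<Rightarrow> 'a) \<Rightarrow> 'a set \<Rightarrow> ('a \<Rightarrow> 'a \<Rightarrow> real) \<Rightarrow> bool" where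
  "continuous_isometric_action act M d \<longleftrightarrow>
     action_on act M \<and>
     (\<forall>g. \<forall>x\<in>M. \<forall>y\<in>M. d (act g x) (act g y) = d x y) \<and>
     continuous_map (prod_topology euclidean (Metric_space.mtopology M d))
       (Metric_space.mtopology M d) (\<lambda>(g, x). act g x)"


section \<open>Median spaces\<close>

definition metric_interval :: "'a set \<Rightarrow> ('a \<Rightarrow> 'a \<Rightarrow> real) \<Rightarrow> 'a \<Rightarrow> 'a \<Rightarrow> 'a set" where
  "metric_interval M d a b = {c \<in> M. d a b = d a c + d c b}"

definition median_space :: "'a set \<Rightarrow> ('a \<Rightarrow> 'a \<Rightarrow> real) \<Rightarrow> bool" where
  "median_space M d \<longleftrightarrow> Metric_space M d \<and>
     (\<forall>x\<in>M. \<forall>y\<in>M. \<forall>z\<in>M. is_singleton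
        (metric_interval M d x y \<inter> metric_interval M d x z \<inter> metric_interval M d y z))"

text \<open>
  The factors of a product decomposition embed into the space, so it is no restriction to let
  their underlying sets be subsets of the same type.
\<close>

definition irreducible_median_space :: "'a set \<Rightarrow> ('a \<Rightarrow> 'a \<Rightarrow> real) \<Rightarrow> bool" where
  "irreducible_median_space M d \<longleftrightarrow> median_space M d \<and>
     \<not> (\<exists>(M1::'a set) d1 (M2::'a set) d2 f.
          median_space M1 d1 \<and> median_space M2 d2 \<and>
          \<not> is_singleton M1 \<and> \<not> is_singleton M2 \<and>
          bij_betw f M (M1 \<times> M2) \<and>
          (\<forall>x\<in>M. \<forall>y\<in>M. d x y = d1 (fst (f x)) (fst (f y)) + d2 (snd (f x)) (snd (f y))))"

abbreviation interval :: "'x::metric_space \<Rightarrow> 'x \<Rightarrow> 'x set" where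
  "interval \<equiv> metric_interval UNIV dist"

definition median :: "'x::metric_space \<Rightarrow> 'x \<Rightarrow> 'x \<Rightarrow> 'x" where
  "median x y z = the_elem (interval x y \<inter> interval x z \<inter> interval y z)"

definition median_convex :: "'x::metric_space set \<Rightarrow> bool" where
  "median_convex A \<longleftrightarrow> (\<forall>a\<in>A. \<forall>b\<in>A. interval a b \<subseteq> A)"

definition halfspace :: "'x::metric_space set \<Rightarrow> bool" where
  "halfspace h \<longleftrightarrow> median_convex h \<and> median_convex (- h)"

definition transverse :: "'x set \<Rightarrow> 'x set \<Rightarrow> bool" where
  "transverse h k \<longleftrightarrow>
     h \<inter> k \<noteq> {} \<and> h \<inter> - k \<noteq> {} \<and> - h \<inter> k \<noteq> {} \<and> - h \<inter> - k \<noteq> {}"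

definition strongly_separated :: "'x::metric_space set \<Rightarrow> 'x set \<Rightarrow> bool" where
  "strongly_separated h k \<longleftrightarrow> h \<inter> k = {} \<and>
     \<not> (\<exists>j. halfspace j \<and> transverse j h \<and> transverse j k)"

definition median_rank :: "'x::metric_space itself \<Rightarrow> enat" where
  "median_rank _ = (SUP \<H> \<in> {\<H> :: 'x set set. finite \<H> \<and> (\<forall>h\<in>\<H>. halfspace h) \<and>
                                 pairwise transverse \<H>}. enat (card \<H>))"


section \<open>The Roller compactification\<close>

text \<open>A family indexed by pairs of points is a function on pairs.\<close>

type_synonym 'x roller = "'x \<times> 'x \<Rightarrow> 'x"

definition roller_product :: "'x::metric_space roller topology" where
  "roller_product = product_topology (\<lambda>(a, b). top_of_set (interval a b)) UNIV"

definition roller_embed :: "'x::metric_space \<Rightarrow> 'x roller" where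
  "roller_embed x = (\<lambda>(a, b). median x a b)"

definition roller_compactification :: "'x::metric_space roller set" where
  "roller_compactification = roller_product closure_of (range roller_embed)"

definition roller_topology :: "'x::metric_space roller topology" where
  "roller_topology = subtopology roller_product roller_compactification"

definition roller_boundary :: "'x::metric_space roller set" where
  "roller_boundary = roller_compactification - range roller_embed"

definition roller_median ::
  "'x::metric_space roller \<Rightarrow> 'x roller \<Rightarrow> 'x roller \<Rightarrow> 'x roller" where
  "roller_median x y z = (\<lambda>p. median (x p) (y p) (z p))"

definition roller_interval :: "'x::metric_space roller \<Rightarrow> 'x roller \<Rightarrow> 'x roller set" where
  "roller_interval x y = {z \<in> roller_compactification. roller_median x y z = z}"

definition roller_convex :: "'x::metric_space roller set \<Rightarrow> bool" where
  "roller_convex C \<longleftrightarrow> (\<forall>x\<in>C. \<forall>y\<in>C. roller_interval x y \<subseteq> C)"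

text \<open>
  The extension of an isometric action. The formula is forced on embedded points by
  \<open>median (act g x) a b = act g (median x (act (- g) a) (act (- g) b))\<close>, and it is continuous in
  the point of the compactification, so it gives the unique continuous extension.
\<close>

definition roller_act ::
  "('g::group_add \<Rightarrow> 'x \<Rightarrow> 'x) \<Rightarrow> 'g \<Rightarrow> 'x roller \<Rightarrow> 'x roller" where
  "roller_act act g x = (\<lambda>(a, b). act g (x (act (- g) a, act (- g) b)))"

definition roller_halfspace :: "'x::metric_space set \<Rightarrow> 'x roller set" where
  "roller_halfspace h = {x \<in> roller_compactification.
     \<forall>a\<in>h. \<forall>b\<in>- h. roller_median x (roller_embed a) (roller_embed b) \<in> roller_embed ` h}"

text \<open>
  Since \<^const>\<open>setdist\<close> vanishes when one of the sets is empty, the last condition also excludes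
  the improper halfspaces: every \<open>- \<hh> i\<close> and every \<open>\<hh> i\<close> is nonempty.
\<close>

definition regular_point :: "'x::metric_space roller \<Rightarrow> bool" where
  "regular_point x \<longleftrightarrow> x \<in> roller_boundary \<and>
     (\<exists>(\<hh> :: nat \<Rightarrow> 'x set) r. r > 0 \<and>
        (\<forall>i. halfspace (\<hh> i) \<and> x \<in> roller_halfspace (\<hh> i) \<and> \<hh> (Suc i) \<subseteq> \<hh> i \<and>
             strongly_separated (- \<hh> i) (\<hh> (Suc i)) \<and>
             setdist (- \<hh> i) (\<hh> (Suc i)) > r))"

definition regular_boundary :: "'x::metric_space roller set" where
  "regular_boundary = {x. regular_point x}"

definition roller_minimal :: "('g::group_add \<Rightarrow> 'x::metric_space \<Rightarrow> 'x) \<Rightarrow> bool" where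
  "roller_minimal act \<longleftrightarrow> \<not> is_singleton (UNIV :: 'x set) \<and>
     (\<forall>C. closedin roller_topology C \<and> roller_convex C \<and> C \<noteq> {} \<and>
          (\<forall>g. \<forall>x\<in>C. roller_act act g x \<in> C) \<longrightarrow> C = roller_compactification)"

definition roller_nonelementary :: "('g::group_add \<Rightarrow> 'x::metric_space \<Rightarrow> 'x) \<Rightarrow> bool" where
  "roller_nonelementary act \<longleftrightarrow> \<not> is_singleton (UNIV :: 'x set) \<and>
     (\<forall>x \<in> roller_compactification. infinite (range (\<lambda>g. roller_act act g x)))"


section \<open>Standard probability spaces with a group action\<close>

definition borel_of_topology :: "'a topology \<Rightarrow> 'a measure" where
  "borel_of_topology T = sigma (topspace T) {U. openin T U}"

definition standard_borel :: "'a measure \<Rightarrow> bool" where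
  "standard_borel M \<longleftrightarrow> (\<exists>T. completely_metrizable_space T \<and> second_countable T \<and>
     space M = topspace T \<and> sets M = sets (borel_of_topology T))"

definition measure_class_preserving_action ::
  "('g::topological_group_add \<Rightarrow> 'b \<Rightarrow> 'b) \<Rightarrow> 'b measure \<Rightarrow> bool" where
  "measure_class_preserving_action act M \<longleftrightarrow>
     action_on act (space M) \<and>
     (\<lambda>(g, x). act g x) \<in> measurable (borel \<Otimes>\<^sub>M M) M \<and>
     (\<forall>g. \<forall>A\<in>sets M. emeasure M (act g -` A \<inter> space M) = 0 \<longleftrightarrow> emeasure M A = 0)"


section \<open>Zimmer amenability\<close>

text \<open>
  A type quantifier cannot occur in a definition. Every separable Banach space is isometrically
  isomorphic to a closed linear subspace \<open>V\<close> of the space of bounded real sequences, here the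
  bounded continuous functions on the discrete space \<^typ>\<open>nat\<close>. So these \<open>V\<close> serve as the
  separable Banach spaces in the definition of amenability. Maps defined on \<open>V\<close> only are taken
  extensional, as in \<^const>\<open>product_topology\<close>.
\<close>

type_synonym bounded_seq = "nat \<Rightarrow>\<^sub>C real"

definition separable_banach :: "bounded_seq set \<Rightarrow> bool" where
  "separable_banach V \<longleftrightarrow> subspace V \<and> closed V \<and> separable_space (top_of_set V)"

definition linear_on_subspace :: "'v::real_vector set \<Rightarrow> ('v \<Rightarrow> 'w::real_vector) \<Rightarrow> bool" where
  "linear_on_subspace V f \<longleftrightarrow>
     (\<forall>u\<in>V. \<forall>v\<in>V. f (u + v) = f u + f v) \<and> (\<forall>c. \<forall>v\<in>V. f (c *\<^sub>R v) = c *\<^sub>R f v)"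

definition linear_isometries :: "bounded_seq set \<Rightarrow> (bounded_seq \<Rightarrow> bounded_seq) set" where
  "linear_isometries V =
     {T \<in> extensional V. linear_on_subspace V T \<and> (\<forall>v\<in>V. norm (T v) = norm v) \<and> T ` V = V}"

definition strong_operator_topology ::
  "bounded_seq set \<Rightarrow> (bounded_seq \<Rightarrow> bounded_seq) topology" where
  "strong_operator_topology V =
     subtopology (product_topology (\<lambda>_. top_of_set V) V) (linear_isometries V)"

definition dual_unit_ball :: "bounded_seq set \<Rightarrow> (bounded_seq \<Rightarrow> real) set" where
  "dual_unit_ball V =
     {l \<in> extensional V. linear_on_subspace V l \<and> (\<forall>v\<in>V. \<bar>l v\<bar> \<le> norm v)}"

definition weak_star_ball :: "bounded_seq set \<Rightarrow> (bounded_seq \<Rightarrow> real) topology" where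
  "weak_star_ball V =
     subtopology (product_topology (\<lambda>_. euclideanreal) V) (dual_unit_ball V)"

definition convex_functionals :: "bounded_seq set \<Rightarrow> (bounded_seq \<Rightarrow> real) set \<Rightarrow> bool" where
  "convex_functionals V K \<longleftrightarrow>
     (\<forall>k\<in>K. \<forall>l\<in>K. \<forall>t\<in>{0..1}. (\<lambda>v\<in>V. (1 - t) * k v + t * l v) \<in> K)"

text \<open>The action of the inverse transpose of an isometry on functionals.\<close>

definition contragredient ::
  "bounded_seq set \<Rightarrow> (bounded_seq \<Rightarrow> bounded_seq) \<Rightarrow> (bounded_seq \<Rightarrow> real) \<Rightarrow> (bounded_seq \<Rightarrow> real)"
  where "contragredient V T l = (\<lambda>v\<in>V. l (inv_into V T v))"

definition isometry_cocycle ::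
  "('g::topological_group_add \<Rightarrow> 'b \<Rightarrow> 'b) \<Rightarrow> 'b measure \<Rightarrow> bounded_seq set \<Rightarrow>
   ('g \<Rightarrow> 'b \<Rightarrow> bounded_seq \<Rightarrow> bounded_seq) \<Rightarrow> bool" where
  "isometry_cocycle act M V \<alpha> \<longleftrightarrow>
     (\<lambda>(g, s). \<alpha> g s) \<in>
       measurable (borel \<Otimes>\<^sub>M M) (borel_of_topology (strong_operator_topology V)) \<and>
     (\<forall>g h. AE s in M. \<forall>v\<in>V. \<alpha> (g + h) s v = \<alpha> g (act h s) (\<alpha> h s v))"

definition invariant_convex_field ::
  "('g::topological_group_add \<Rightarrow> 'b \<Rightarrow> 'b) \<Rightarrow> 'b measure \<Rightarrow> bounded_seq set \<Rightarrow>
   ('g \<Rightarrow> 'b \<Rightarrow> bounded_seq \<Rightarrow> bounded_seq) \<Rightarrow> ('b \<Rightarrow> (bounded_seq \<Rightarrow> real) set) \<Rightarrow> bool" where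
  "invariant_convex_field act M V \<alpha> K \<longleftrightarrow>
     (\<forall>s\<in>space M. K s \<noteq> {} \<and> compactin (weak_star_ball V) (K s) \<and> convex_functionals V (K s)) \<and>
     {(s, l). s \<in> space M \<and> l \<in> K s} \<in> sets (M \<Otimes>\<^sub>M borel_of_topology (weak_star_ball V)) \<and>
     (\<forall>g. AE s in M. contragredient V (\<alpha> g s) ` K s = K (act g s))"

text \<open>
  Amenability in the sense of Zimmer: every affine space over \<open>M\<close> has a fixed point, i.e. an
  invariant measurable section.
\<close>

definition zimmer_amenable ::
  "('g::topological_group_add \<Rightarrow> 'b \<Rightarrow> 'b) \<Rightarrow> 'b measure \<Rightarrow> bool" where
  "zimmer_amenable act M \<longleftrightarrow>
     (\<forall>V \<alpha> K. separable_banach V \<and> isometry_cocycle act M V \<alpha> \<and>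
              invariant_convex_field act M V \<alpha> K \<longrightarrow>
        (\<exists>\<phi> \<in> measurable M (borel_of_topology (weak_star_ball V)).
           (AE s in M. \<phi> s \<in> K s) \<and>
           (\<forall>g. AE s in M. \<phi> (act g s) = contragredient V (\<alpha> g s) (\<phi> s))))"


section \<open>Isometric ergodicity and boundaries\<close>

text \<open>
  A separable metric space has at most continuum many points, so it is no restriction to let the
  underlying set \<open>Z\<close> be a set of reals. Its metric \<open>d\<close> is arbitrary and unrelated to the one of
  the real line.
\<close>

definition isometrically_ergodic ::
  "('g::topological_group_add \<Rightarrow> 'b \<Rightarrow> 'b) \<Rightarrow> 'b measure \<Rightarrow> bool" where
  "isometrically_ergodic act M \<longleftrightarrow>
     (\<forall>(Z::real set) d \<rho> f.
        Metric_space Z d \<and> separable_space (Metric_space.mtopology Z d) \<and>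
        continuous_isometric_action \<rho> Z d \<and>
        f \<in> measurable M (borel_of_topology (Metric_space.mtopology Z d)) \<and>
        (\<forall>g. AE x in M. f (act g x) = \<rho> g (f x)) \<longrightarrow>
        (\<exists>z\<in>Z. AE x in M. f x = z))"

definition diagonal_action :: "('g \<Rightarrow> 'b \<Rightarrow> 'b) \<Rightarrow> 'g \<Rightarrow> 'b \<times> 'b \<Rightarrow> 'b \<times> 'b" where
  "diagonal_action act g = (\<lambda>(x, y). (act g x, act g y))"

definition G_boundary ::
  "('g::topological_group_add \<Rightarrow> 'b \<Rightarrow> 'b) \<Rightarrow> 'b measure \<Rightarrow> bool" where
  "G_boundary act B \<longleftrightarrow>
     prob_space B \<and> standard_borel B \<and> measure_class_preserving_action act B \<and>
     zimmer_amenable act B \<and>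
     isometrically_ergodic (diagonal_action act) (B \<Otimes>\<^sub>M B)"

definition equivariant_regular_boundary_map ::
  "('g::group_add \<Rightarrow> 'b \<Rightarrow> 'b) \<Rightarrow> 'b measure \<Rightarrow> ('g \<Rightarrow> 'x::metric_space \<Rightarrow> 'x) \<Rightarrow>
   ('b \<Rightarrow> 'x roller) \<Rightarrow> bool" where
  "equivariant_regular_boundary_map actB B act \<phi> \<longleftrightarrow>
     \<phi> \<in> measurable B (restrict_space (borel_of_topology roller_topology) regular_boundary) \<and>
     (\<forall>g. AE b in B. \<phi> (actB g b) = roller_act act g (\<phi> b))"

end

theory Submission
  imports Defs "HOL-Library.Diagonal_Subsequence"
begin

text \<open>
  A point \<open>\<xi>\<close> of the Roller compactification is determined by the numbers \<open>dist p (\<xi> (p, q))\<close>. For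
  \<open>\<xi>\<close> in \<open>X\<close> they are the Gromov products \<open>gprod p q \<xi>\<close>. So instead of probability measures on the
  compactification it suffices to use \<^emph>\<open>means\<close>, the positive normalized functionals on the linear
  span of the functions \<open>gprod p q\<close> and the constants. Zimmer amenability provides an equivariant
  measurable family of means over \<open>B\<close> (\<open>amenable_means\<close>). The heart of the proof is
  \<open>mean_at_regular_point\<close>: almost every member of any such family is the evaluation at a regular point.
  This point is the value of the boundary map. For uniqueness the same result is applied to the
  average of the evaluations at two boundary maps: the average is again an evaluation, and an
  evaluation is not a proper average of two others (\<open>evaluation_average\<close>).

  The geometric input concerns thick halfspaces, which have interior points on both sides. In finite
  rank they separate points (\<open>thick_separation\<close>), because the meet of any finite set in the lattice
  \<open>interval x y\<close> is already the meet of a subset of bounded size. Consequently intervals, and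
  with them the Roller compactification, are compact. Minimality then implies that every thick
  halfspace can be moved off itself (\<open>flip\<close>), and that of two nested ones the larger can be moved into the
  smaller (\<open>skewer\<close>). Irreducibility enters through \<open>nontransverse_connected\<close>: if the thick
  halfspaces fell into two mutually transverse classes, the space would be a product. Together
  these facts give strongly separated thick halfspaces at positive distance
  (\<open>strongly_separated_gap\<close>), and a group element that skewers them gives a bi-infinite ladder of strongly
  separated halfspaces. Descending chains of this kind end at regular points (\<open>end_regular\<close>). As
  the action is non-elementary, a ladder has a translate that faces both of its ends (\<open>ex_facing_ladder\<close>).

  Such a facing triple has a centre, so the triples of translates on which two independent means put
  definite mass single out finitely many points of an orbit. They define an equivariant map from
  \<open>B \<times> B\<close> to a separable space of functions. By isometric ergodicity this map is constant, and since
  orbits are unbounded it vanishes. So almost no mean charges two sides of a facing triple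
  (\<open>no_splitting\<close>). Ergodicity also moves a long ladder into a position where one of two independent means sees its
  top and the other one its bottom (\<open>long_ladder\<close>); depending on the side of the middle rung that contains
  a given base point, one of them sees a long chain starting at this point. Therefore almost every mean sees arbitrarily long chains of
  strongly separated halfspaces, these can be spliced into an infinite one (\<open>infinite_chain\<close>), and a
  mean that sees all members of a chain is the evaluation at its end (\<open>sees_const\<close>).
\<close>

section \<open>Median algebra of a median space\<close>

locale median_metric =
  fixes X_type :: "'x::metric_space itself"
  assumes median_space: "median_space (UNIV :: 'x set) dist"
begin

lemma in_interval: "c \<in> interval a b \<longleftrightarrow> dist a b = dist a c + dist c b" for a :: 'x
  by (simp add: metric_interval_def)

lemma ex_median:
  "\<exists>p. interval x y \<inter> interval x z \<inter> interval y z = {p}" for x :: 'x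
  using median_space unfolding median_space_def is_singleton_def by blast

lemma median_singleton:
  "interval x y \<inter> interval x z \<inter> interval y z = {median x y z}" for x :: 'x
  using ex_median[of x y z] unfolding median_def by force

lemma median_in:
  "median x y z \<in> interval x y" "median x y z \<in> interval x z" "median x y z \<in> interval y z"
  for x :: 'x
proof -
  have "median x y z \<in> interval x y \<inter> interval x z \<inter> interval y z"
    unfolding median_singleton by simp
  then show "median x y z \<in> interval x y" "median x y z \<in> interval x z" "median x y z \<in> interval y z"
    by simp_all
qed

lemma median_unique:
  "p \<in> interval x y \<Longrightarrow> p \<in> interval x z \<Longrightarrow> p \<in> interval y z \<Longrightarrow> median x y z = p" for x :: 'x
proof -
  assume "p \<in> interval x y" "p \<in> interval x z" "p \<in> interval y z"
  then have "p \<in> {median x y z}"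
    unfolding median_singleton[symmetric] by simp
  then show ?thesis
    by simp
qed

lemma interval_commute: "interval a b = interval b a" for a :: 'x
  by (auto simp: in_interval dist_commute)

lemma endpoints_in [simp]: "a \<in> interval a b" "b \<in> interval a b" for a :: 'x
  by (auto simp: in_interval)

lemma interval_refl [simp]: "interval a a = {a}" for a :: 'x
  by (auto simp: in_interval dist_commute)

lemma median_swap12: "median x y z = median y x z" for x :: 'x
  by (rule median_unique) (metis median_in interval_commute)+

lemma median_swap23: "median x y z = median x z y" for x :: 'x
  by (rule median_unique) (metis median_in interval_commute)+

lemma median_swap13: "median x y z = median z y x" for x :: 'x
  by (metis median_swap12 median_swap23)

lemma median_same [simp]: "median x x y = x" "median x y x = x" "median y x x = x" for x :: 'x
  by (auto intro!: median_unique)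

lemma median_eq_iff: "median x a b = x \<longleftrightarrow> x \<in> interval a b" for x :: 'x
  by (metis median_in(3) median_unique endpoints_in(1))

lemma interval_trans:
  fixes x :: 'x
  assumes "v \<in> interval x a" "u \<in> interval x v"
  shows "u \<in> interval x a" "v \<in> interval u a"
  using assms dist_triangle[of x a u] dist_triangle[of u a v] by (auto simp: in_interval)

lemma dist_interval: "c \<in> interval a b \<Longrightarrow> dist a b = dist a c + dist c b" for a :: 'x
  by (simp add: in_interval)

text \<open>
  The median \<open>median x a b\<close> is the gate of \<open>x\<close> in the interval \<open>interval a b\<close>: every geodesic
  from \<open>x\<close> into the interval can be routed through it. With \<open>v\<close> the median of \<open>x, a, c\<close> the
  median of \<open>x, v, b\<close> lies between all pairs among \<open>x, a, b\<close>, so it is the median of these points.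
\<close>

lemma gate:
  fixes a :: 'x
  assumes "c \<in> interval a b"
  shows "median x a b \<in> interval x c"
proof -
  define v where "v = median x a c"
  define w where "w = median x v b"
  have v: "v \<in> interval x a" "v \<in> interval x c" "v \<in> interval a c"
    unfolding v_def by (rule median_in)+
  have w: "w \<in> interval x v" "w \<in> interval x b" "w \<in> interval v b"
    unfolding w_def by (rule median_in)+
  have vab: "v \<in> interval a b"
    using interval_trans(1)[OF assms v(3)] .
  have "w \<in> interval a b"
    using interval_trans(1)[of v b a w] vab w(3) by (metis interval_commute)
  then have "median x a b = w"
    using interval_trans(1)[OF v(1) w(1)] w(2) by (intro median_unique)
  then show ?thesis
    using interval_trans(1)[OF v(2) w(1)] by simp
qed

text \<open>
  Each of the two gates lies on the way from its own point to the other gate.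
\<close>

lemma median_lipschitz: "dist (median x a b) (median y a b) \<le> dist x y" for x :: 'x
proof -
  let ?p = "median x a b" and ?q = "median y a b"
  have "dist x ?q = dist x ?p + dist ?p ?q"
    using gate[OF median_in(3), of x a b y] by (simp add: in_interval)
  moreover have "dist y ?p = dist y ?q + dist ?q ?p"
    using gate[OF median_in(3), of y a b x] by (simp add: in_interval)
  ultimately show ?thesis
    using dist_triangle[of x ?q y] dist_triangle[of y ?p x] by (simp add: dist_commute)
qed

lemma median_lipschitz3:
  "dist (median x y z) (median x' y' z') \<le> dist x x' + dist y y' + dist z z'" for x :: 'x
proof -
  have "dist (median x y z) (median x' y z) \<le> dist x x'"
    by (rule median_lipschitz)
  moreover have "dist (median x' y z) (median x' y' z) \<le> dist y y'"
    by (metis median_lipschitz median_swap12)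
  moreover have "dist (median x' y' z) (median x' y' z') \<le> dist z z'"
    by (metis median_lipschitz median_swap13)
  ultimately show ?thesis
    using dist_triangle[of "median x y z" "median x' y' z'" "median x' y z"]
      dist_triangle[of "median x' y z" "median x' y' z'" "median x' y' z"] by linarith
qed

text \<open>
  The gate of \<open>z\<close> in the interval lies on the way from \<open>z\<close> to \<open>c\<close> and on the way to \<open>e\<close>, so a detour
  through it shortens the distance of \<open>c\<close> and \<open>e\<close> unless it is \<open>z\<close>.
\<close>

lemma interval_convex:
  fixes a :: 'x
  assumes "c \<in> interval a b" "e \<in> interval a b" "z \<in> interval c e"
  shows "z \<in> interval a b"
proof -
  let ?p = "median z a b"
  have "dist z c = dist z ?p + dist ?p c" "dist z e = dist z ?p + dist ?p e"
    by (intro dist_interval gate assms)+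
  moreover have "dist c e = dist c z + dist z e"
    using assms(3) by (simp add: in_interval)
  moreover have "dist c e \<le> dist c ?p + dist ?p e"
    by (rule dist_triangle)
  ultimately have "dist z ?p \<le> 0"
    by (simp add: dist_commute)
  then show ?thesis
    using median_in(3)[of z a b] by simp
qed

lemma median_convex_interval: "median_convex (interval a b)" for a :: 'x
  unfolding median_convex_def using interval_convex by blast

text \<open>
  For a common point \<open>e\<close> of the two intervals the median of \<open>e, a, b\<close> lies in both of them as well, so it is
  also the median of \<open>p, a, b\<close>.
\<close>

lemma interval_Int: "interval p a \<inter> interval p b = interval p (median p a b)" for p :: 'x
proof (intro equalityI subsetI)
  fix e assume e: "e \<in> interval p a \<inter> interval p b"
  have "median e a b \<in> interval p a"
    using interval_trans(1)[of e a p "median e a b"] e median_in(1)[of e a b]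
    by (metis IntD1 interval_commute)
  moreover have "median e a b \<in> interval p b"
    using interval_trans(1)[of e b p "median e a b"] e median_in(2)[of e a b]
    by (metis IntD2 interval_commute)
  ultimately have eq: "median p a b = median e a b"
    using median_in(3) by (intro median_unique)
  have "e \<in> interval p (median e a b)"
    using interval_trans(2)[of e a p "median e a b"] e median_in(1)[of e a b]
    by (metis IntD1 interval_commute)
  then show "e \<in> interval p (median p a b)"
    using eq by simp
next
  fix e assume "e \<in> interval p (median p a b)"
  then show "e \<in> interval p a \<inter> interval p b"
    using interval_trans(1)[OF median_in(1)] interval_trans(1)[OF median_in(2)] by blast
qed

text \<open>
  Gates preserve betweenness. Write \<open>p\<close> for the gate of \<open>z\<close> and \<open>u\<close> for the median of \<open>a, b, p\<close>.
  As \<open>u\<close> lies on the way from \<open>z\<close> to \<open>p\<close>, it has the gate \<open>p\<close> too. The median \<open>n\<close> of \<open>p\<close> with the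
  two gates lies in \<open>interval p a \<inter> interval p b = interval p u\<close>, and the gate \<open>p\<close> of \<open>u\<close> lies
  between \<open>u\<close> and \<open>n\<close>. Hence \<open>n = p\<close>.
\<close>

lemma gate_between:
  fixes a :: 'x
  assumes "z \<in> interval a b"
  shows "median z d e \<in> interval (median a d e) (median b d e)"
proof -
  define p where "p = median z d e"
  define A where "A = median a d e"
  define B where "B = median b d e"
  define n where "n = median p A B"
  define u where "u = median p a b"
  have I: "p \<in> interval d e" "A \<in> interval d e" "B \<in> interval d e"
    unfolding p_def A_def B_def by (rule median_in)+
  have nI: "n \<in> interval d e"
    using interval_convex[OF I(2,3)] median_in(3)[of p A B] unfolding n_def by blast
  have uzp: "u \<in> interval p z"
    unfolding u_def using gate[OF assms] .
  have pun: "p \<in> interval u n"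
  proof -
    have "p \<in> interval z n"
      unfolding p_def using gate[OF nI] .
    then have *: "dist z n = dist z p + dist p n"
      by (simp add: in_interval)
    have "dist p z = dist p u + dist u z"
      using uzp by (simp add: in_interval)
    then show ?thesis
      using * dist_triangle[of z n u] dist_triangle[of u n p]
      by (simp add: in_interval dist_commute)
  qed
  have "n \<in> interval p a"
  proof -
    have "A \<in> interval p a"
      using gate[OF I(1), of a] unfolding A_def by (simp add: interval_commute)
    then show ?thesis
      using interval_trans(1)[OF _ median_in(1)[of p A B]] unfolding n_def by blast
  qed
  moreover have "n \<in> interval p b"
  proof -
    have "B \<in> interval p b"
      using gate[OF I(1), of b] unfolding B_def by (simp add: interval_commute)
    then show ?thesis
      using interval_trans(1)[OF _ median_in(2)[of p A B]] unfolding n_def by blast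
  qed
  ultimately have "n \<in> interval p u"
    using interval_Int unfolding u_def by blast
  then have "n = p"
    using pun zero_le_dist[of n p] by (auto simp: in_interval dist_commute)
  then show ?thesis
    using median_in(3)[of p A B] unfolding n_def p_def A_def B_def by simp
qed

lemma gate_median:
  "median (median x y z) d e = median (median x d e) (median y d e) (median z d e)" for x :: 'x
  by (rule sym, rule median_unique) (intro gate_between median_in)+

text \<open>
  Let \<open>z\<close> lie between points \<open>y1, y2\<close> on the ways from \<open>a1, a2\<close> to \<open>x\<close>, and project to \<open>interval z x\<close>. The
  projections of \<open>a1, a2\<close> are on the way from \<open>z\<close> to those of \<open>y1, y2\<close>, which have \<open>z\<close> between them. So the
  median of \<open>a1, a2, z\<close>, a point of \<open>A\<close>, projects to \<open>z\<close>, which means that \<open>z\<close> is on its way to \<open>x\<close>.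
\<close>

lemma join_convex:
  fixes A :: "'x set"
  assumes "median_convex A"
  shows "median_convex (\<Union>a\<in>A. interval a x)"
  unfolding median_convex_def
proof (intro ballI subsetI)
  fix y1 y2 z
  assume "y1 \<in> (\<Union>a\<in>A. interval a x)" "y2 \<in> (\<Union>a\<in>A. interval a x)" and z: "z \<in> interval y1 y2"
  then obtain a1 a2 where a: "a1 \<in> A" "y1 \<in> interval a1 x" "a2 \<in> A" "y2 \<in> interval a2 x"
    by blast
  define a where "a = median a1 a2 z"
  let ?g = "\<lambda>y. median y z x"
  have "a \<in> A"
    using assms a median_in(1)[of a1 a2 z] unfolding median_convex_def a_def by blast
  have gz: "?g z = z" and gx: "?g x = x"
    by auto
  have g1: "interval z (?g a1) \<subseteq> interval z (?g y1)" and g2: "interval z (?g a2) \<subseteq> interval z (?g y2)"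
  proof -
    have *: "interval z (?g c) \<subseteq> interval z (?g y)" if "y \<in> interval c x" for c y
    proof -
      have 1: "?g y \<in> interval x (?g c)"
        using gate_between[OF that, of z x] gx by (simp add: interval_commute)
      have 2: "?g c \<in> interval x z"
        using median_in(3)[of c z x] by (simp add: interval_commute)
      have "?g c \<in> interval (?g y) z"
        using interval_trans(2)[OF 2 1] .
      then have "?g c \<in> interval z (?g y)"
        by (simp add: interval_commute)
      then show ?thesis
        using interval_trans(1) by blast
    qed
    show "interval z (?g a1) \<subseteq> interval z (?g y1)" "interval z (?g a2) \<subseteq> interval z (?g y2)"
      using * a by blast+
  qed
  have "z \<in> interval (?g y1) (?g y2)"
    using gate_between[OF z, of z x] gz by simp
  then have "median z (?g y1) (?g y2) = z"
    by (simp add: median_eq_iff)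
  then have "interval z (?g y1) \<inter> interval z (?g y2) = {z}"
    by (simp add: interval_Int)
  then have "interval z (median z (?g a1) (?g a2)) \<subseteq> {z}"
    using g1 g2 interval_Int[of z "?g a1" "?g a2"] by blast
  then have "median z (?g a1) (?g a2) = z"
    using endpoints_in(2) by blast
  then have "?g a = z"
    using gate_median[of a1 a2 z z x] gz unfolding a_def by (metis median_swap12 median_swap23)
  then have "z \<in> interval a x"
    using median_in(2)[of a z x] by simp
  then show "z \<in> (\<Union>a\<in>A. interval a x)"
    using \<open>a \<in> A\<close> by blast
qed

text \<open>
  The median \<open>z\<close> of \<open>a, c, e\<close> is such a point. The projection to \<open>interval a z\<close> maps \<open>c\<close> to \<open>z\<close>, then also \<open>x\<close>
  because it lies beyond \<open>c\<close>; it maps \<open>e\<close> to \<open>z\<close>, hence also \<open>f\<close>, which lies between \<open>e\<close> and \<open>x\<close>.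
\<close>

lemma pasch:
  fixes a :: 'x
  assumes "c \<in> interval a x" "f \<in> interval e x"
  shows "\<exists>z. z \<in> interval c e \<and> z \<in> interval a f"
proof -
  define z where "z = median a c e"
  let ?g = "\<lambda>y. median y a z"
  have z: "z \<in> interval a c" "z \<in> interval a e" "z \<in> interval c e"
    unfolding z_def by (rule median_in)+
  have fix_z: "?g y = z" if "z \<in> interval a y" for y
    using that by (intro median_unique) (auto simp: interval_commute)
  have "?g c \<in> interval (?g a) (?g x)"
    using gate_between[OF assms(1)] .
  then have "z \<in> interval a (?g x)"
    using fix_z[OF z(1)] by simp
  moreover have "?g x \<in> interval a z"
    by (rule median_in)
  ultimately have "?g x = z"
    using zero_le_dist[of "?g x" z] by (auto simp: in_interval dist_commute)
  then have "?g f = z"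
    using gate_between[OF assms(2), of a z] fix_z[OF z(2)] by simp
  then have "z \<in> interval a f"
    using median_in(1)[of f a z] by (simp add: interval_commute)
  then show ?thesis
    using z by blast
qed

text \<open>
  A maximal convex set containing \<open>A\<close> and missing \<open>B\<close> has this property, as joining it to another point \<open>x\<close> gives
  a larger convex set.
\<close>

lemma max_convex_avoiding:
  fixes A :: "'x set"
  assumes "median_convex A" "A \<inter> B = {}"
  shows "\<exists>h. median_convex h \<and> A \<subseteq> h \<and> h \<inter> B = {} \<and>
    (\<forall>x. x \<notin> h \<longrightarrow> h \<noteq> {} \<longrightarrow> (\<exists>a\<in>h. interval a x \<inter> B \<noteq> {}))"
proof -
  let ?S = "{h. median_convex h \<and> A \<subseteq> h \<and> h \<inter> B = {}}"
  have "\<exists>M\<in>?S. \<forall>h\<in>?S. M \<subseteq> h \<longrightarrow> h = M"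
  proof (rule subset_Zorn_nonempty)
    show "?S \<noteq> {}"
      using assms by blast
  next
    fix \<C> assume \<C>: "\<C> \<noteq> {}" "subset.chain ?S \<C>"
    have sub: "\<C> \<subseteq> ?S" and chain: "\<And>h k. h \<in> \<C> \<Longrightarrow> k \<in> \<C> \<Longrightarrow> h \<subseteq> k \<or> k \<subseteq> h"
      using \<C>(2) unfolding subset.chain_def by (simp, blast)
    have "median_convex (\<Union>\<C>)"
      unfolding median_convex_def
    proof (intro ballI)
      fix a b assume "a \<in> \<Union>\<C>" "b \<in> \<Union>\<C>"
      then obtain h k where hk: "h \<in> \<C>" "a \<in> h" "k \<in> \<C>" "b \<in> k"
        by blast
      then obtain l where "l \<in> \<C>" "a \<in> l" "b \<in> l"
        using chain by blast
      then show "interval a b \<subseteq> \<Union>\<C>"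
        using sub unfolding median_convex_def by blast
    qed
    then show "\<Union>\<C> \<in> ?S"
      using sub \<C>(1) by blast
  qed
  then obtain h where h: "h \<in> ?S" and max: "\<forall>h'\<in>?S. h \<subseteq> h' \<longrightarrow> h' = h"
    by (elim bexE)
  have "\<exists>a\<in>h. interval a x \<inter> B \<noteq> {}" if x: "x \<notin> h" "h \<noteq> {}" for x
  proof (rule ccontr)
    let ?h = "\<Union>a\<in>h. interval a x"
    assume neg: "\<not> ?thesis"
    have "h \<subseteq> ?h" "x \<in> ?h"
      using x by (auto intro: bexI[where P="\<lambda>a. _ \<in> interval a x"])
    moreover have "?h \<in> ?S"
      using neg h \<open>h \<subseteq> ?h\<close> join_convex[of h x] by blast
    ultimately show False
      using max x by blast
  qed
  then show ?thesis
    using h by blast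
qed

text \<open>
  The convex sets containing \<open>A\<close> and missing \<open>B\<close> have a maximal element \<open>h\<close>, and those containing \<open>B\<close>
  and missing \<open>h\<close> have a maximal element \<open>k\<close>. A point \<open>x\<close> outside both could be joined to \<open>h\<close> only by
  a segment meeting \<open>k\<close>, and to \<open>k\<close> only by a segment meeting \<open>h\<close>; by the Pasch property
  this makes \<open>h\<close> and \<open>k\<close> meet.
\<close>

lemma separation:
  fixes A :: "'x set"
  assumes "median_convex A" "median_convex B" "A \<inter> B = {}" "A \<noteq> {}" "B \<noteq> {}"
  shows "\<exists>h. halfspace h \<and> A \<subseteq> h \<and> B \<subseteq> - h"
proof -
  obtain h where h: "median_convex h" "A \<subseteq> h" "h \<inter> B = {}"
    and hmax: "\<forall>x. x \<notin> h \<longrightarrow> h \<noteq> {} \<longrightarrow> (\<exists>a\<in>h. interval a x \<inter> B \<noteq> {})"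
    using max_convex_avoiding[OF assms(1,3)] by metis
  have hB: "B \<inter> h = {}"
    using h(3) by blast
  obtain k where k: "median_convex k" "B \<subseteq> k" "k \<inter> h = {}"
    and kmax: "\<forall>x. x \<notin> k \<longrightarrow> k \<noteq> {} \<longrightarrow> (\<exists>a\<in>k. interval a x \<inter> h \<noteq> {})"
    using max_convex_avoiding[OF assms(2) hB] by metis
  have ne: "h \<noteq> {}" "k \<noteq> {}"
    using h(2) k(2) assms(4,5) by blast+
  have "x \<in> k" if xh: "x \<notin> h" for x
  proof (rule ccontr)
    assume "x \<notin> k"
    obtain a c where ac: "a \<in> h" "c \<in> interval a x" "c \<in> k"
      using hmax[rule_format, OF xh ne(1)] k(2) by auto
    obtain e f where ef: "e \<in> k" "f \<in> interval e x" "f \<in> h"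
      using kmax[rule_format, OF \<open>x \<notin> k\<close> ne(2)] by auto
    obtain z where "z \<in> interval c e" "z \<in> interval a f"
      using pasch[OF ac(2) ef(2)] by blast
    then have "z \<in> k" "z \<in> h"
      using ac ef h(1) k(1) unfolding median_convex_def by blast+
    then show False
      using k(3) by blast
  qed
  then have "k = - h"
    using k(3) by blast
  then show ?thesis
    using h k unfolding halfspace_def by blast
qed

lemma separate_points:
  fixes x :: 'x
  assumes "x \<noteq> y"
  shows "\<exists>h. halfspace h \<and> x \<in> h \<and> y \<notin> h"
  using separation[of "{x}" "{y}"] assms by (auto simp: median_convex_def)

lemma eq_if_halfspaces:
  fixes x :: 'x
  assumes "\<And>h. halfspace h \<Longrightarrow> x \<in> h \<Longrightarrow> y \<in> h"
  shows "x = y"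
  using separate_points[of x y] assms by blast

lemma convex_interval: "median_convex h \<Longrightarrow> a \<in> h \<Longrightarrow> b \<in> h \<Longrightarrow> c \<in> interval a b \<Longrightarrow> c \<in> h" for a :: 'x
  unfolding median_convex_def by blast

lemma convex_median:
  fixes a :: 'x
  assumes "median_convex h"
  shows "a \<in> h \<Longrightarrow> b \<in> h \<Longrightarrow> median a b c \<in> h"
    and "a \<in> h \<Longrightarrow> c \<in> h \<Longrightarrow> median a b c \<in> h"
    and "b \<in> h \<Longrightarrow> c \<in> h \<Longrightarrow> median a b c \<in> h"
  by (metis assms convex_interval median_in)+

lemma halfspace_Compl [simp]: "halfspace (- h) \<longleftrightarrow> halfspace h" for h :: "'x set"
  by (auto simp: halfspace_def)

lemma halfspace_median:
  fixes a :: 'x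
  assumes "halfspace h"
  shows "median a b c \<in> h \<longleftrightarrow> (a \<in> h \<and> b \<in> h) \<or> (a \<in> h \<and> c \<in> h) \<or> (b \<in> h \<and> c \<in> h)"
proof -
  have "median_convex h" "median_convex (- h)"
    using assms by (auto simp: halfspace_def)
  then show ?thesis
    using convex_median[of h a b c] convex_median[of "- h" a b c]
    convex_median[of h a c b] convex_median[of "- h" a c b]
    convex_median[of h b c a] convex_median[of "- h" b c a]
    median_swap23[of a c b] median_swap12[of b c a] median_swap23[of c b a] by auto
qed

lemma halfspace_interval:
  fixes a :: 'x
  assumes "halfspace h" "c \<in> interval a b"
  shows "a \<in> h \<Longrightarrow> b \<in> h \<Longrightarrow> c \<in> h" "a \<notin> h \<Longrightarrow> b \<notin> h \<Longrightarrow> c \<notin> h"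
  using assms convex_interval[of h a b c] convex_interval[of "- h" a b c]
  unfolding halfspace_def by blast+

text \<open>
  Because halfspaces separate points and contain a median iff they contain two of the three
  points, an equation between median terms holds once it holds for majority in the Booleans.
\<close>

lemma median_eqI:
  fixes x :: 'x
  assumes "\<And>h. halfspace h \<Longrightarrow> x \<in> h \<longleftrightarrow> y \<in> h"
  shows "x = y"
  using eq_if_halfspaces assms by blast

lemma interval_halfspace_iff:
  "c \<in> interval a b \<longleftrightarrow> (\<forall>h. halfspace h \<longrightarrow> a \<in> h \<longrightarrow> b \<in> h \<longrightarrow> c \<in> h)" for a :: 'x
proof
  assume *: "\<forall>h. halfspace h \<longrightarrow> a \<in> h \<longrightarrow> b \<in> h \<longrightarrow> c \<in> h"
  have "median c a b = c"
  proof (rule median_eqI)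
    fix h :: "'x set" assume "halfspace h"
    then show "median c a b \<in> h \<longleftrightarrow> c \<in> h"
      using *[rule_format, of h] *[rule_format, of "- h"] by (auto simp: halfspace_median)
  qed
  then show "c \<in> interval a b"
    by (simp add: median_eq_iff)
qed (auto dest: halfspace_interval)

lemma helly_three:
  fixes A :: "'x set"
  assumes "median_convex A" "median_convex B" "median_convex C"
    and "A \<inter> B \<noteq> {}" "A \<inter> C \<noteq> {}" "B \<inter> C \<noteq> {}"
  shows "A \<inter> B \<inter> C \<noteq> {}"
proof -
  obtain a b c where "a \<in> A \<inter> B" "b \<in> A \<inter> C" "c \<in> B \<inter> C"
    using assms by blast
  then have "median a b c \<in> A \<inter> B \<inter> C"
    using convex_median[OF assms(1), of a b c] convex_median[OF assms(2), of a c b]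
      convex_median[OF assms(3), of b c a] median_swap23[of a b c] median_swap12[of b c a]
      median_swap23[of c b a] by auto
  then show ?thesis
    by blast
qed

lemma convex_Int: "median_convex A \<Longrightarrow> median_convex B \<Longrightarrow> median_convex (A \<inter> B)" for A :: "'x set"
  unfolding median_convex_def by blast

lemma convex_Inter: "(\<And>A. A \<in> \<A> \<Longrightarrow> median_convex A) \<Longrightarrow> median_convex (\<Inter>\<A>)" for \<A> :: "'x set set"
  unfolding median_convex_def by blast

lemma helly:
  fixes \<A> :: "'x set set"
  assumes "finite \<A>" "\<A> \<noteq> {}" "\<And>A. A \<in> \<A> \<Longrightarrow> median_convex A"
    and "\<And>A B. A \<in> \<A> \<Longrightarrow> B \<in> \<A> \<Longrightarrow> A \<inter> B \<noteq> {}"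
  shows "\<Inter>\<A> \<noteq> {}"
proof -
  have *: "median_convex K \<Longrightarrow> K \<noteq> {} \<Longrightarrow> (\<And>A. A \<in> \<A> \<Longrightarrow> A \<inter> K \<noteq> {}) \<Longrightarrow> K \<inter> \<Inter>\<A> \<noteq> {}" for K
    using assms(1,3,4)
  proof (induction \<A> arbitrary: K rule: finite_induct)
    case (insert A \<A>)
    have *: "(K \<inter> A) \<inter> \<Inter>\<A> \<noteq> {}"
    proof (rule insert.IH)
      show "median_convex (K \<inter> A)"
        using insert.prems by (intro convex_Int) auto
      show "K \<inter> A \<noteq> {}"
        using insert.prems(3)[of A] by blast
      show "A' \<inter> (K \<inter> A) \<noteq> {}" if "A' \<in> \<A>" for A'
        using helly_three[of A' K A] insert.prems(1) insert.prems(3-5)[of A'] insert.prems(3-5)[of A] that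
        by (simp add: Int_ac)
      show "A' \<inter> B \<noteq> {}" if "A' \<in> \<A>" "B \<in> \<A>" for A' B
        using insert.prems that by auto
      show "median_convex A'" if "A' \<in> \<A>" for A'
        using insert.prems that by auto
    qed
    then show ?case
      by auto
  qed auto
  have "UNIV \<inter> \<Inter>\<A> \<noteq> {}"
  proof (rule *)
    show "A \<inter> UNIV \<noteq> {}" if "A \<in> \<A>" for A
      using assms(4)[OF that that] by simp
  qed (auto simp: median_convex_def)
  then show ?thesis
    by simp
qed

lemma dist_median: "dist p (median x p q) = (dist p q + dist p x - dist q x) / 2" for p :: 'x
proof -
  let ?m = "median x p q"
  have "dist p x = dist x ?m + dist p ?m" "dist q x = dist x ?m + dist ?m q" "dist p q = dist p ?m + dist ?m q"
    using dist_interval[OF median_in(1)[of x p q]] dist_interval[OF median_in(2)[of x p q]]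
      dist_interval[OF median_in(3)[of x p q]] by (simp_all add: dist_commute)
  then show ?thesis
    by simp
qed

end

section \<open>Finite rank: robust separation and compact intervals\<close>

lemma (in median_metric) closure_convex:
  fixes C :: "'x set"
  assumes "median_convex C"
  shows "median_convex (closure C)"
  unfolding median_convex_def
proof (intro ballI subsetI)
  fix a b z assume ab: "a \<in> closure C" "b \<in> closure C" and z: "z \<in> interval a b"
  show "z \<in> closure C"
    unfolding closure_approachable
  proof (intro allI impI)
    fix e :: real assume "e > 0"
    then obtain a' b' where *: "a' \<in> C" "dist a' a < e / 2" "b' \<in> C" "dist b' b < e / 2"
      using ab unfolding closure_approachable by (meson half_gt_zero)
    have "median a b z = z"
      using z by (metis median_eq_iff median_swap12 median_swap23)
    then have "dist (median a' b' z) z < e"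
      using median_lipschitz3[of a' b' z a b z] * by simp
    then show "\<exists>y\<in>C. dist y z < e"
      using convex_median(1)[OF assms *(1,3)] by blast
  qed
qed

lemma (in median_metric) closed_interval: "closed (interval a b)" for a :: 'x
proof -
  have "interval a b = {c. dist a b = dist a c + dist c b}"
    by (auto simp: in_interval)
  then show ?thesis
    by (auto intro!: closed_Collect_eq continuous_intros)
qed

text \<open>
  A halfspace may be dense or have empty interior. Thickness excludes this, so that the closures of a thick
  halfspace and of its complement are proper closed convex sets.
\<close>

definition thick :: "'x::metric_space set \<Rightarrow> bool" where
  "thick h \<longleftrightarrow> halfspace h \<and> interior h \<noteq> {} \<and> interior (- h) \<noteq> {}"

lemma thick_halfspace: "thick h \<Longrightarrow> halfspace h"
  by (simp add: thick_def)

lemma thick_Compl [simp]: "thick (- h) \<longleftrightarrow> thick h"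
  by (auto simp: thick_def halfspace_def)

lemma thick_nonempty: "thick h \<Longrightarrow> h \<noteq> {} \<and> - h \<noteq> {}"
  unfolding thick_def by (metis interior_empty)

locale finite_rank_median = median_metric X_type for X_type :: "'x::polish_space itself" +
  assumes finite_rank: "median_rank TYPE('x) < \<infinity>"
begin

text \<open>The bound is positive because it serves as a denominator.\<close>

definition rank_bound :: nat where
  "rank_bound = (SOME n. n > 0 \<and> (\<forall>\<H> :: 'x set set. finite \<H> \<and> (\<forall>h\<in>\<H>. halfspace h) \<and>
     pairwise transverse \<H> \<longrightarrow> card \<H> \<le> n))"

lemma rank_bound:
  "rank_bound > 0"
  "finite \<H> \<Longrightarrow> (\<And>h. h \<in> \<H> \<Longrightarrow> halfspace h) \<Longrightarrow> pairwise transverse \<H> \<Longrightarrow> card \<H> \<le> rank_bound"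
  for \<H> :: "'x set set"
proof -
  obtain n where n: "median_rank TYPE('x) = enat n"
    using finite_rank by (cases "median_rank TYPE('x)") auto
  have "card \<H> \<le> Suc n" if "finite \<H> \<and> (\<forall>h\<in>\<H>. halfspace h) \<and> pairwise transverse \<H>" for \<H> :: "'x set set"
  proof -
    have "enat (card \<H>) \<le> median_rank TYPE('x)"
      unfolding median_rank_def using that by (intro SUP_upper) simp
    then show ?thesis
      by (simp add: n)
  qed
  then have "Suc n > 0 \<and> (\<forall>\<H> :: 'x set set. finite \<H> \<and> (\<forall>h\<in>\<H>. halfspace h) \<and>
     pairwise transverse \<H> \<longrightarrow> card \<H> \<le> Suc n)"
    by blast
  from someI[of "\<lambda>n. n > 0 \<and> (\<forall>\<H> :: 'x set set. finite \<H> \<and> (\<forall>h\<in>\<H>. halfspace h) \<and>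
     pairwise transverse \<H> \<longrightarrow> card \<H> \<le> n)", OF this, folded rank_bound_def]
  show "rank_bound > 0"
    and "finite \<H> \<Longrightarrow> (\<And>h. h \<in> \<H> \<Longrightarrow> halfspace h) \<Longrightarrow> pairwise transverse \<H> \<Longrightarrow> card \<H> \<le> rank_bound"
    by auto
qed

lemma no_infinite_transverse:
  fixes \<H> :: "'x set set"
  assumes "infinite \<H>" "\<And>h. h \<in> \<H> \<Longrightarrow> halfspace h"
  shows "\<not> pairwise transverse \<H>"
proof
  assume "pairwise transverse \<H>"
  obtain T where T: "T \<subseteq> \<H>" "finite T" "card T = Suc rank_bound"
    using infinite_arbitrarily_large[OF assms(1)] by blast
  have "card T \<le> rank_bound"
    using T assms(2) \<open>pairwise transverse \<H>\<close> by (intro rank_bound(2)) (auto intro: pairwise_subset)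
  then show False
    using T(3) by simp
qed

text \<open>
  The interval \<open>interval x y\<close> is a lattice with least element \<open>x\<close>, where \<open>p\<close> is below \<open>q\<close> iff
  \<open>p \<in> interval x q\<close>. Then \<open>\<mu>\<close> is the meet of \<open>Z\<close> iff the following equation holds.
\<close>

definition is_meet :: "'x \<Rightarrow> 'x set \<Rightarrow> 'x \<Rightarrow> bool" where
  "is_meet x Z \<mu> \<longleftrightarrow> interval x \<mu> = (\<Inter>z\<in>Z. interval x z)"

lemma interval_inj:
  fixes x :: 'x
  assumes "interval x u = interval x v"
  shows "u = v"
proof -
  have "u \<in> interval x v" "v \<in> interval x u"
    using assms endpoints_in by blast+
  then have "dist x v = dist x u + dist u v" "dist x u = dist x v + dist v u"
    by (auto dest: dist_interval)
  then show ?thesis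
    by (simp add: dist_commute)
qed

text \<open>
  Meets are iterated medians. The distance bound is linear in the number of elements, which is why the
  breadth of the lattice has to be bounded.
\<close>

lemma ex_meet:
  assumes "finite Z" "Z \<noteq> {}"
  shows "\<exists>\<mu>. is_meet x Z \<mu> \<and> (\<forall>F. halfspace F \<longrightarrow> Z \<subseteq> F \<longrightarrow> \<mu> \<in> F) \<and>
    (\<forall>y \<epsilon>. (\<forall>z\<in>Z. dist y z \<le> \<epsilon>) \<longrightarrow> dist y \<mu> \<le> real (card Z) * \<epsilon>)"
  using assms
proof (induction Z rule: finite_ne_induct)
  case (singleton z)
  then show ?case
    by (intro exI[of _ z]) (auto simp: is_meet_def)
next
  case (insert a Z)
  then obtain \<mu> where \<mu>: "is_meet x Z \<mu>" "\<forall>F. halfspace F \<longrightarrow> Z \<subseteq> F \<longrightarrow> \<mu> \<in> F"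
    "\<forall>y \<epsilon>. (\<forall>z\<in>Z. dist y z \<le> \<epsilon>) \<longrightarrow> dist y \<mu> \<le> real (card Z) * \<epsilon>"
    by blast
  show ?case
  proof (intro exI[of _ "median x a \<mu>"] conjI allI impI)
    show "is_meet x (insert a Z) (median x a \<mu>)"
      using \<mu>(1) interval_Int[of x a \<mu>] by (auto simp: is_meet_def)
    show "median x a \<mu> \<in> F" if "halfspace F" "insert a Z \<subseteq> F" for F
      using \<mu>(2) that by (auto simp: halfspace_median)
    show "dist y (median x a \<mu>) \<le> real (card (insert a Z)) * \<epsilon>" if "\<forall>z\<in>insert a Z. dist y z \<le> \<epsilon>" for y \<epsilon>
    proof -
      have "dist y (median x a \<mu>) \<le> dist y a + dist y \<mu>"
        using median_lipschitz3[of x y y x a \<mu>] by simp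
      also have "\<dots> \<le> \<epsilon> + real (card Z) * \<epsilon>"
        using \<mu>(3) that by (intro add_mono) auto
      also have "\<dots> = real (card (insert a Z)) * \<epsilon>"
        using insert.hyps by (simp add: distrib_right)
      finally show ?thesis .
    qed
  qed
qed

lemma meet_halfspace:
  assumes "finite Z" "Z \<noteq> {}" "is_meet x Z \<mu>" "halfspace F" "x \<notin> F"
  shows "\<mu> \<in> F \<longleftrightarrow> Z \<subseteq> F"
proof -
  obtain \<mu>' where "is_meet x Z \<mu>'" "\<forall>F. halfspace F \<longrightarrow> Z \<subseteq> F \<longrightarrow> \<mu>' \<in> F"
    using ex_meet[OF assms(1,2)] by blast
  moreover from this have "\<mu>' = \<mu>"
    using assms(3) interval_inj unfolding is_meet_def by metis
  moreover have "z \<in> F" if "\<mu> \<in> F" "z \<in> Z" for z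
  proof -
    have "\<mu> \<in> interval x z"
      using assms(3) that(2) endpoints_in(2)[of \<mu> x] unfolding is_meet_def by blast
    then show ?thesis
      using halfspace_interval(2)[OF assms(4)] assms(5) that(1) by blast
  qed
  ultimately show ?thesis
    using assms(4) by blast
qed

text \<open>
  If no element of \<open>Z\<close> can be dropped without changing the meet, then for each \<open>z \<in> Z\<close> some halfspace
  contains all elements of \<open>Z\<close> but \<open>z\<close>. These halfspaces are pairwise transverse, so the rank bounds
  their number.
\<close>

lemma meet_breadth:
  assumes "finite Z" "Z \<noteq> {}" "Z \<subseteq> interval x y" "is_meet x Z \<mu>"
  shows "\<exists>Z'\<subseteq>Z. Z' \<noteq> {} \<and> card Z' \<le> rank_bound \<and> is_meet x Z' \<mu>"
proof -
  let ?P = "\<lambda>Z'. Z' \<subseteq> Z \<and> Z' \<noteq> {} \<and> is_meet x Z' \<mu>"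
  obtain Z' where Z': "?P Z'" and min: "\<And>Y. ?P Y \<Longrightarrow> card Z' \<le> card Y"
    using ex_has_least_nat[of ?P Z card] assms by blast
  have fin: "finite Z'"
    using Z' assms(1) finite_subset by blast
  show ?thesis
  proof (cases "card Z' \<le> 1")
    case True
    then show ?thesis
      using Z' rank_bound(1) by (intro exI[of _ Z']) auto
  next
    case False
    have "\<exists>F. halfspace F \<and> x \<notin> F \<and> z \<notin> F \<and> Z' - {z} \<subseteq> F" if z: "z \<in> Z'" for z
    proof -
      let ?Y = "Z' - {z}"
      have Y: "finite ?Y" "?Y \<noteq> {}" "card ?Y < card Z'"
        using fin False z card_Diff1_less[OF fin z] by (auto simp: subset_singleton_iff dest: card_mono)
      obtain w where w: "is_meet x ?Y w"
        using ex_meet[OF Y(1,2)] by blast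
      have "w \<noteq> \<mu>"
        using min[of ?Y] w Y Z' by auto
      then obtain F where F: "halfspace F" "w \<in> F" "\<mu> \<notin> F"
        using separate_points by blast
      have "\<mu> \<in> interval x w"
        using w Z' endpoints_in(2)[of \<mu> x] unfolding is_meet_def by blast
      then have "x \<notin> F"
        using halfspace_interval(1)[OF F(1)] F by blast
      moreover have "?Y \<subseteq> F"
        using meet_halfspace[OF Y(1,2) w F(1) \<open>x \<notin> F\<close>] F by blast
      moreover have "z \<notin> F"
        using meet_halfspace[OF fin _ _ F(1) \<open>x \<notin> F\<close>, of \<mu>] Z' F \<open>?Y \<subseteq> F\<close> by blast
      ultimately show ?thesis
        using F(1) by blast
    qed
    then obtain F where F: "\<And>z. z \<in> Z' \<Longrightarrow> halfspace (F z) \<and> x \<notin> F z \<and> z \<notin> F z \<and> Z' - {z} \<subseteq> F z"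
      by metis
    have inj: "inj_on F Z'"
      by (rule inj_onI) (use F in blast)
    have "transverse (F z) (F z')" if z: "z \<in> Z'" "z' \<in> Z'" "z \<noteq> z'" for z z'
    proof -
      have *: "z' \<in> F z" "z \<in> F z'" "x \<notin> F z" "x \<notin> F z'" "z \<notin> F z" "z' \<notin> F z'"
        using F z by blast+
      have "z \<in> interval x y" "z' \<in> interval x y"
        using z Z' assms(3) by blast+
      then have "y \<in> F z" "y \<in> F z'"
        using * F z halfspace_interval(2) by metis+
      then show ?thesis
        using * unfolding transverse_def by blast
    qed
    then have "pairwise transverse (F ` Z')"
      unfolding pairwise_def by auto
    then have "card (F ` Z') \<le> rank_bound"
      using F fin by (intro rank_bound(2)) auto
    then show ?thesis
      using Z' inj by (auto simp: card_image)
  qed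
qed

text \<open>
  The points whose projection to \<open>interval x y\<close> belongs to the filter generated by the elements of this lattice
  at distance at most \<open>\<epsilon>\<close> from \<open>y\<close>.
\<close>

definition near_filter :: "'x \<Rightarrow> 'x \<Rightarrow> real \<Rightarrow> 'x set" where
  "near_filter x y \<epsilon> = {w. \<exists>Z \<mu>. finite Z \<and> Z \<noteq> {} \<and> Z \<subseteq> interval x y \<and> (\<forall>z\<in>Z. dist y z \<le> \<epsilon>) \<and>
     is_meet x Z \<mu> \<and> \<mu> \<in> interval x (median w x y)}"

lemma near_filter_convex: "median_convex (near_filter x y \<epsilon>)"
  unfolding median_convex_def
proof (intro ballI subsetI)
  fix w1 w2 w assume "w1 \<in> near_filter x y \<epsilon>" "w2 \<in> near_filter x y \<epsilon>" and w: "w \<in> interval w1 w2"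
  then obtain Z1 \<mu>1 Z2 \<mu>2 where
    1: "finite Z1" "Z1 \<noteq> {}" "Z1 \<subseteq> interval x y" "\<forall>z\<in>Z1. dist y z \<le> \<epsilon>"
       "is_meet x Z1 \<mu>1" "\<mu>1 \<in> interval x (median w1 x y)" and
    2: "finite Z2" "Z2 \<noteq> {}" "Z2 \<subseteq> interval x y" "\<forall>z\<in>Z2. dist y z \<le> \<epsilon>"
       "is_meet x Z2 \<mu>2" "\<mu>2 \<in> interval x (median w2 x y)"
    unfolding near_filter_def by auto
  have "is_meet x (Z1 \<union> Z2) (median x \<mu>1 \<mu>2)"
    using 1(5) 2(5) interval_Int[of x \<mu>1 \<mu>2] unfolding is_meet_def by (simp add: INT_Un)
  moreover have "median x \<mu>1 \<mu>2 \<in> interval x (median w x y)"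
    unfolding interval_halfspace_iff
  proof (intro allI impI)
    fix h assume h: "halfspace h" "x \<in> h" "median w x y \<in> h"
    then have "median w1 x y \<in> h \<or> median w2 x y \<in> h"
      using gate_between[OF w, of x y] halfspace_interval(2)[of h] by blast
    then show "median x \<mu>1 \<mu>2 \<in> h"
      using halfspace_interval(1)[OF h(1) 1(6)] halfspace_interval(1)[OF h(1) 2(6)] h
      by (auto simp: halfspace_median)
  qed
  moreover have "finite (Z1 \<union> Z2)" "Z1 \<union> Z2 \<noteq> {}" "Z1 \<union> Z2 \<subseteq> interval x y" "\<forall>z\<in>Z1 \<union> Z2. dist y z \<le> \<epsilon>"
    using 1 2 by auto
  ultimately show "w \<in> near_filter x y \<epsilon>"
    unfolding near_filter_def by blast
qed

text \<open>
  Elements of the filter lie above a meet of elements close to \<open>y\<close>, and boundedly many of these suffice.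
\<close>

lemma near_filter_bound:
  assumes "w \<in> near_filter x y \<epsilon>" "\<epsilon> \<ge> 0"
  shows "dist y (median w x y) \<le> real rank_bound * \<epsilon>"
proof -
  obtain Z \<mu> where Z: "finite Z" "Z \<noteq> {}" "Z \<subseteq> interval x y" "\<forall>z\<in>Z. dist y z \<le> \<epsilon>"
    "is_meet x Z \<mu>" "\<mu> \<in> interval x (median w x y)"
    using assms unfolding near_filter_def by blast
  obtain Z' where Z': "Z' \<subseteq> Z" "Z' \<noteq> {}" "card Z' \<le> rank_bound" "is_meet x Z' \<mu>"
    using meet_breadth[OF Z(1-3,5)] by blast
  obtain \<mu>' where \<mu>': "is_meet x Z' \<mu>'" "dist y \<mu>' \<le> real (card Z') * \<epsilon>"
    using ex_meet[of Z' x] Z Z' by (meson finite_subset subsetD)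
  have "\<mu>' = \<mu>"
    using \<mu>'(1) Z'(4) interval_inj unfolding is_meet_def by metis
  have "median w x y \<in> interval \<mu> y"
    using interval_trans(2)[OF median_in(3) Z(6)] .
  then have "dist y (median w x y) \<le> dist y \<mu>"
    by (auto dest: dist_interval simp: dist_commute)
  also have "\<dots> \<le> real rank_bound * \<epsilon>"
    using \<mu>'(2) \<open>\<mu>' = \<mu>\<close> Z'(3) assms(2) mult_right_mono[of "real (card Z')" "real rank_bound" \<epsilon>] by simp
  finally show ?thesis .
qed

text \<open>
  Distinct points have a separating halfspace with margin. The points of \<open>interval x y\<close> close to \<open>y\<close>
  generate a filter of this lattice, which by the bound on the breadth stays close to \<open>y\<close>; the same
  holds with \<open>x\<close> and \<open>y\<close> exchanged. The two filters are convex and disjoint.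
\<close>

lemma robust_separation:
  fixes x :: 'x
  assumes "x \<noteq> y"
  shows "\<exists>h \<epsilon>. halfspace h \<and> \<epsilon> > 0 \<and> (\<forall>w. dist (median w x y) x < \<epsilon> \<longrightarrow> w \<in> h) \<and>
    (\<forall>w. dist (median w x y) y < \<epsilon> \<longrightarrow> w \<notin> h)"
proof -
  define \<epsilon> where "\<epsilon> = dist x y / (3 * real rank_bound)"
  have \<epsilon>: "\<epsilon> > 0" "3 * (real rank_bound * \<epsilon>) = dist x y"
    using assms rank_bound(1) by (auto simp: \<epsilon>_def)
  have disj: "near_filter y x \<epsilon> \<inter> near_filter x y \<epsilon> = {}"
  proof (rule ccontr)
    assume "near_filter y x \<epsilon> \<inter> near_filter x y \<epsilon> \<noteq> {}"
    then obtain w where w: "w \<in> near_filter y x \<epsilon>" "w \<in> near_filter x y \<epsilon>"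
      by blast
    have "dist x (median w x y) \<le> real rank_bound * \<epsilon>" "dist y (median w x y) \<le> real rank_bound * \<epsilon>"
      using near_filter_bound[OF w(1)] near_filter_bound[OF w(2)] \<epsilon>(1) median_swap23[of w x y] by auto
    then have "dist x y \<le> 2 * (real rank_bound * \<epsilon>)"
      using dist_triangle[of x y "median w x y"] by (simp add: dist_commute)
    moreover have "dist x y > 0"
      using assms by simp
    ultimately show False
      using \<epsilon>(2) by linarith
  qed
  have near: "w \<in> near_filter a b \<epsilon>" if "dist (median w a b) b < \<epsilon>" for w a b
    unfolding near_filter_def
    by (rule CollectI, rule exI[of _ "{median w a b}"], rule exI[of _ "median w a b"])
      (use that median_in(3) in \<open>auto simp: is_meet_def dist_commute\<close>)
  have "x \<in> near_filter y x \<epsilon>" "y \<in> near_filter x y \<epsilon>"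
    using near[of x y x] near[of y x y] \<epsilon>(1) by simp_all
  then obtain h where h: "halfspace h" "near_filter y x \<epsilon> \<subseteq> h" "near_filter x y \<epsilon> \<subseteq> - h"
    using separation[OF near_filter_convex near_filter_convex disj] by blast
  have "\<forall>w. dist (median w x y) x < \<epsilon> \<longrightarrow> w \<in> h"
    using near[of _ y x] h(2) median_swap23 by (metis subsetD)
  moreover have "\<forall>w. dist (median w x y) y < \<epsilon> \<longrightarrow> w \<notin> h"
    using near[of _ x y] h(3) by blast
  ultimately show ?thesis
    using h(1) \<epsilon>(1) by blast
qed

lemma ball_near:
  fixes x :: 'x
  assumes "\<forall>w. dist (median w x y) c < \<epsilon> \<longrightarrow> w \<in> S" "\<epsilon> > 0" "median z x y = c"
  shows "z \<in> interior S"
proof -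
  have "ball z \<epsilon> \<subseteq> S"
  proof
    fix w assume "w \<in> ball z \<epsilon>"
    then have "dist (median w x y) c < \<epsilon>"
      using median_lipschitz[of z x y w] assms(3) by (simp add: dist_commute)
    then show "w \<in> S"
      using assms(1) by blast
  qed
  then show ?thesis
    using assms(2) by (meson centre_in_ball interiorI open_ball)
qed

lemma thick_separation:
  fixes x :: 'x
  assumes "x \<noteq> y"
  obtains h where "thick h" "\<And>w. median w x y = x \<Longrightarrow> w \<in> interior h"
    "\<And>w. median w x y = y \<Longrightarrow> w \<in> interior (- h)"
proof -
  obtain h \<epsilon> where h: "halfspace h" "\<epsilon> > 0" "\<forall>w. dist (median w x y) x < \<epsilon> \<longrightarrow> w \<in> h"
    "\<forall>w. dist (median w x y) y < \<epsilon> \<longrightarrow> w \<in> - h"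
    using robust_separation[OF assms] by auto
  have *: "\<And>w. median w x y = x \<Longrightarrow> w \<in> interior h" "\<And>w. median w x y = y \<Longrightarrow> w \<in> interior (- h)"
    using ball_near[OF h(3,2)] ball_near[OF h(4,2)] by blast+
  then have "thick h"
    using h(1) *(1)[of x] *(2)[of y] unfolding thick_def by (metis empty_iff median_same(1,2) median_same)
  then show thesis
    using that * by blast
qed

text \<open>
  Points \<open>c i\<close> of \<open>C\<close> whose distances to \<open>x\<close> approach the minimum form a Cauchy sequence: the median of
  \<open>x, c i, c j\<close> is in \<open>C\<close> too, and it is closer to \<open>x\<close> unless \<open>c i\<close> and \<open>c j\<close> are close.
\<close>

lemma ex_gate:
  fixes C :: "'x set"
  assumes "closed C" "median_convex C" "C \<noteq> {}"
  shows "\<exists>c\<in>C. \<forall>w\<in>C. c \<in> interval x w"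
proof -
  define D where "D = infdist x C"
  have D: "D \<le> dist x w" if "w \<in> C" for w
    unfolding D_def using that by (rule infdist_le)
  have "\<exists>c\<in>C. dist x c < D + 1 / Suc n" for n
  proof -
    have "infdist x C < D + 1 / Suc n"
      by (simp add: D_def)
    then show ?thesis
      using assms(3) by (simp add: infdist_def cINF_less_iff)
  qed
  then obtain c where c: "\<And>n. c n \<in> C" "\<And>n. dist x (c n) < D + 1 / Suc n"
    by metis
  have bound: "dist (c i) (c j) < 1 / Suc i + 1 / Suc j" for i j
  proof -
    let ?m = "median x (c i) (c j)"
    have "D \<le> dist x ?m"
      using D convex_median(3)[OF assms(2) c(1) c(1)] by blast
    then show ?thesis
      using dist_interval[OF median_in(1)[of x "c i" "c j"]] dist_interval[OF median_in(2)[of x "c i" "c j"]]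
        dist_interval[OF median_in(3)[of x "c i" "c j"]] c(2)[of i] c(2)[of j]
        dist_commute[of "c i" ?m] by linarith
  qed
  have "Cauchy c"
  proof (rule metric_CauchyI)
    fix e :: real assume "e > 0"
    then obtain N where N: "inverse (Suc N) < e / 2"
      using reals_Archimedean[of "e / 2"] by auto
    have "dist (c i) (c j) < e" if "i \<ge> N" "j \<ge> N" for i j
    proof -
      have "1 / Suc i \<le> inverse (Suc N)" "1 / Suc j \<le> inverse (Suc N)"
        using that by (simp_all add: inverse_eq_divide frac_le)
      then show ?thesis
        using bound[of i j] N by linarith
    qed
    then show "\<exists>M. \<forall>m\<ge>M. \<forall>n\<ge>M. dist (c m) (c n) < e"
      by blast
  qed
  then obtain l where l: "c \<longlonglongrightarrow> l"
    using Cauchy_convergent convergent_def by blast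
  have lC: "l \<in> C"
    using closed_sequentially[OF assms(1) _ l] c(1) by blast
  have "(\<lambda>n. dist x (c n)) \<longlonglongrightarrow> dist x l"
    by (intro tendsto_intros l)
  moreover have "(\<lambda>n. D + 1 / Suc n) \<longlonglongrightarrow> D + 0"
    by (intro tendsto_intros LIMSEQ_Suc lim_1_over_n)
  ultimately have "dist x l \<le> D + 0"
    by (rule LIMSEQ_le) (use c(2) less_imp_le in blast)
  moreover have "l \<in> interval x w" if "w \<in> C" for w
  proof -
    let ?m = "median x l w"
    have "D \<le> dist x ?m"
      using D convex_median(3)[OF assms(2) lC that] by blast
    then have "dist ?m l \<le> 0"
      using dist_interval[OF median_in(1)[of x l w]] \<open>dist x l \<le> D + 0\<close> by linarith
    then have "?m = l"
      by simp
    then show ?thesis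
      using median_in(2)[of x l w] by simp
  qed
  ultimately show ?thesis
    using lC by blast
qed

definition proj :: "'x set \<Rightarrow> 'x \<Rightarrow> 'x" where
  "proj C x = (SOME c. c \<in> C \<and> (\<forall>w\<in>C. c \<in> interval x w))"

lemma proj:
  fixes C :: "'x set"
  assumes "closed C" "median_convex C" "C \<noteq> {}"
  shows "proj C x \<in> C" "w \<in> C \<Longrightarrow> proj C x \<in> interval x w"
proof -
  have "proj C x \<in> C \<and> (\<forall>w\<in>C. proj C x \<in> interval x w)"
    unfolding proj_def
    by (rule someI_ex) (use ex_gate[OF assms, of x] in \<open>metis (no_types)\<close>)
  then show "proj C x \<in> C" "w \<in> C \<Longrightarrow> proj C x \<in> interval x w"
    by auto
qed

lemma median_proj:
  fixes x :: 'x
  assumes "closed C" "median_convex C" "w \<in> C"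
  shows "median x (proj C x) w = proj C x"
proof -
  have "proj C x \<in> interval x w"
    using proj(2)[OF assms(1,2)] assms(3) by blast
  then show ?thesis
    by (intro median_unique) auto
qed

lemma proj_lipschitz:
  assumes "closed C" "median_convex C" "C \<noteq> {}"
  shows "dist (proj C x) (proj C y) \<le> dist x y"
proof -
  have "dist x (proj C y) = dist x (proj C x) + dist (proj C x) (proj C y)"
    "dist y (proj C x) = dist y (proj C y) + dist (proj C y) (proj C x)"
    using proj[OF assms] by (auto intro!: dist_interval)
  then show ?thesis
    using dist_triangle[of x "proj C y" y] dist_triangle[of y "proj C x" x] by (simp add: dist_commute)
qed

text \<open>
  An interior point of \<open>h\<close> is separated with margin from its projection \<open>c\<close> to the closure of the complement; the whole
  complement lies on the side of \<open>c\<close>, with the same margin.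
\<close>

lemma thick_shrink:
  fixes h :: "'x set"
  assumes "thick h"
  obtains k \<epsilon> where "thick k" "k \<subseteq> h" "\<epsilon> > 0" "\<And>a b. a \<notin> h \<Longrightarrow> b \<in> k \<Longrightarrow> \<epsilon> \<le> dist a b"
proof -
  let ?C = "closure (- h)"
  obtain y where y: "y \<in> interior h"
    using assms unfolding thick_def by blast
  have "y \<notin> ?C"
    using y by (simp add: closure_complement)
  have C: "closed ?C" "median_convex ?C" "?C \<noteq> {}"
    using closure_convex[of "- h"] thick_nonempty[OF assms] thick_halfspace[OF assms]
    by (auto simp: halfspace_def)
  define c where "c = proj ?C y"
  have c: "c \<in> ?C" "\<And>a. a \<in> ?C \<Longrightarrow> median a y c = c"
    unfolding c_def using proj(1)[OF C] median_proj[OF C(1,2)] by (simp, metis median_swap12 median_swap23)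
  have "y \<noteq> c"
    using c(1) \<open>y \<notin> ?C\<close> by blast
  then obtain k \<epsilon> where k: "halfspace k" "\<epsilon> > 0" "\<forall>w. dist (median w y c) y < \<epsilon> \<longrightarrow> w \<in> k"
    "\<forall>w. dist (median w y c) c < \<epsilon> \<longrightarrow> w \<in> - k"
    using robust_separation[of y c] by auto
  have gap: "\<epsilon> \<le> dist a b" if "a \<notin> h" "b \<in> k" for a b
  proof (rule ccontr)
    assume "\<not> \<epsilon> \<le> dist a b"
    have "median a y c = c"
      using c(2)[of a] that(1) closure_subset[of "- h"] by blast
    then have "dist (median b y c) c < \<epsilon>"
      using median_lipschitz[of b y c a] \<open>\<not> \<epsilon> \<le> dist a b\<close> by (simp add: dist_commute)
    then show False
      using k(4) that(2) by blast
  qed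
  moreover have "k \<subseteq> h"
  proof
    fix b assume "b \<in> k"
    then show "b \<in> h"
      using gap[of b b] k(2) by auto
  qed
  moreover have "thick k"
    using ball_near[OF k(3,2), of y] ball_near[OF k(4,2), of c] k(1) unfolding thick_def by auto
  ultimately show thesis
    using that k(2) by blast
qed

text \<open>
  One halfspace is chosen for each pair of balls with centres in a countable dense set and the same rational radius
  that can be separated.
\<close>

lemma countable_thick_separators:
  "\<exists>F :: nat \<Rightarrow> 'x set. (\<forall>i. halfspace (F i)) \<and>
    (\<forall>x y. x \<noteq> y \<longrightarrow> (\<exists>i. x \<in> interior (F i) \<and> y \<in> interior (- F i)))"
proof -
  obtain D :: "'x set" where D: "countable D" "\<And>U. open U \<Longrightarrow> U \<noteq> {} \<Longrightarrow> \<exists>d\<in>D. d \<in> U"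
    using countable_dense_exists by blast
  let ?P = "\<lambda>(p, q, r) (h :: 'x set). halfspace h \<and> ball p r \<subseteq> h \<and> ball q r \<subseteq> - h"
  have ex: "\<exists>h. halfspace h \<and> ((\<exists>h. ?P i h) \<longrightarrow> ?P i h)" for i
  proof (cases "\<exists>h. ?P i h")
    case True
    then obtain h where "?P i h"
      by blast
    then show ?thesis
      by (intro exI[of _ h]) (simp split: prod.splits)
  next
    case False
    then show ?thesis
      by (intro exI[of _ "{}"]) (simp add: halfspace_def median_convex_def)
  qed
  have "\<exists>H. \<forall>i. halfspace (H i) \<and> ((\<exists>h. ?P i h) \<longrightarrow> ?P i (H i))"
    by (rule choice) (rule allI, rule ex)
  then obtain H where H: "\<forall>i. halfspace (H i) \<and> ((\<exists>h. ?P i h) \<longrightarrow> ?P i (H i))"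
    by (elim exE)
  have Phalf: "halfspace (H i)" for i
    using H by (elim allE conjE)
  have HP: "?P i (H i)" if "?P i h" for i h
  proof -
    have "(\<exists>h. ?P i h) \<longrightarrow> ?P i (H i)"
      using H by (elim allE conjE)
    then show ?thesis
      by (rule mp) (rule exI, rule that)
  qed
  let ?I = "D \<times> D \<times> (\<rat> :: real set)"
  have "countable (H ` ?I)"
    using D(1) by (auto simp: countable_rat)
  moreover have "H ` ?I \<noteq> {}"
    using D(2)[of UNIV] by auto
  ultimately obtain F :: "nat \<Rightarrow> 'x set" where F: "range F = H ` ?I"
    using uncountable_def[of "H ` ?I"] by blast
  have "\<exists>h\<in>H ` ?I. x \<in> interior h \<and> y \<in> interior (- h)" if xy: "x \<noteq> y" for x y
  proof -
    obtain h where h: "thick h" "x \<in> interior h" "y \<in> interior (- h)"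
      using thick_separation[OF xy] by (metis median_same)
    obtain e1 where e1: "e1 > 0" "ball x e1 \<subseteq> h"
      using h(2) mem_interior by blast
    obtain e2 where e2: "e2 > 0" "ball y e2 \<subseteq> - h"
      using h(3) mem_interior by blast
    obtain r where r: "r \<in> \<rat>" "0 < r" "r < min e1 e2 / 2"
      using Rats_dense_in_real[of 0 "min e1 e2 / 2"] e1(1) e2(1) by auto
    obtain p q where pq: "p \<in> D" "p \<in> ball x r" "q \<in> D" "q \<in> ball y r"
      using D(2)[of "ball x r"] D(2)[of "ball y r"] r(2) by auto
    have "ball p r \<subseteq> ball x e1"
    proof
      fix w assume "w \<in> ball p r"
      then show "w \<in> ball x e1"
        using pq(2) r(3) dist_triangle[of x w p] by simp
    qed
    moreover have "ball q r \<subseteq> ball y e2"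
    proof
      fix w assume "w \<in> ball q r"
      then show "w \<in> ball y e2"
        using pq(4) r(3) dist_triangle[of y w q] by simp
    qed
    ultimately have P: "?P (p, q, r) h"
      using h(1) e1(2) e2(2) thick_halfspace by auto
    have "?P (p, q, r) (H (p, q, r))"
      by (rule HP[OF P])
    then have "x \<in> interior (H (p, q, r))" "y \<in> interior (- H (p, q, r))"
      using pq(2,4) by (auto intro!: interiorI[OF open_ball] simp: dist_commute)
    then show ?thesis
      using pq r(1) by blast
  qed
  then have "\<exists>i. x \<in> interior (F i) \<and> y \<in> interior (- F i)" if "x \<noteq> y" for x y
    using that unfolding F[symmetric] by fast
  moreover have "halfspace (F i)" for i
  proof -
    have "F i \<in> H ` ?I"
      using F by blast
    then obtain p where "F i = H p"
      by (elim imageE)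
    then show ?thesis
      using Phalf[of p] by simp
  qed
  ultimately show ?thesis
    by blast
qed

text \<open>
  The distance of two terms is the difference of their distances to \<open>a\<close>, and these decrease.
\<close>

lemma decreasing_convergent:
  fixes s :: "nat \<Rightarrow> 'x"
  assumes "\<And>m. s (Suc m) \<in> interval a (s m)"
  shows "convergent s"
proof -
  have mono: "s n \<in> interval a (s m)" if "m \<le> n" for m n
    using that by (induction n rule: dec_induct) (auto intro: interval_trans(1)[OF _ assms])
  have eq': "dist (s m) (s n) = \<bar>dist a (s m) - dist a (s n)\<bar>" if "m \<le> n" for m n
    using dist_interval[OF mono[OF that]] by (simp add: dist_commute)
  have eq: "dist (s m) (s n) = \<bar>dist a (s m) - dist a (s n)\<bar>" for m n
    using eq'[of m n] eq'[of n m] by (cases "m \<le> n") (simp_all add: dist_commute abs_minus_commute)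
  have "dist a (s (Suc m)) \<le> dist a (s m)" for m
    using dist_interval[OF assms[of m]] by simp
  then have "decseq (\<lambda>m. dist a (s m))"
    by (rule decseq_SucI)
  from decseq_convergent[OF this, of 0] obtain l where "(\<lambda>m. dist a (s m)) \<longlonglongrightarrow> l"
    by (metis zero_le_dist)
  then have "convergent (\<lambda>m. dist a (s m))"
    by (rule convergentI)
  then have "Cauchy (\<lambda>m. dist a (s m))"
    by (rule convergent_Cauchy)
  then have "Cauchy s"
    unfolding Cauchy_def eq dist_real_def .
  then show ?thesis
    by (rule Cauchy_convergent)
qed

text \<open>
  The limit inferior of a sequence in the lattice \<open>interval a c\<close> with least element \<open>a\<close>. It stays in the
  closure of every halfspace that contains almost all terms.
\<close>

lemma lattice_liminf:
  fixes a c :: 'x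
  assumes u: "\<And>i. u i \<in> interval a c"
  obtains I L where "\<And>k. I k \<in> interval a (u k)" "I \<longlonglongrightarrow> L"
    "\<And>F k. halfspace F \<Longrightarrow> (\<And>i. i \<ge> k \<Longrightarrow> u i \<in> F) \<Longrightarrow> L \<in> closure F"
proof -
  \<comment> \<open>the meet of \<open>u k, ..., u (k + m)\<close>\<close>
  define M where "M k = rec_nat (u k) (\<lambda>m p. median a p (u (k + Suc m)))" for k
  have M0: "M k 0 = u k" and MS: "M k (Suc m) = median a (M k m) (u (k + Suc m))" for k m
    by (auto simp: M_def)
  have dec: "M k (Suc m) \<in> interval a (M k m)" for k m
    unfolding MS by (rule median_in)
  have conv: "convergent (M k)" for k
    using dec by (rule decreasing_convergent)
  define I where "I k = lim (M k)" for k
  have I: "M k \<longlonglongrightarrow> I k" for k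
    using conv unfolding I_def by (simp add: convergent_LIMSEQ_iff)
  have "M k m \<in> interval a (u k)" for k m
    by (induction m) (auto simp: M0 intro: interval_trans(1)[OF _ dec])
  then have Iu: "I k \<in> interval a (u k)" for k
    using closed_sequentially[OF closed_interval _ I] by blast
  have MF: "M k m \<in> F" if "halfspace F" "\<And>i. i \<ge> k \<Longrightarrow> u i \<in> F" for k m F
    using that by (induction m) (auto simp: M0 MS halfspace_median)
  have step: "M k (Suc m) \<in> interval a (M (Suc k) m)" for k m
    unfolding interval_halfspace_iff
  proof (intro allI impI)
    fix h assume h: "halfspace h" "a \<in> h" "M (Suc k) m \<in> h"
    then show "M k (Suc m) \<in> h"
      by (induction m) (auto simp: M0 MS halfspace_median)
  qed
  have IS: "I k \<in> interval a (I (Suc k))" for k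
  proof -
    have "(\<lambda>m. dist a (M (Suc k) m)) \<longlonglongrightarrow> dist a (I (Suc k))"
      by (intro tendsto_intros I)
    moreover have "(\<lambda>m. dist a (M (Suc k) m)) \<longlonglongrightarrow> dist a (I k) + dist (I k) (I (Suc k))"
      using dist_interval[OF step] LIMSEQ_Suc[OF I[of k]] by (auto intro!: tendsto_intros I)
    ultimately show ?thesis
      unfolding in_interval by (rule LIMSEQ_unique)
  qed
  have Ic: "I k \<in> interval a c" for k
    using interval_trans(1)[OF u Iu] .
  have "I (Suc k) \<in> interval c (I k)" for k
    using interval_trans(2)[OF Ic IS] by (simp add: interval_commute)
  then have "convergent I"
    by (rule decreasing_convergent)
  then obtain L where L: "I \<longlonglongrightarrow> L"
    using convergent_def by blast
  have "L \<in> closure F" if F: "halfspace F" "\<And>i. i \<ge> k \<Longrightarrow> u i \<in> F" for F k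
  proof -
    have "I j \<in> closure F" if "j \<ge> k" for j
    proof -
      have "M j m \<in> F" for m
        using MF[of F j m] F that by auto
      then show ?thesis
        using I[of j] closure_sequential by blast
    qed
    then show ?thesis
      using closed_sequentially[OF closed_closure _ LIMSEQ_ignore_initial_segment[OF L, of k]] by simp
  qed
  then show thesis
    using that Iu L by blast
qed

text \<open>
  A subsequence can be chosen that eventually decides membership in each of countably many halfspaces
  that separate points robustly. Its limits inferior and superior cannot be separated by any of
  these halfspaces, so they agree.
\<close>

lemma compact_interval: "compact (interval a c)" for a :: 'x
  unfolding compact_eq_seq_compact_metric seq_compact_def
proof (intro allI impI)
  fix z :: "nat \<Rightarrow> 'x" assume z: "\<forall>n. z n \<in> interval a c"
  obtain F :: "nat \<Rightarrow> 'x set" where F: "\<And>i. halfspace (F i)"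
    "\<And>x y. x \<noteq> y \<Longrightarrow> \<exists>i. x \<in> interior (F i) \<and> y \<in> interior (- F i)"
    using countable_thick_separators by blast
  define P where "P n s \<longleftrightarrow> (\<forall>i. z (s i) \<in> F n) \<or> (\<forall>i. z (s i) \<notin> F n)" for n and s :: "nat \<Rightarrow> nat"
  interpret subseqs P
  proof
    fix n and s :: "nat \<Rightarrow> nat" assume s: "strict_mono s"
    have "infinite {i. z (s i) \<in> F n} \<or> infinite {i. z (s i) \<notin> F n}"
    proof -
      have "{i. z (s i) \<in> F n} \<union> {i. z (s i) \<notin> F n} = UNIV"
        by blast
      then show ?thesis
        using finite_UnI infinite_UNIV_nat by metis
    qed
    then obtain S where S: "infinite S" "(\<forall>i\<in>S. z (s i) \<in> F n) \<or> (\<forall>i\<in>S. z (s i) \<notin> F n)"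
      by blast
    then obtain r :: "nat \<Rightarrow> nat" where "strict_mono r" "\<forall>n. r n \<in> S"
      using infinite_enumerate by blast
    then show "\<exists>r'. strict_mono r' \<and> P n (s \<circ> r')"
      unfolding P_def using S(2) by (intro exI[of _ r]) auto
  qed
  have P: "P n (diagseq \<circ> ((+) (Suc n)))" for n
  proof (rule diagseq_holds)
    show "P n (s \<circ> r)" if "strict_mono r" "P n s" for n r s
      using that unfolding P_def by auto
  qed
  define u where "u = z \<circ> diagseq"
  have u: "u i \<in> interval a c" for i
    using z by (simp add: u_def)
  have dec: "(\<forall>i\<ge>Suc n. u i \<in> F n) \<or> (\<forall>i\<ge>Suc n. u i \<in> - F n)" for n
  proof -
    have *: "u (Suc n + i) = z ((diagseq \<circ> ((+) (Suc n))) i)" for i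
      by (simp add: u_def)
    have "(\<forall>i. u (Suc n + i) \<in> F n) \<or> (\<forall>i. u (Suc n + i) \<notin> F n)"
      using P[of n] unfolding P_def * .
    then show ?thesis
      unfolding le_iff_add by blast
  qed
  obtain I L where I: "\<And>k. I k \<in> interval a (u k)" "I \<longlonglongrightarrow> L"
    "\<And>F k. halfspace F \<Longrightarrow> (\<And>i. i \<ge> k \<Longrightarrow> u i \<in> F) \<Longrightarrow> L \<in> closure F"
    using lattice_liminf[of u a c] u by blast
  obtain J K where J: "\<And>k. J k \<in> interval c (u k)" "J \<longlonglongrightarrow> K"
    "\<And>F k. halfspace F \<Longrightarrow> (\<And>i. i \<ge> k \<Longrightarrow> u i \<in> F) \<Longrightarrow> K \<in> closure F"
    using lattice_liminf[of u c a] u interval_commute[of a c] by auto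
  have "L = K"
  proof (rule ccontr)
    assume "L \<noteq> K"
    then obtain i where i: "L \<in> interior (F i)" "K \<in> interior (- F i)"
      using F(2) by blast
    show False
    proof (cases "\<forall>j\<ge>Suc i. u j \<in> F i")
      case True
      then show False
        using J(3)[OF F(1)[of i], of "Suc i"] i(2) by (simp add: interior_complement)
    next
      case False
      then have "\<forall>j\<ge>Suc i. u j \<in> - F i"
        using dec by blast
      then have "L \<in> closure (- F i)"
        using I(3)[of "- F i" "Suc i"] F(1)[of i] by simp
      then show False
        using i(1) by (simp add: closure_complement)
    qed
  qed
  have dist_u: "dist (I k) (u k) \<le> dist (I k) (J k)" for k
    using dist_interval[OF u[of k]] dist_interval[OF I(1)[of k]] dist_interval[OF J(1)[of k]]
      dist_triangle[of a c "I k"] dist_triangle[of "I k" c "J k"] zero_le_dist[of "J k" "u k"]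
      dist_commute[of "u k" c] dist_commute[of "J k" c] by linarith
  have "(\<lambda>k. dist (I k) (J k)) \<longlonglongrightarrow> dist L K"
    by (intro tendsto_intros I J)
  moreover have "(\<lambda>k. dist (I k) L) \<longlonglongrightarrow> dist L L"
    by (intro tendsto_intros I)
  ultimately have lim: "(\<lambda>k. dist (I k) (J k) + dist (I k) L) \<longlonglongrightarrow> 0"
    using \<open>L = K\<close> tendsto_add by fastforce
  have "dist (u k) L \<le> dist (I k) (J k) + dist (I k) L" for k
    using dist_u[of k] dist_triangle3[of "u k" L "I k"] by linarith
  then have "(\<lambda>k. dist (u k) L) \<longlonglongrightarrow> 0"
    by (intro tendsto_sandwich[OF _ _ tendsto_const[of 0] lim] always_eventually allI) simp_all
  then have "u \<longlonglongrightarrow> L"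
    by (rule iffD2[OF tendsto_dist_iff])
  moreover have "L \<in> interval a c"
    using closed_sequentially[OF closed_interval _ \<open>u \<longlonglongrightarrow> L\<close>] u by blast
  ultimately show "\<exists>l\<in>interval a c. \<exists>r. strict_mono r \<and> (z \<circ> r) \<longlonglongrightarrow> l"
    using subseq_diagseq unfolding u_def by blast
qed

end

section \<open>The Roller compactification\<close>

lemma transverse_Compl [simp]:
  "transverse (- h) k \<longleftrightarrow> transverse h k" "transverse h (- k) \<longleftrightarrow> transverse h k"
  unfolding transverse_def double_compl by (simp_all only: conj_ac)

lemma transverse_sym: "transverse h k \<longleftrightarrow> transverse k h"
  unfolding transverse_def by (simp only: Int_commute conj_ac)

lemma topspace_roller: "topspace roller_product = {x. \<forall>a b. x (a, b) \<in> interval a b}"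
  unfolding roller_product_def by (auto simp: PiE_def Pi_def extensional_def split: prod.splits)

context median_metric
begin

lemma roller_embed_topspace: "roller_embed x \<in> topspace roller_product" for x :: 'x
  unfolding topspace_roller roller_embed_def using median_in(3) by auto

lemma openin_roller_near:
  fixes x :: "'x roller"
  assumes "finite P"
  shows "openin roller_product {y \<in> topspace roller_product. \<forall>p\<in>P. dist (y p) (x p) < e}"
proof -
  have "openin roller_product {y \<in> topspace roller_product. y p \<in> ball (x p) e}" for p
  proof (rule openin_continuous_map_preimage)
    have "continuous_map roller_product (top_of_set (interval (fst p) (snd p))) (\<lambda>y. y p)"
      unfolding roller_product_def
      using continuous_map_product_projection[of p UNIV "\<lambda>(a, b). top_of_set (interval a b)"]
      by (simp add: case_prod_beta)
    then show "continuous_map roller_product euclidean (\<lambda>y. y p)"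
      by (rule continuous_map_into_fulltopology)
  qed auto
  then have "openin roller_product (topspace roller_product \<inter> (\<Inter>p\<in>P. {y \<in> topspace roller_product. y p \<in> ball (x p) e}))"
    using assms by (cases "P = {}") (auto intro!: openin_Int openin_INT2)
  moreover have "topspace roller_product \<inter> (\<Inter>p\<in>P. {y \<in> topspace roller_product. y p \<in> ball (x p) e}) =
      {y \<in> topspace roller_product. \<forall>p\<in>P. dist (y p) (x p) < e}"
    by (auto simp: dist_commute)
  ultimately show ?thesis
    by simp
qed

lemma openin_roller_basis:
  fixes x :: "'x roller"
  assumes "openin roller_product U" "x \<in> U"
  shows "\<exists>P e. finite P \<and> e > 0 \<and> {y \<in> topspace roller_product. \<forall>p\<in>P. dist (y p) (x p) < e} \<subseteq> U"
proof -
  let ?T = "\<lambda>(a, b). top_of_set (interval a b) :: 'x topology"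
  have "\<exists>V. finite {i \<in> UNIV. V i \<noteq> topspace (?T i)} \<and> (\<forall>i\<in>UNIV. openin (?T i) (V i)) \<and>
      x \<in> Pi\<^sub>E UNIV V \<and> Pi\<^sub>E UNIV V \<subseteq> U"
    using assms unfolding roller_product_def openin_product_topology_alt by blast
  then obtain V where V: "finite {i. V i \<noteq> topspace (?T i)}" "\<And>i. openin (?T i) (V i)"
    "x \<in> Pi\<^sub>E UNIV V" "Pi\<^sub>E UNIV V \<subseteq> U"
    by auto
  let ?P = "{i. V i \<noteq> topspace (?T i)}"
  have "\<exists>e>0. \<forall>z \<in> topspace (?T i). dist z (x i) < e \<longrightarrow> z \<in> V i" for i
  proof -
    obtain W where W: "open W" "V i = W \<inter> topspace (?T i)"
      using V(2)[of i] by (cases i) (auto simp: openin_open)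
    have "x i \<in> W"
      using V(3) W(2) by auto
    then obtain e where "e > 0" "\<forall>z. dist z (x i) < e \<longrightarrow> z \<in> W"
      using W(1) unfolding open_dist by blast
    then show ?thesis
      unfolding W(2) by (intro exI[of _ e]) simp
  qed
  then obtain e where e: "\<And>i. e i > 0" "\<And>i z. z \<in> topspace (?T i) \<Longrightarrow> dist z (x i) < e i \<Longrightarrow> z \<in> V i"
    by metis
  define d where "d = Min (insert 1 (e ` ?P))"
  have d: "d > 0" "\<And>i. i \<in> ?P \<Longrightarrow> d \<le> e i"
    unfolding d_def using V(1) e(1) by auto
  have "{y \<in> topspace roller_product. \<forall>p\<in>?P. dist (y p) (x p) < d} \<subseteq> Pi\<^sub>E UNIV V"
  proof
    fix y assume y: "y \<in> {y \<in> topspace roller_product. \<forall>p\<in>?P. dist (y p) (x p) < d}"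
    have "y (a, b) \<in> interval a b" for a b
      using y by (simp add: topspace_roller)
    then have yT: "y i \<in> topspace (?T i)" for i
      by (cases i) simp
    have "y i \<in> V i" for i
    proof (cases "i \<in> ?P")
      case True
      note yT
      moreover have "dist (y i) (x i) < e i"
      proof (rule less_le_trans)
        have "\<forall>p\<in>?P. dist (y p) (x p) < d"
          using y by simp
        then show "dist (y i) (x i) < d"
          using True by (rule bspec)
      qed (rule d(2)[OF True])
      ultimately show ?thesis
        by (rule e(2))
    next
      case False
      then have "V i = topspace (?T i)"
        by simp
      then show ?thesis
        using yT by simp
    qed
    then show "y \<in> Pi\<^sub>E UNIV V"
      by auto
  qed
  then show ?thesis
    using V(1,4) d(1) by (intro exI[of _ ?P] exI[of _ d]) auto
qed

text \<open>
  In the product topology only finitely many coordinates matter. Membership in the product is automatic because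
  intervals are closed.
\<close>

lemma roller_closure_iff:
  fixes A :: "'x set"
  shows "x \<in> roller_product closure_of (roller_embed ` A) \<longleftrightarrow>
    (\<forall>P e. finite P \<longrightarrow> e > 0 \<longrightarrow> (\<exists>y\<in>A. \<forall>(a, b)\<in>P. dist (median y a b) (x (a, b)) < e))"
proof
  assume x: "x \<in> roller_product closure_of (roller_embed ` A)"
  show "\<forall>P e. finite P \<longrightarrow> e > 0 \<longrightarrow> (\<exists>y\<in>A. \<forall>(a, b)\<in>P. dist (median y a b) (x (a, b)) < e)"
  proof (intro allI impI)
    fix P :: "('x \<times> 'x) set" and e :: real assume "finite P" "e > 0"
    let ?U = "{y \<in> topspace roller_product. \<forall>p\<in>P. dist (y p) (x p) < e}"
    have "x \<in> ?U"
      using x \<open>e > 0\<close> by (simp add: in_closure_of)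
    then obtain y where "y \<in> roller_embed ` A" "y \<in> ?U"
      using x openin_roller_near[OF \<open>finite P\<close>, of x e] unfolding in_closure_of by meson
    then have "y \<in> roller_embed ` A" "\<forall>p\<in>P. dist (y p) (x p) < e"
      by simp_all
    then show "\<exists>y\<in>A. \<forall>(a, b)\<in>P. dist (median y a b) (x (a, b)) < e"
      unfolding roller_embed_def by fastforce
  qed
next
  assume *: "\<forall>P e. finite P \<longrightarrow> e > 0 \<longrightarrow> (\<exists>y\<in>A. \<forall>(a, b)\<in>P. dist (median y a b) (x (a, b)) < e)"
  have "x (a, b) \<in> interval a b" for a b
  proof -
    have "x (a, b) \<in> closure (interval a b)"
      unfolding closure_approachable
    proof (intro allI impI)
      fix e :: real assume "e > 0"
      then obtain y where "dist (median y a b) (x (a, b)) < e"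
        using *[rule_format, of "{(a, b)}" e] by auto
      then show "\<exists>y\<in>interval a b. dist y (x (a, b)) < e"
        using median_in(3) by blast
    qed
    then show ?thesis
      using closed_interval by (simp add: closure_closed)
  qed
  then have "x \<in> topspace roller_product"
    by (simp add: topspace_roller)
  moreover have "\<exists>y. y \<in> roller_embed ` A \<and> y \<in> U" if U: "x \<in> U" "openin roller_product U" for U
  proof -
    obtain P e where P: "finite P" "e > 0"
      "{y \<in> topspace roller_product. \<forall>p\<in>P. dist (y p) (x p) < e} \<subseteq> U"
      using openin_roller_basis[OF U(2,1)] by blast
    obtain y where y: "y \<in> A" "\<forall>(a, b)\<in>P. dist (median y a b) (x (a, b)) < e"
      using * P(1,2) by blast
    have "roller_embed y \<in> {y \<in> topspace roller_product. \<forall>p\<in>P. dist (y p) (x p) < e}"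
      using y(2) roller_embed_topspace[of y] by (auto simp: roller_embed_def)
    then show ?thesis
      using P(3) y(1) by blast
  qed
  ultimately show "x \<in> roller_product closure_of (roller_embed ` A)"
    unfolding in_closure_of by blast
qed

lemma roller_compactification_iff:
  "x \<in> roller_compactification \<longleftrightarrow>
    (\<forall>P e. finite P \<longrightarrow> e > 0 \<longrightarrow> (\<exists>y. \<forall>(a, b)\<in>P. dist (median y a b) (x (a, b)) < e))"
  for x :: "'x roller"
  unfolding roller_compactification_def roller_closure_iff by simp

lemma roller_embed_in: "roller_embed x \<in> roller_compactification" for x :: 'x
  unfolding roller_compactification_iff roller_embed_def by (auto intro!: exI[of _ x])

lemma roller_compactification_in_interval:
  "x \<in> roller_compactification \<Longrightarrow> x (a, b) \<in> interval a b" for x :: "'x roller"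
proof -
  assume "x \<in> roller_compactification"
  then have "x \<in> topspace roller_product"
    unfolding roller_compactification_def in_closure_of by (rule conjunct1)
  then show ?thesis
    unfolding topspace_roller by simp
qed

end

lemma (in finite_rank_median) compact_roller_product: "compact_space (roller_product :: 'x roller topology)"
  unfolding roller_product_def compact_space_product_topology
  by (auto simp: compact_space_subtopology compactin_euclidean_iff compact_interval)

section \<open>Flipping and skewering halfspaces\<close>

locale median_action = finite_rank_median X_type for X_type :: "'x::polish_space itself" +
  fixes act :: "'g::topological_group_add \<Rightarrow> 'x \<Rightarrow> 'x"
  assumes action: "continuous_isometric_action act (UNIV :: 'x set) dist"
begin

lemma act_zero [simp]: "act 0 x = x"
  and act_add: "act (g + h) x = act g (act h x)"
  and act_dist [simp]: "dist (act g x) (act g y) = dist x y"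
  using action unfolding continuous_isometric_action_def action_on_def by auto

lemma act_minus [simp]: "act (- g) (act g x) = x" "act g (act (- g) x) = x"
  by (simp_all flip: act_add)

lemma act_eq_iff: "act g x = y \<longleftrightarrow> x = act (- g) y"
  by auto

lemma act_interval: "act g c \<in> interval (act g a) (act g b) \<longleftrightarrow> c \<in> interval a b"
  by (simp add: in_interval)

lemma act_median: "act g (median x y z) = median (act g x) (act g y) (act g z)"
  by (rule sym, rule median_unique) (simp_all add: act_interval median_in)

lemma in_act_image: "x \<in> act g ` S \<longleftrightarrow> act (- g) x \<in> S"
  by (metis act_minus image_iff)

lemma act_image_comp: "act g ` act k ` S = act (g + k) ` S"
  unfolding set_eq_iff in_act_image by (simp add: minus_add act_add del: add_uminus_conv_diff)

lemma act_image_zero [simp]: "act 0 ` S = S"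
  by auto

lemma act_image_Compl: "act g ` (- S) = - (act g ` S)"
  by (simp add: set_eq_iff in_act_image)

lemma act_image_Int: "act g ` (S \<inter> T) = act g ` S \<inter> act g ` T"
  by (simp add: set_eq_iff in_act_image)

lemma act_image_mono: "act g ` S \<subseteq> act g ` T \<longleftrightarrow> S \<subseteq> T"
  by (metis act_image_comp act_image_zero image_mono left_minus)

lemma act_convex: "median_convex S \<Longrightarrow> median_convex (act g ` S)"
  unfolding median_convex_def
proof (intro ballI subsetI)
  fix a b c assume S: "\<forall>a\<in>S. \<forall>b\<in>S. interval a b \<subseteq> S" and ab: "a \<in> act g ` S" "b \<in> act g ` S"
    and "c \<in> interval a b"
  then have "act (- g) c \<in> interval (act (- g) a) (act (- g) b)"
    by (simp add: act_interval)
  then show "c \<in> act g ` S"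
    using S ab unfolding in_act_image by blast
qed

lemma act_halfspace [simp]: "halfspace (act g ` h) \<longleftrightarrow> halfspace h"
proof -
  have "halfspace (act g ` h)" if "halfspace h" for g h
    using that act_convex unfolding halfspace_def by (metis act_image_Compl)
  from this[of h g] this[of "act g ` h" "- g"] show ?thesis
    by (auto simp: act_image_comp)
qed

lemma act_open: "open U \<Longrightarrow> open (act g ` U)"
  unfolding open_dist by (metis act_dist act_minus(2) in_act_image)

lemma act_interior: "act g ` interior S \<subseteq> interior (act g ` S)"
  by (intro interior_maximal image_mono interior_subset act_open open_interior)

lemma act_thick [simp]: "thick (act g ` h) \<longleftrightarrow> thick h"
proof -
  have "thick (act g ` h)" if "thick h" for g h
    using that act_interior[of g h] act_interior[of g "- h"] unfolding thick_def act_image_Compl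
    by (auto simp flip: act_image_Compl)
  from this[of h g] this[of "act g ` h" "- g"] show ?thesis
    by (auto simp: act_image_comp)
qed

lemma act_transverse [simp]: "transverse (act g ` h) (act g ` k) \<longleftrightarrow> transverse h k"
  unfolding transverse_def by (simp flip: act_image_Compl act_image_Int)

lemma roller_act_in:
  assumes "x \<in> roller_compactification"
  shows "roller_act act g x \<in> roller_compactification"
  unfolding roller_compactification_iff
proof (intro allI impI)
  fix P :: "('x \<times> 'x) set" and e :: real assume "finite P" "e > 0"
  moreover have "finite ((\<lambda>(a, b). (act (- g) a, act (- g) b)) ` P)"
    using \<open>finite P\<close> by simp
  ultimately obtain y where y: "\<forall>(a, b)\<in>(\<lambda>(a, b). (act (- g) a, act (- g) b)) ` P. dist (median y a b) (x (a, b)) < e"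
    using assms unfolding roller_compactification_iff by blast
  have "dist (median (act g y) a b) (roller_act act g x (a, b)) < e" if "(a, b) \<in> P" for a b
  proof -
    have "median (act g y) a b = act g (median y (act (- g) a) (act (- g) b))"
      by (simp add: act_median)
    then show ?thesis
      using y that by (auto simp: roller_act_def)
  qed
  then show "\<exists>y. \<forall>(a, b)\<in>P. dist (median y a b) (roller_act act g x (a, b)) < e"
    by blast
qed

end

locale minimal_median_action = median_action X_type act
  for X_type :: "'x::polish_space itself" and act :: "'g::topological_group_add \<Rightarrow> 'x \<Rightarrow> 'x" +
  assumes minimal: "roller_minimal act"
begin

text \<open>
  If all translates of \<open>h\<close> met each other, then by the Helly property and compactness the closures of the
  translates in the Roller compactification would have a common point. The set of all common points is
  closed, convex and invariant, hence everything; but a point of the interior of \<open>- h\<close> is not in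
  the closure of \<open>h\<close>.
\<close>

lemma flip:
  assumes h: "halfspace h" "h \<noteq> {}" "interior (- h) \<noteq> {}"
  shows "\<exists>g. act g ` h \<inter> h = {}"
proof (rule ccontr)
  assume "\<nexists>g. act g ` h \<inter> h = {}"
  then have meet: "act g ` h \<inter> act k ` h \<noteq> {}" for g k
  proof -
    have "act g ` h \<inter> act k ` h = act k ` (act (- k + g) ` h \<inter> h)"
      by (simp only: act_image_Int act_image_comp) (simp flip: add.assoc)
    then show ?thesis
      using \<open>\<nexists>g. act g ` h \<inter> h = {}\<close> by simp
  qed
  define K where "K g = roller_product closure_of (roller_embed ` act g ` h)" for g
  define C where "C = (\<Inter>g. K g)"
  have conv: "median_convex (act g ` h)" for g
    using h(1) act_convex by (auto simp: halfspace_def)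
  have K_iff: "x \<in> K g \<longleftrightarrow> (\<forall>P e. finite P \<longrightarrow> e > 0 \<longrightarrow>
      (\<exists>y\<in>act g ` h. \<forall>(a, b)\<in>P. dist (median y a b) (x (a, b)) < e))" for x g
    unfolding K_def roller_closure_iff ..
  have K_sub: "K g \<subseteq> roller_compactification" for g
    unfolding K_def roller_compactification_def by (intro closure_of_mono) auto
  have closed: "closedin roller_product (K g)" for g
    unfolding K_def by (rule closedin_closure_of)
  have "C \<noteq> {}"
    unfolding C_def
  proof (rule compact_space_fip[THEN iffD1, OF compact_roller_product, rule_format], intro conjI ballI allI impI)
    fix L assume "L \<in> range K"
    then show "closedin roller_product L"
      using closed by blast
  next
    fix \<F> assume "finite \<F> \<and> \<F> \<subseteq> range K"
    then obtain F where F: "finite F" "\<F> = K ` F"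
      by (meson finite_subset_image)
    show "\<Inter>\<F> \<noteq> {}"
    proof (cases "F = {}")
      case False
      have "\<Inter>((\<lambda>g. act g ` h) ` F) \<noteq> {}"
        by (rule helly) (use F False conv meet in auto)
      then obtain x where x: "x \<in> act g ` h" if "g \<in> F" for g
        by blast
      have "roller_embed x \<in> K g" if "g \<in> F" for g
        unfolding K_iff using x[OF that] by (intro allI impI bexI[of _ x]) (auto simp: roller_embed_def)
      then show ?thesis
        using F by blast
    qed (use F in simp)
  qed
  moreover have "closedin roller_topology C"
  proof -
    have "closedin roller_product C"
      unfolding C_def using closed by (intro closedin_Inter) auto
    moreover have "C \<subseteq> roller_compactification"
      using K_sub unfolding C_def by blast
    ultimately show ?thesis
      unfolding roller_topology_def by (metis closedin_closed_subtopology closedin_subset_topspace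
          closedin_subtopology inf.orderE)
  qed
  moreover have "roller_convex C"
    unfolding roller_convex_def C_def
  proof (intro ballI subsetI INT_I)
    fix x y z g assume xy: "x \<in> (\<Inter>g. K g)" "y \<in> (\<Inter>g. K g)" and z: "z \<in> roller_interval x y"
    show "z \<in> K g"
      unfolding K_iff
    proof (intro allI impI)
      fix P :: "('x \<times> 'x) set" and e :: real assume P: "finite P" "e > 0"
      have "e / 3 > 0"
        using P by simp
      obtain ux where ux: "ux \<in> act g ` h" "\<forall>(a, b)\<in>P. dist (median ux a b) (x (a, b)) < e / 3"
        using xy(1) K_iff[of x g] P(1) \<open>e / 3 > 0\<close> by blast
      obtain uy where uy: "uy \<in> act g ` h" "\<forall>(a, b)\<in>P. dist (median uy a b) (y (a, b)) < e / 3"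
        using xy(2) K_iff[of y g] P(1) \<open>e / 3 > 0\<close> by blast
      obtain uz where uz: "\<forall>(a, b)\<in>P. dist (median uz a b) (z (a, b)) < e / 3"
        using z roller_compactification_iff[of z] P(1) \<open>e / 3 > 0\<close> unfolding roller_interval_def by blast
      have "dist (median (median ux uy uz) a b) (z (a, b)) < e" if "(a, b) \<in> P" for a b
      proof -
        have "z (a, b) = median (x (a, b)) (y (a, b)) (z (a, b))"
          using z by (auto simp: roller_interval_def roller_median_def fun_eq_iff)
        then have "dist (median (median ux uy uz) a b) (z (a, b)) \<le>
            dist (median ux a b) (x (a, b)) + dist (median uy a b) (y (a, b)) + dist (median uz a b) (z (a, b))"
          using median_lipschitz3 unfolding gate_median[of ux uy uz a b] by metis
        then show ?thesis
          using ux(2) uy(2) uz that by fastforce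
      qed
      moreover have "median ux uy uz \<in> act g ` h"
        using convex_median(1)[OF conv ux(1) uy(1)] .
      ultimately show "\<exists>y\<in>act g ` h. \<forall>(a, b)\<in>P. dist (median y a b) (z (a, b)) < e"
        by blast
    qed
  qed
  moreover have "roller_act act g x \<in> C" if "x \<in> C" for g x
    unfolding C_def
  proof (intro INT_I)
    fix k
    show "roller_act act g x \<in> K k"
      unfolding K_iff
    proof (intro allI impI)
      fix P :: "('x \<times> 'x) set" and e :: real assume P: "finite P" "e > 0"
      let ?P = "(\<lambda>(a, b). (act (- g) a, act (- g) b)) ` P"
      have "x \<in> K (- g + k)"
        using that unfolding C_def by blast
      moreover have "finite ?P"
        using P(1) by simp
      ultimately obtain y where y: "y \<in> act (- g + k) ` h" "\<forall>(a, b)\<in>?P. dist (median y a b) (x (a, b)) < e"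
        using K_iff[of x "- g + k"] P(2) by blast
      have "dist (median (act g y) a b) (roller_act act g x (a, b)) < e" if "(a, b) \<in> P" for a b
      proof -
        have "median (act g y) a b = act g (median y (act (- g) a) (act (- g) b))"
          by (simp add: act_median)
        then show ?thesis
          using y(2) that by (auto simp: roller_act_def)
      qed
      moreover have "act g y \<in> act k ` h"
        using y(1) unfolding in_act_image by (simp add: minus_add act_add del: add_uminus_conv_diff)
      ultimately show "\<exists>y\<in>act k ` h. \<forall>(a, b)\<in>P. dist (median y a b) (roller_act act g x (a, b)) < e"
        by blast
    qed
  qed
  ultimately have C: "C = roller_compactification"
    using minimal unfolding roller_minimal_def by blast
  obtain y where y: "y \<in> interior (- h)"
    using h(3) by blast
  then obtain e where e: "e > 0" "ball y e \<subseteq> - h"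
    using mem_interior by blast
  obtain c where c: "c \<in> h"
    using h(2) by blast
  have "roller_embed y \<in> K 0"
    using C roller_embed_in[of y] unfolding C_def by blast
  then obtain u where u: "u \<in> h" "dist (median u y c) (roller_embed y (y, c)) < e"
    using e(1) unfolding K_iff by (auto dest!: spec[of _ "{(y, c)}"])
  have "median u y c \<in> h"
    using u(1) c h(1) by (simp add: halfspace_median)
  moreover have "median u y c \<in> ball y e"
    using u(2) by (simp add: roller_embed_def dist_commute)
  ultimately show False
    using e(2) by blast
qed

text \<open>
  A flip of \<open>k\<close> moves it into \<open>- h\<close>, which a flip moves into \<open>h\<close>.
\<close>

lemma skewer:
  assumes "thick h" "thick k" "h \<subseteq> k"
  shows "\<exists>g. act g ` k \<subseteq> h"
proof -
  obtain g1 where g1: "act g1 ` k \<inter> k = {}"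
    using flip[of k] assms(2) thick_nonempty[OF assms(2)] by (auto simp: thick_def)
  obtain g2 where g2: "act g2 ` (- h) \<inter> - h = {}"
    using flip[of "- h"] assms(1) thick_nonempty[OF assms(1)] by (auto simp: thick_def)
  have "act g1 ` k \<subseteq> - h"
    using g1 assms(3) by blast
  then have "act (g2 + g1) ` k \<subseteq> act g2 ` (- h)"
    by (simp add: act_image_mono flip: act_image_comp)
  then show ?thesis
    using g2 by blast
qed

end

context median_action
begin

definition iter :: "'g \<Rightarrow> nat \<Rightarrow> 'g" where
  "iter g n = ((+) g ^^ n) 0"

lemma iter_simps [simp]: "iter g 0 = 0" "iter g (Suc n) = g + iter g n"
  by (simp_all add: iter_def)

lemma iter_add: "iter g (m + n) = iter g m + iter g n"
  by (induction m) (simp_all add: add.assoc)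

text \<open>Otherwise the translates of \<open>w\<close> by powers of \<open>g\<close> would be an infinite transverse family.\<close>

lemma power_nontransverse:
  assumes "halfspace w"
  shows "\<exists>m>0. \<not> transverse (act (iter g m) ` w) w"
proof (rule ccontr)
  assume neg: "\<not> ?thesis"
  have tr: "transverse (act (iter g n) ` w) (act (iter g m) ` w)" if mn: "m < n" for m n
  proof -
    obtain k where k: "n = m + k" "k > 0"
      using less_imp_add_positive[OF mn] by auto
    have "act (iter g n) ` w = act (iter g m) ` act (iter g k) ` w"
      by (simp add: k(1) iter_add act_image_comp)
    then show ?thesis
      using neg[unfolded not_ex, rule_format, of k] k(2) by simp
  qed
  have tr': "transverse (act (iter g n) ` w) (act (iter g m) ` w)" if "m \<noteq> n" for m n
    using tr[of m n] tr[of n m] that transverse_sym by (metis linorder_neqE_nat)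
  let ?f = "\<lambda>n. act (iter g n) ` w"
  have "\<not> transverse A A" for A :: "'x set"
    by (simp add: transverse_def)
  then have "inj ?f"
    using tr' unfolding inj_def by metis
  then have "infinite (range ?f)"
    by (rule range_inj_infinite)
  moreover have "pairwise transverse (range ?f)"
  proof (rule pairwiseI)
    fix A B assume "A \<in> range ?f" "B \<in> range ?f" "A \<noteq> B"
    then obtain m n where "A = ?f m" "B = ?f n" "n \<noteq> m"
      by (elim rangeE) metis
    then show "transverse A B"
      using tr' by simp
  qed
  moreover have "halfspace h" if "h \<in> range ?f" for h
    using that assms by (elim rangeE) simp
  ultimately show False
    using no_infinite_transverse by blast
qed

end

section \<open>Product decompositions\<close>

text \<open>
  Suppose that the thick halfspaces fall into two classes \<open>K\<close> and \<open>L\<close> such that each member of the one is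
  transverse to each member of the other. The fiber through \<open>x\<close> consists of the points that no
  halfspace in \<open>L\<close> separates from \<open>x\<close>, up to closure; exchanging \<open>K\<close> and \<open>L\<close> gives the other fiber
  through \<open>x\<close>. The space is the product of the two fibers through any point.
\<close>

locale thick_partition = finite_rank_median X_type for X_type :: "'x::polish_space itself" +
  fixes K L :: "'x set set"
  assumes K_Un_L: "h \<in> K \<or> h \<in> L \<longleftrightarrow> thick h"
    and disjoint: "K \<inter> L = {}"
    and K_Compl: "h \<in> K \<Longrightarrow> - h \<in> K"
    and L_Compl: "h \<in> L \<Longrightarrow> - h \<in> L"
    and K_L_transverse: "h \<in> K \<Longrightarrow> k \<in> L \<Longrightarrow> transverse h k"
begin

lemma swap: "thick_partition L K"
proof -
  have "thick_partition_axioms L K"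
    using K_Un_L disjoint K_Compl L_Compl K_L_transverse unfolding thick_partition_axioms_def
    by (metis Int_commute transverse_sym)
  then show ?thesis
    using finite_rank_median_axioms by (simp add: thick_partition_def)
qed

definition fiber :: "'x \<Rightarrow> 'x set" where
  "fiber x = \<Inter>(closure ` {h \<in> L. x \<in> h})"

lemma fiber_closed: "closed (fiber x)"
  unfolding fiber_def by auto

lemma fiber_convex: "median_convex (fiber x)"
proof -
  have "halfspace h" if "h \<in> L" for h
    using that K_Un_L thick_halfspace by blast
  then show ?thesis
    unfolding fiber_def by (intro convex_Inter) (auto intro!: closure_convex simp: halfspace_def)
qed

lemma fiber_self: "x \<in> fiber x"
  unfolding fiber_def using closure_subset by blast

lemma fiber_sub: "h \<in> L \<Longrightarrow> x \<in> h \<Longrightarrow> fiber x \<subseteq> closure h"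
  unfolding fiber_def by blast

lemmas proj_fiber = proj[OF fiber_closed fiber_convex]

lemma proj_fiber_in: "proj (fiber x) y \<in> fiber x"
  using proj_fiber(1) fiber_self by blast

lemma proj_fiber_between: "w \<in> fiber x \<Longrightarrow> proj (fiber x) y \<in> interval y w"
  using proj_fiber(2) by blast

lemma separate_closure: "v \<in> interior (- h) \<Longrightarrow> v \<notin> closure h" for h :: "'x set"
  by (simp add: interior_complement)

text \<open>
  A member of \<open>L\<close> or its complement has the whole fiber in its closure, namely the one that contains \<open>x\<close>.
\<close>

lemma fiber_separator:
  assumes "u \<in> fiber x" "v \<in> fiber x" "thick h" "u \<in> interior h" "v \<in> interior (- h)"
  shows "h \<in> K"
proof (rule ccontr)
  assume "h \<notin> K"
  then have h: "h \<in> L" "- h \<in> L"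
    using assms(3) K_Un_L L_Compl by blast+
  show False
  proof (cases "x \<in> h")
    case True
    then show False
      using fiber_sub[OF h(1)] assms(2,5) separate_closure by blast
  next
    case False
    then show False
      using fiber_sub[OF h(2)] assms(1,4) separate_closure[of u "- h"] by auto
  qed
qed

text \<open>
  A halfspace \<open>h\<close> in \<open>K\<close> that contains \<open>y\<close> meets every halfspace in \<open>L\<close> that contains \<open>x\<close>, and by projection
  to \<open>interval x y\<close> it does so within this compact interval. So \<open>closure h\<close> meets the fiber.
\<close>

lemma proj_fiber_closure:
  assumes h: "h \<in> K" "y \<in> h"
  shows "proj (fiber x) y \<in> closure h"
proof -
  let ?L = "{k \<in> L. x \<in> k}"
  have hs: "halfspace k" if "k \<in> insert h ?L" for k
    using that h(1) K_Un_L thick_halfspace by blast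
  have "interval x y \<inter> \<Inter>(closure ` insert h ?L) \<noteq> {}"
  proof (rule compact_imp_fip[OF compact_interval])
    fix \<F> assume "finite \<F>" "\<F> \<subseteq> closure ` insert h ?L"
    then obtain G where G: "finite G" "G \<subseteq> insert h ?L" "\<F> = closure ` G"
      by (meson finite_subset_image)
    have "\<Inter>((\<lambda>k. k \<inter> interval x y) ` insert h G) \<noteq> {}"
    proof (rule helly)
      fix A B assume "A \<in> (\<lambda>k. k \<inter> interval x y) ` insert h G" "B \<in> (\<lambda>k. k \<inter> interval x y) ` insert h G"
      then obtain k l where kl: "k \<in> insert h G" "A = k \<inter> interval x y" "l \<in> insert h G" "B = l \<inter> interval x y"
        by blast
      have cross: "h \<inter> k \<inter> interval x y \<noteq> {}" if k: "k \<in> ?L" for k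
      proof -
        obtain z where z: "z \<in> h" "z \<in> k"
          using K_L_transverse[OF h(1), of k] k unfolding transverse_def by blast
        have "median x y z \<in> h" "median x y z \<in> k"
          using z h(2) k hs[of h] hs[of k] by (auto simp: halfspace_median)
        then show ?thesis
          using median_in(1) by blast
      qed
      have k: "k = h \<or> k \<in> ?L" and l: "l = h \<or> l \<in> ?L"
        using kl G(2) by blast+
      have "k \<inter> l \<inter> interval x y \<noteq> {}"
      proof (cases "k = h")
        case True
        then show ?thesis
          using l cross[of l] h(2) endpoints_in(2)[of y x] by blast
      next
        case False
        then have "k \<in> ?L"
          using k by blast
        then show ?thesis
          using l cross[of k] endpoints_in(1)[of x y] by blast
      qed
      then show "A \<inter> B \<noteq> {}"
        using kl by blast
    next
      fix A assume "A \<in> (\<lambda>k. k \<inter> interval x y) ` insert h G"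
      then obtain k where "k \<in> insert h ?L" "A = k \<inter> interval x y"
        using G(2) by blast
      then show "median_convex A"
        using hs[of k] median_convex_interval convex_Int unfolding halfspace_def by blast
    qed (use G(1) in auto)
    then obtain w where "\<forall>k\<in>insert h G. w \<in> k \<inter> interval x y"
      by blast
    then have "w \<in> interval x y" "\<forall>k\<in>G. w \<in> closure k"
      using closure_subset by auto
    then show "interval x y \<inter> \<Inter>\<F> \<noteq> {}"
      unfolding G(3) by blast
  qed auto
  then obtain w where w: "w \<in> closure h" "w \<in> fiber x"
    unfolding fiber_def by auto
  have "median_convex (closure h)"
    using hs[of h] closure_convex by (auto simp: halfspace_def)
  moreover have "y \<in> closure h"
    using h(2) closure_subset by blast
  ultimately show ?thesis
    using convex_interval w(1) proj_fiber_between[OF w(2), of y] by blast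
qed

lemma proj_fiber_separator:
  assumes "thick h" "y \<in> interior h" "proj (fiber x) y \<in> interior (- h)"
  shows "h \<in> L"
proof (rule ccontr)
  assume "h \<notin> L"
  then have "proj (fiber x) y \<in> closure h"
    using assms(1,2) K_Un_L proj_fiber_closure interior_subset by blast
  then show False
    using assms(3) separate_closure by blast
qed

text \<open>
  A halfspace that separates two points of a fiber is in \<open>K\<close>, and the projection to another fiber does not lead across
  members of \<open>K\<close>.
\<close>

lemma proj_fiber_back:
  assumes "y \<in> fiber x"
  shows "proj (fiber x) (proj (fiber c) y) = y"
proof (rule ccontr)
  let ?p = "proj (fiber c) y"
  let ?u = "proj (fiber x) ?p"
  assume "?u \<noteq> y"
  then obtain h where h: "thick h" "\<And>w. median w ?u y = ?u \<Longrightarrow> w \<in> interior h"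
    "\<And>w. median w ?u y = y \<Longrightarrow> w \<in> interior (- h)"
    using thick_separation by metis
  have "h \<in> K"
    using fiber_separator[OF proj_fiber_in assms h(1)] h(2)[of ?u] h(3)[of y] by simp
  have "?p \<in> interior h"
    using h(2) median_proj[OF fiber_closed fiber_convex assms] by blast
  moreover have "y \<in> - h"
    using h(3)[of y] interior_subset by auto
  then have "?p \<in> closure (- h)"
    using proj_fiber_closure K_Compl[OF \<open>h \<in> K\<close>] by blast
  ultimately show False
    by (simp add: closure_complement)
qed

text \<open>
  A halfspace separating the projections also separates the points, so it is in \<open>L\<close>; but as it separates two
  points of a fiber it is in \<open>K\<close>.
\<close>

lemma proj_fiber_eq:
  assumes "\<And>h. thick h \<Longrightarrow> y \<in> interior h \<Longrightarrow> z \<in> interior (- h) \<Longrightarrow> h \<in> L"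
  shows "proj (fiber c) y = proj (fiber c) z"
proof (rule ccontr)
  let ?p = "proj (fiber c) y" and ?q = "proj (fiber c) z"
  assume "?p \<noteq> ?q"
  then obtain h where h: "thick h" "\<And>w. median w ?p ?q = ?p \<Longrightarrow> w \<in> interior h"
    "\<And>w. median w ?p ?q = ?q \<Longrightarrow> w \<in> interior (- h)"
    using thick_separation by metis
  have "h \<in> K"
    using fiber_separator[OF proj_fiber_in proj_fiber_in h(1)] h(2)[of ?p] h(3)[of ?q] by simp
  moreover have "y \<in> interior h"
    using h(2) median_proj[OF fiber_closed fiber_convex proj_fiber_in] by blast
  moreover have "z \<in> interior (- h)"
    using h(3) median_proj[OF fiber_closed fiber_convex proj_fiber_in] median_swap23 by metis
  ultimately show False
    using assms h(1) disjoint by blast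
qed

lemma proj_fiber_id: "y \<in> fiber x \<Longrightarrow> proj (fiber x) y = y"
  using proj_fiber_between[of y x y] by simp

lemma proj_fiber_isometric:
  assumes "y \<in> fiber x" "z \<in> fiber x"
  shows "dist (proj (fiber c) y) (proj (fiber c) z) = dist y z"
proof (rule antisym)
  have ne: "fiber a \<noteq> {}" for a
    using fiber_self by blast
  show "dist (proj (fiber c) y) (proj (fiber c) z) \<le> dist y z"
    by (rule proj_lipschitz[OF fiber_closed fiber_convex ne])
  show "dist y z \<le> dist (proj (fiber c) y) (proj (fiber c) z)"
    using proj_lipschitz[OF fiber_closed fiber_convex ne, of x "proj (fiber c) y" "proj (fiber c) z"]
    unfolding proj_fiber_back[OF assms(1)] proj_fiber_back[OF assms(2)] .
qed

lemma median_space_fiber: "median_space (fiber c) dist"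
proof -
  have "metric_interval (fiber c) dist x y = interval x y" if "x \<in> fiber c" "y \<in> fiber c" for x y
    using fiber_convex[of c] that unfolding median_convex_def by (auto simp: metric_interval_def)
  then show ?thesis
    unfolding median_space_def is_singleton_def using median_singleton
    by (auto simp: Metric_space_def dist_commute dist_triangle)
qed

end

context thick_partition
begin

interpretation other: thick_partition X_type L K
  by (rule swap)

text \<open>
  Between the two projections \<open>z, z'\<close> of \<open>y\<close> lie \<open>x\<close>, because the two fibers through \<open>x\<close> meet in \<open>x\<close> only, and \<open>y\<close>,
  because each halfspace containing \<open>y\<close> contains one of the projections, up to closure. So the four points form a
  rectangle.
\<close>

lemma fibers_rectangle:
  defines "z \<equiv> \<lambda>x y. proj (fiber x) y" and "z' \<equiv> \<lambda>x y. proj (other.fiber x) y"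
  shows "dist x y = dist x (z x y) + dist x (z' x y)"
proof -
  let ?z = "z x y" and ?z' = "z' x y"
  have zz: "?z \<in> fiber x" "?z' \<in> other.fiber x"
    unfolding z_def z'_def by (rule proj_fiber_in other.proj_fiber_in)+
  have "x \<in> interval ?z ?z'"
  proof (rule ccontr)
    let ?m = "median ?z ?z' x"
    assume "x \<notin> interval ?z ?z'"
    then have "x \<noteq> ?m"
      using median_in(1) by metis
    then obtain h where h: "thick h" "x \<in> interior h" "?m \<in> interior (- h)"
      using thick_separation by (metis median_same(1,2))
    then have "x \<in> h"
      using interior_subset by blast
    have "?m \<in> fiber x" "?m \<in> other.fiber x"
      using convex_interval[OF fiber_convex zz(1) fiber_self median_in(2)]
        convex_interval[OF other.fiber_convex zz(2) other.fiber_self median_in(3)] by blast+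
    then have "?m \<in> closure h"
      using fiber_sub[OF _ \<open>x \<in> h\<close>] other.fiber_sub[OF _ \<open>x \<in> h\<close>] K_Un_L[of h] h(1) by blast
    then show False
      using h(3) separate_closure by blast
  qed
  moreover have "y \<in> interval ?z ?z'"
  proof (rule ccontr)
    let ?m = "median ?z ?z' y"
    assume "y \<notin> interval ?z ?z'"
    then have "y \<noteq> ?m"
      using median_in(1) by metis
    then obtain h where h: "thick h" "y \<in> interior h" "?m \<in> interior (- h)"
      using thick_separation by (metis median_same(1,2))
    then have y: "y \<in> h" "y \<in> closure h"
      using interior_subset closure_subset by blast+
    have conv: "median_convex (closure h)"
      using thick_halfspace[OF h(1)] closure_convex by (auto simp: halfspace_def)
    have "?z \<in> closure h \<or> ?z' \<in> closure h"
      using proj_fiber_closure[OF _ y(1)] other.proj_fiber_closure[OF _ y(1)] K_Un_L[of h] h(1)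
      unfolding z_def z'_def by blast
    then have "?m \<in> closure h"
      using convex_interval[OF conv _ y(2) median_in(2)] convex_interval[OF conv _ y(2) median_in(3)] by blast
    then show False
      using h(3) separate_closure by blast
  qed
  moreover have "?z \<in> interval y x" "?z' \<in> interval y x"
    unfolding z_def z'_def
    by (rule proj_fiber_between[OF fiber_self]) (rule other.proj_fiber_between[OF other.fiber_self])
  ultimately have "dist ?z ?z' = dist ?z x + dist x ?z'" "dist ?z ?z' = dist ?z y + dist y ?z'"
    "dist y x = dist y ?z + dist ?z x" "dist y x = dist y ?z' + dist ?z' x"
    by (auto dest: dist_interval)
  then show ?thesis
    by (simp add: dist_commute)
qed

lemma product_dist:
  "dist x y = dist (proj (fiber c) x) (proj (fiber c) y) +
    dist (proj (other.fiber c) x) (proj (other.fiber c) y)"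
proof -
  let ?z = "proj (fiber x) y" and ?z' = "proj (other.fiber x) y"
  have "dist x ?z = dist (proj (fiber c) x) (proj (fiber c) ?z)"
    by (rule proj_fiber_isometric[OF fiber_self proj_fiber_in, symmetric])
  also have "proj (fiber c) ?z = proj (fiber c) y"
    by (rule proj_fiber_eq[symmetric]) (rule proj_fiber_separator)
  finally have 1: "dist x ?z = dist (proj (fiber c) x) (proj (fiber c) y)" .
  have "dist x ?z' = dist (proj (other.fiber c) x) (proj (other.fiber c) ?z')"
    by (rule other.proj_fiber_isometric[OF other.fiber_self other.proj_fiber_in, symmetric])
  also have "proj (other.fiber c) ?z' = proj (other.fiber c) y"
    by (rule other.proj_fiber_eq[symmetric]) (rule other.proj_fiber_separator)
  finally show ?thesis
    using 1 fibers_rectangle[of x y] by simp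
qed

lemma product_surj:
  assumes "a \<in> fiber c" "b \<in> other.fiber c"
  shows "\<exists>x. proj (fiber c) x = a \<and> proj (other.fiber c) x = b"
proof (intro exI conjI)
  \<comment> \<open>the corner over \<open>a\<close> and \<open>b\<close> of the rectangle at \<open>c\<close>\<close>
  let ?x = "proj (other.fiber a) b"
  have "proj (fiber c) ?x = proj (fiber c) a"
    by (rule proj_fiber_eq) (rule other.fiber_separator[OF other.proj_fiber_in other.fiber_self])
  then show "proj (fiber c) ?x = a"
    using proj_fiber_id[OF assms(1)] by simp
  have "proj (other.fiber c) b = proj (other.fiber c) ?x"
    by (rule other.proj_fiber_eq) (rule other.proj_fiber_separator)
  then show "proj (other.fiber c) ?x = b"
    using other.proj_fiber_id[OF assms(2)] by simp
qed

text \<open>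
  Otherwise the whole space would be the other fiber, and only members of \<open>L\<close> separate its points.
\<close>

lemma fiber_nonsingleton:
  assumes "K \<noteq> {}"
  shows "\<not> is_singleton (fiber c)"
proof
  assume "is_singleton (fiber c)"
  then have sing: "fiber c = {c}"
    using fiber_self[of c] by (auto simp: is_singleton_def)
  have "x \<in> other.fiber c" for x
  proof -
    let ?x = "proj (other.fiber c) x"
    have "dist x ?x = 0"
      using product_dist[of x ?x c] proj_fiber_in[of c] sing other.proj_fiber_id[OF other.proj_fiber_in]
      by simp
    then show ?thesis
      using other.proj_fiber_in[of c x] by simp
  qed
  moreover obtain h where h: "h \<in> K"
    using assms by blast
  moreover from this obtain u v where "u \<in> interior h" "v \<in> interior (- h)"
    using K_Un_L[of h] unfolding thick_def by blast
  ultimately have "h \<in> L"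
    using other.fiber_separator K_Un_L by blast
  then show False
    using h disjoint by blast
qed

lemma not_irreducible:
  assumes "K \<noteq> {}" "L \<noteq> {}"
  shows "\<not> irreducible_median_space (UNIV :: 'x set) dist"
proof
  assume irr: "irreducible_median_space (UNIV :: 'x set) dist"
  fix c :: 'x
  let ?f = "\<lambda>x. (proj (fiber c) x, proj (other.fiber c) x)"
  have "bij_betw ?f UNIV (fiber c \<times> other.fiber c)"
    unfolding bij_betw_def
  proof
    show "inj ?f"
    proof (rule injI)
      fix x y assume "?f x = ?f y"
      then have "dist x y = 0"
        using product_dist[of x y c] by simp
      then show "x = y"
        by simp
    qed
    show "range ?f = fiber c \<times> other.fiber c"
      using product_surj[of _ c] proj_fiber_in other.proj_fiber_in by (auto simp: image_iff) metis
  qed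
  moreover have "\<forall>x\<in>UNIV. \<forall>y\<in>UNIV. dist x y = dist (fst (?f x)) (fst (?f y)) + dist (snd (?f x)) (snd (?f y))"
    using product_dist by simp
  ultimately show False
    using irr median_space_fiber other.median_space_fiber fiber_nonsingleton[OF assms(1), of c]
      thick_partition.fiber_nonsingleton[OF swap assms(2), of c] unfolding irreducible_median_space_def by blast
qed

end

text \<open>
  Otherwise the connected component of \<open>h\<close> and its complement form a partition into two transverse classes.
\<close>

lemma (in finite_rank_median) nontransverse_connected:
  assumes "irreducible_median_space (UNIV :: 'x set) dist" "thick h" "thick k"
  shows "(h, k) \<in> {(a, b :: 'x set). thick a \<and> thick b \<and> \<not> transverse a b}\<^sup>*" (is "_ \<in> ?R\<^sup>*")
proof (rule ccontr)
  assume "(h, k) \<notin> ?R\<^sup>*"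
  let ?K = "{a. (h, a) \<in> ?R\<^sup>*}"
  let ?L = "{a. thick a} - ?K"
  have thickK: "thick a" if "a \<in> ?K" for a
  proof -
    have "(h, a) \<in> ?R\<^sup>*"
      using that by simp
    then show ?thesis
      by (induction rule: rtrancl_induct) (use assms(2) in auto)
  qed
  have step: "b \<in> ?K" if "a \<in> ?K" "thick b" "\<not> transverse a b" for a b
  proof -
    have "(a, b) \<in> ?R"
      using that thickK[OF that(1)] by simp
    then show ?thesis
      using that(1) by (auto intro: rtrancl_into_rtrancl)
  qed
  have compl: "\<not> transverse a (- a)" for a :: "'x set"
    by (simp add: transverse_def)
  have "thick_partition_axioms ?K ?L"
  proof
    show "- a \<in> ?K" if "a \<in> ?K" for a
      using step[OF that, of "- a"] thickK[OF that] compl by simp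
    then show "- a \<in> ?L" if "a \<in> ?L" for a
      using that by (metis (no_types, lifting) DiffD1 DiffD2 DiffI double_complement mem_Collect_eq thick_Compl)
    show "transverse a b" if "a \<in> ?K" "b \<in> ?L" for a b
      using step[OF that(1)] that(2) by blast
    show "a \<in> ?K \<or> a \<in> ?L \<longleftrightarrow> thick a" for a
      using thickK[of a] by blast
    show "?K \<inter> ?L = {}"
      by blast
  qed
  then interpret thick_partition X_type ?K ?L
    using finite_rank_median_axioms by (simp add: thick_partition_def)
  have "h \<in> ?K" "k \<in> ?L"
    using \<open>(h, k) \<notin> ?R\<^sup>*\<close> assms(3) by auto
  then show False
    using not_irreducible assms(1) by blast
qed

section \<open>Strongly separated halfspaces\<close>

lemma nontransverse_cases:
  "\<not> transverse a b \<longleftrightarrow> a \<subseteq> b \<or> a \<subseteq> - b \<or> - a \<subseteq> b \<or> - a \<subseteq> - b"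
  unfolding transverse_def by blast

definition cuts :: "'x set \<Rightarrow> 'x set \<Rightarrow> bool" where
  "cuts j S \<longleftrightarrow> j \<inter> S \<noteq> {} \<and> - j \<inter> S \<noteq> {}"

lemma cuts_mono: "cuts j S \<Longrightarrow> S \<subseteq> T \<Longrightarrow> cuts j T"
  unfolding cuts_def by blast

lemma transverse_cuts: "transverse j h \<longleftrightarrow> cuts j h \<and> cuts j (- h)"
  unfolding transverse_def cuts_def by blast

text \<open>
  A halfspace that cuts both of two disjoint sets also cuts their complements.
\<close>

lemma strongly_separated_iff:
  "strongly_separated h k \<longleftrightarrow> h \<inter> k = {} \<and> \<not> (\<exists>j. halfspace j \<and> cuts j h \<and> cuts j k)"
proof (cases "h \<inter> k = {}")
  case True
  then have "h \<subseteq> - k" "k \<subseteq> - h"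
    by blast+
  then have "transverse j h \<and> transverse j k \<longleftrightarrow> cuts j h \<and> cuts j k" for j
    using cuts_mono unfolding transverse_cuts by blast
  then show ?thesis
    unfolding strongly_separated_def by simp
qed (simp add: strongly_separated_def)

lemma strongly_separated_mono:
  assumes "strongly_separated h k" "h' \<subseteq> h" "k' \<subseteq> k"
  shows "strongly_separated h' k'"
  using assms cuts_mono unfolding strongly_separated_iff by blast

lemma strongly_separated_sym: "strongly_separated h k \<longleftrightarrow> strongly_separated k h"
  unfolding strongly_separated_iff by blast

definition contains_thick :: "'x::metric_space set \<Rightarrow> bool" where
  "contains_thick S \<longleftrightarrow> (\<exists>u. thick u \<and> u \<subseteq> S)"

locale irreducible_minimal_action = minimal_median_action X_type act
  for X_type :: "'x::polish_space itself" and act :: "'g::topological_group_add \<Rightarrow> 'x \<Rightarrow> 'x" +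
  assumes irreducible: "irreducible_median_space (UNIV :: 'x set) dist"
    and nonelementary: "roller_nonelementary act"
begin

lemma iter_image_subset:
  assumes "act g ` B \<subseteq> a" "a \<subseteq> B" "m > 0"
  shows "act (iter g m) ` B \<subseteq> a"
  using assms(3)
proof (induction m rule: nat_induct_non_zero)
  case 1
  then show ?case
    using assms(1) by simp
next
  case (Suc m)
  have "act (iter g (Suc m)) ` B = act g ` act (iter g m) ` B"
    by (simp only: iter_simps act_image_comp)
  also have "\<dots> \<subseteq> act g ` B"
    using Suc.IH assms(2) by (intro image_mono) blast
  finally show ?case
    using assms(1) by blast
qed

text \<open>
  Two steps through a common neighbour suffice to get from any thick halfspace to any other in the
  graph of non-transverse pairs. If a path \<open>w0, w1, w2, w3\<close> cannot be shortened trivially, then suitable sides \<open>a\<close> of \<open>w1\<close> and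
  \<open>b\<close> of \<open>w2\<close> are disjoint, and they lie in sides of \<open>w0\<close> and \<open>w3\<close>. Some \<open>g\<close> maps \<open>- b\<close> into \<open>a\<close>. Suitable
  powers of \<open>g\<close> then move \<open>w3\<close> to a halfspace that is transverse neither to \<open>w0\<close> nor to \<open>w3\<close>.
\<close>

lemma path_shortcut:
  fixes w0 :: "'x set"
  assumes "thick w0" "thick w1" "thick w2" "thick w3"
    and "\<not> transverse w0 w1" "\<not> transverse w1 w2" "\<not> transverse w2 w3"
  shows "\<exists>u. thick u \<and> \<not> transverse w0 u \<and> \<not> transverse u w3"
proof -
  obtain a A where a: "a = w1 \<or> a = - w1" "A = w0 \<or> A = - w0" "a \<subseteq> A"
    using assms(5) unfolding transverse_sym[of w0] nontransverse_cases by metis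
  have "\<not> transverse a w2"
    using a(1) assms(6) by auto
  then consider B where "B = w2 \<or> B = - w2" "- a \<subseteq> B" | B where "B = w2 \<or> B = - w2" "a \<subseteq> B"
    unfolding nontransverse_cases by blast
  then show ?thesis
  proof cases
    case (1 B)
    then have "- A \<subseteq> B"
      using a(3) by blast
    then have "\<not> transverse w0 w2"
      using a(2) 1(1) unfolding nontransverse_cases by auto
    then show ?thesis
      using assms(3,7) by blast
  next
    case (2 B)
    have "\<not> transverse B w3"
      using 2(1) assms(7) by auto
    then consider C where "C = w3 \<or> C = - w3" "B \<subseteq> C" | C where "C = w3 \<or> C = - w3" "- B \<subseteq> C"
      unfolding nontransverse_cases by blast
    then show ?thesis
    proof cases
      case (1 C)
      then have "a \<subseteq> C"
        using 2(2) by blast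
      then have "\<not> transverse w1 w3"
        using a(1) 1(1) unfolding nontransverse_cases by auto
      then show ?thesis
        using assms(2,5) by blast
    next
      case C: (2 C)
      have "thick a" "thick B" "thick C"
        using a(1) 2(1) C(1) assms by auto
      then obtain g where g: "act g ` B \<subseteq> a"
        using skewer[of a B] 2(2) by blast
      obtain m where m: "m > 0" "\<not> transverse (act (iter g m) ` C) C"
        using power_nontransverse[of C] thick_halfspace[OF \<open>thick C\<close>] by blast
      let ?u = "act (iter g m) ` (- C)"
      have "?u \<subseteq> act (iter g m) ` B"
        using C(2) by (intro image_mono) blast
      then have "?u \<subseteq> A"
        using iter_image_subset[OF g 2(2) m(1)] a(3) by blast
      then have "\<not> transverse w0 ?u"
        using a(2) unfolding transverse_sym[of w0] nontransverse_cases by blast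
      moreover have "\<not> transverse ?u w3"
        using m(2) C(1) by (auto simp: act_image_Compl)
      ultimately show ?thesis
        using \<open>thick C\<close> by (metis act_thick thick_Compl)
    qed
  qed
qed

lemma common_neighbour:
  fixes h k :: "'x set"
  assumes "thick h" "thick k"
  shows "\<exists>u. thick u \<and> \<not> transverse h u \<and> \<not> transverse u k"
  using nontransverse_connected[OF irreducible assms]
proof (induction rule: rtrancl_induct)
  case base
  have "\<not> transverse h h"
    by (simp add: transverse_def)
  then show ?case
    using assms(1) by blast
next
  case (step k l)
  then obtain u where "thick u" "\<not> transverse h u" "\<not> transverse u k"
    by blast
  then show ?case
    using path_shortcut[of h u k l] assms(1) step.hyps(2) by blast
qed

text \<open>
  Choose \<open>g\<close> with \<open>g H \<subseteq> u\<close> and a power \<open>t\<close> of \<open>g\<close> for which \<open>t J\<close> and \<open>J\<close> are not transverse. As \<open>t H \<subseteq> u \<subseteq> J\<close>, the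
  halfspace \<open>- J\<close> moved by \<open>- t\<close> is disjoint from \<open>H\<close>, and it is not transverse to \<open>J\<close>.
\<close>

lemma opposite_sector:
  fixes H :: "'x set"
  assumes "thick H" "thick J" "transverse H J" "thick u" "u \<subseteq> H" "u \<subseteq> J"
  shows "contains_thick (- H \<inter> - J) \<or> contains_thick (- H \<inter> J)"
proof -
  obtain g where g: "act g ` H \<subseteq> u"
    using skewer[OF assms(4,1,5)] by blast
  obtain m where m: "m > 0" "\<not> transverse (act (iter g m) ` J) J"
    using power_nontransverse[of J] thick_halfspace[OF assms(2)] by blast
  define t where "t = iter g m"
  define v where "v = act (- t) ` (- J)"
  have "act t ` H \<subseteq> J"
    using iter_image_subset[OF g assms(5) m(1)] assms(6) unfolding t_def by blast
  then have "H \<subseteq> act (- t) ` J"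
    using act_image_mono[of "- t" "act t ` H" J] by (simp add: act_image_comp)
  then have "v \<subseteq> - H"
    unfolding v_def act_image_Compl by blast
  have "\<not> transverse v J"
  proof -
    have "transverse v J \<longleftrightarrow> transverse (act t ` v) (act t ` J)"
      by simp
    also have "act t ` v = - J"
      unfolding v_def by (simp add: act_image_comp)
    finally show ?thesis
      using m(2) transverse_sym unfolding t_def by auto
  qed
  then have "v \<subseteq> J \<or> v \<subseteq> - J"
    using \<open>v \<subseteq> - H\<close> assms(3) unfolding nontransverse_cases transverse_def by blast
  moreover have "thick v"
    using assms(2) by (simp add: v_def)
  ultimately show ?thesis
    using \<open>v \<subseteq> - H\<close> unfolding contains_thick_def by blast
qed

text \<open>
  A common neighbour of \<open>h\<close> and \<open>j\<close> or its complement is a thick halfspace in one of the four sectors. It yields one in a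
  sector on the other side of \<open>h\<close>, and one in a sector on the other side of \<open>j\<close>.
\<close>

lemma opposite_sectors:
  fixes h :: "'x set"
  assumes "thick h" "thick j" "transverse h j"
  shows "contains_thick (h \<inter> j) \<and> contains_thick (- h \<inter> - j) \<or>
    contains_thick (h \<inter> - j) \<and> contains_thick (- h \<inter> j)"
proof -
  obtain u where u: "thick u" "\<not> transverse h u" "\<not> transverse u j"
    using common_neighbour assms by blast
  obtain u' H where H: "u' = u \<or> u' = - u" "H = h \<or> H = - h" "u' \<subseteq> H"
    using u(2) unfolding transverse_sym[of h] nontransverse_cases by metis
  have "\<not> transverse u' j"
    using H(1) u(3) by auto
  then obtain J where J: "J = j \<or> J = - j" "u' \<subseteq> J \<or> - u' \<subseteq> J"
    unfolding nontransverse_cases by blast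
  have tr: "transverse H J" "transverse J H"
    using assms(3) H(2) J(1) transverse_sym by auto
  have "\<not> - u' \<subseteq> J"
    using tr(1) H(3) unfolding transverse_def by blast
  then have "u' \<subseteq> J"
    using J(2) by blast
  have th: "thick H" "thick J" "thick u'"
    using assms u(1) H J(1) by auto
  have "contains_thick (- H \<inter> - J) \<or> contains_thick (- H \<inter> J)"
    using opposite_sector[OF th(1,2) tr(1) th(3) H(3) \<open>u' \<subseteq> J\<close>] .
  moreover have "contains_thick (- J \<inter> - H) \<or> contains_thick (- J \<inter> H)"
    using opposite_sector[OF th(2,1) tr(2) th(3) \<open>u' \<subseteq> J\<close> H(3)] .
  moreover have "contains_thick (H \<inter> J)"
    unfolding contains_thick_def using th(3) H(3) \<open>u' \<subseteq> J\<close> by blast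
  ultimately have "contains_thick (H \<inter> J) \<and> contains_thick (- H \<inter> - J) \<or>
    contains_thick (H \<inter> - J) \<and> contains_thick (- H \<inter> J)"
    by (simp add: Int_commute) blast
  then show ?thesis
    using H(2) J(1) by auto
qed

definition crossing_family :: "nat \<Rightarrow> 'x set \<Rightarrow> 'x set \<Rightarrow> bool" where
  "crossing_family n h k \<longleftrightarrow> (\<exists>\<J>. finite \<J> \<and> card \<J> = n \<and> pairwise transverse \<J> \<and>
     (\<forall>j\<in>\<J>. thick j \<and> cuts j h \<and> cuts j k))"

lemma act_cuts: "cuts (act g ` j) (act g ` S) \<longleftrightarrow> cuts j S"
  unfolding cuts_def by (simp flip: act_image_Compl act_image_Int)

lemma crossing_family_act:
  assumes "crossing_family n (act g ` h) (act g ` k)"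
  shows "crossing_family n h k"
proof -
  obtain \<J> where \<J>: "finite \<J>" "card \<J> = n" "pairwise transverse \<J>"
    "\<And>j. j \<in> \<J> \<Longrightarrow> thick j \<and> cuts j (act g ` h) \<and> cuts j (act g ` k)"
    using assms unfolding crossing_family_def by blast
  let ?f = "\<lambda>j. act (- g) ` j"
  have inj: "inj_on ?f \<J>"
    by (rule inj_onI) (metis act_image_mono subset_antisym order_refl)
  have "thick (?f j) \<and> cuts (?f j) h \<and> cuts (?f j) k" if "j \<in> \<J>" for j
    using \<J>(4)[OF that] act_cuts[of g "?f j"] by (simp add: act_image_comp)
  moreover have "pairwise transverse (?f ` \<J>)"
  proof (rule pairwiseI)
    fix A B assume "A \<in> ?f ` \<J>" "B \<in> ?f ` \<J>" "A \<noteq> B"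
    then obtain i j where "i \<in> \<J>" "j \<in> \<J>" "A = ?f i" "B = ?f j" "i \<noteq> j"
      by blast
    then show "transverse A B"
      using \<J>(3) by (simp add: pairwise_def)
  qed
  ultimately show ?thesis
    unfolding crossing_family_def using \<J>(1,2) inj
    by (intro exI[of _ "?f ` \<J>"]) (simp add: card_image)
qed

text \<open>
  Let \<open>n\<close> be the least possible maximal size of a transverse family crossing both of two disjoint thick
  halfspaces, attained at \<open>h, k\<close>. For \<open>n > 0\<close> take \<open>t\<close> with \<open>t (- k) \<subseteq> h\<close> and a thick \<open>j\<close> crossing
  the translates of \<open>h\<close> by \<open>t\<close> and by \<open>- t\<close>, hence also \<open>h\<close> itself. Of the three pairs of opposite sectors
  two have the same type. They provide disjoint thick halfspaces \<open>p, q\<close> on different sides of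
  \<open>j\<close> that lie in a translate of \<open>h\<close> and in the same translate of \<open>k\<close>. A family of size \<open>n\<close> crossing \<open>p\<close> and \<open>q\<close>
  can be extended by \<open>j\<close>, which contradicts the choice of \<open>h, k\<close>.
\<close>

lemma thick_uncrossed_pair:
  "\<exists>h k :: 'x set. thick h \<and> thick k \<and> h \<inter> k = {} \<and> \<not> (\<exists>j. thick j \<and> cuts j h \<and> cuts j k)"
proof -
  let ?D = "\<lambda>h k :: 'x set. thick h \<and> thick k \<and> h \<inter> k = {}"
  let ?Q = "\<lambda>n. \<exists>h k. ?D h k \<and> \<not> crossing_family (Suc n) h k"
  obtain x y :: 'x where "x \<noteq> y"
    using nonelementary unfolding roller_nonelementary_def is_singleton_def by (metis UNIV_eq_I singletonI)
  then obtain w :: "'x set" where w: "thick w"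
    using thick_separation by metis
  then obtain g where "act g ` w \<inter> w = {}"
    using flip[of w] thick_nonempty[OF w] by (auto simp: thick_def)
  then have D: "?D (act g ` w) w"
    using w by simp
  have "\<not> crossing_family (Suc rank_bound) (act g ` w) w"
  proof
    assume "crossing_family (Suc rank_bound) (act g ` w) w"
    then obtain \<J> :: "'x set set" where \<J>: "finite \<J>" "card \<J> = Suc rank_bound" "pairwise transverse \<J>"
      "\<forall>j\<in>\<J>. thick j"
      unfolding crossing_family_def by auto
    have "halfspace j" if "j \<in> \<J>" for j
      using \<J>(4) that thick_halfspace by auto
    then show False
      using rank_bound(2)[OF \<J>(1) _ \<J>(3)] \<J>(2) by simp
  qed
  then have Q: "?Q rank_bound"
    using D by blast
  define n where "n = (LEAST n. ?Q n)"
  obtain h k where hk: "?D h k" "\<not> crossing_family (Suc n) h k"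
    using LeastI[of ?Q, OF Q] unfolding n_def by blast
  have least: "crossing_family n p q" if "?D p q" for p q
  proof (cases n)
    case 0
    then show ?thesis
      unfolding crossing_family_def by (intro exI[of _ "{}"]) simp
  next
    case (Suc m)
    then show ?thesis
      using not_less_Least[of m ?Q] that unfolding n_def[symmetric] by auto
  qed
  have "n = 0"
  proof (rule ccontr)
    assume "n \<noteq> 0"
    obtain t where t: "act t ` (- k) \<subseteq> h"
      using skewer[of h "- k"] hk(1) by auto
    let ?A = "act t ` h" and ?B = "act (- t) ` h"
    have k1: "- h \<subseteq> act t ` k"
      using t unfolding act_image_Compl by blast
    have k2: "- ?B \<subseteq> k"
    proof -
      have "act (- t) ` (- h) \<subseteq> act (- t) ` act t ` k"
        using k1 by (rule image_mono)
      then show ?thesis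
        by (simp add: act_image_comp act_image_Compl)
    qed
    have hkc: "h \<subseteq> - k"
      using hk(1) by blast
    have Ah: "?A \<subseteq> h"
      using t image_mono[OF hkc, of "act t"] by blast
    have hB: "h \<subseteq> ?B"
      using hkc k2 by blast
    have "?D ?A (- ?B)"
      using hk(1) Ah hB by auto
    then obtain \<J> where \<J>: "card \<J> = n" "\<forall>j\<in>\<J>. thick j \<and> cuts j ?A \<and> cuts j (- ?B)"
      using least unfolding crossing_family_def by blast
    then obtain j where j: "thick j" "cuts j ?A" "cuts j (- ?B)"
      using \<open>n \<noteq> 0\<close> by (metis card.empty equals0I)
    have extend: False
      if J: "J = j \<or> J = - j" and S: "S \<subseteq> act s ` h" "T \<subseteq> act s ` k" "cuts j S" "cuts j T"
        and p: "contains_thick (S \<inter> J)" and q: "contains_thick (T \<inter> - J)" for J S T s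
    proof -
      obtain p q where pq: "thick p" "p \<subseteq> S" "p \<subseteq> J" "thick q" "q \<subseteq> T" "q \<subseteq> - J"
        using p q unfolding contains_thick_def by blast
      then obtain \<I> where \<I>: "finite \<I>" "card \<I> = n" "pairwise transverse \<I>"
        "\<And>i. i \<in> \<I> \<Longrightarrow> thick i \<and> cuts i p \<and> cuts i q"
        using least[of p q] unfolding crossing_family_def by blast
      have tr: "transverse i j" if "i \<in> \<I>" for i
      proof -
        have "cuts i J" "cuts i (- J)"
          using \<I>(4)[OF that] pq cuts_mono by blast+
        then show ?thesis
          using J unfolding transverse_cuts by auto
      qed
      have "\<not> transverse j j"
        by (simp add: transverse_def)
      then have "j \<notin> \<I>"
        using tr by blast
      have "pairwise transverse (insert j \<I>)"
        using \<I>(3) tr transverse_sym unfolding pairwise_insert by blast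
      moreover have "thick i \<and> cuts i (act s ` h) \<and> cuts i (act s ` k)" if i: "i \<in> insert j \<I>" for i
      proof (cases "i = j")
        case True
        then show ?thesis
          using j(1) S cuts_mono by blast
      next
        case False
        then have "i \<in> \<I>"
          using i by blast
        then show ?thesis
          using \<I>(4)[of i] pq S cuts_mono by (meson order_trans)
      qed
      ultimately have "crossing_family (Suc n) (act s ` h) (act s ` k)"
        unfolding crossing_family_def using \<I>(1,2) \<open>j \<notin> \<I>\<close>
        by (intro exI[of _ "insert j \<I>"]) simp
      then show False
        using crossing_family_act hk(2) by blast
    qed
    have tk: "- h \<subseteq> act t ` k" "- ?B \<subseteq> act 0 ` k" "h \<subseteq> act 0 ` h" "?A \<subseteq> act 0 ` h"
      using k1 k2 Ah by simp_all
    have cu: "cuts j h" "cuts j (- h)" "cuts j ?B" "cuts j (- ?A)"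
      using j(2,3) Ah hB cuts_mono by (meson Compl_subset_Compl_iff order_trans)+
    have tr: "transverse ?A j" "transverse h j" "transverse ?B j"
      using j(2,3) cu transverse_sym unfolding transverse_cuts[symmetric] by (metis transverse_cuts)+
    have th: "thick ?A" "thick h" "thick ?B"
      using hk(1) by simp_all
    note opp = opposite_sectors[OF th(1) j(1) tr(1)] opposite_sectors[OF th(2) j(1) tr(2)]
      opposite_sectors[OF th(3) j(1) tr(3)]
    have "False" if J: "J = j \<or> J = - j"
      "contains_thick (?A \<inter> J)" "contains_thick (- h \<inter> - J)" for J
      using extend[OF J(1) order_refl tk(1) j(2) cu(2) J(2,3)] .
    moreover have "False" if J: "J = j \<or> J = - j"
      "contains_thick (?A \<inter> J)" "contains_thick (- ?B \<inter> - J)" for J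
      using extend[OF J(1) tk(4,2) j(2,3) J(2,3)] .
    moreover have "False" if J: "J = j \<or> J = - j"
      "contains_thick (h \<inter> J)" "contains_thick (- ?B \<inter> - J)" for J
      using extend[OF J(1) tk(3,2) cu(1) j(3) J(2,3)] .
    ultimately show False
      using opp by (metis double_complement)
  qed
  have "\<not> (\<exists>j. thick j \<and> cuts j h \<and> cuts j k)"
  proof
    assume "\<exists>j. thick j \<and> cuts j h \<and> cuts j k"
    then obtain j where "thick j \<and> cuts j h \<and> cuts j k"
      by blast
    then have "crossing_family (Suc 0) h k"
      unfolding crossing_family_def by (intro exI[of _ "{j}"]) simp
    then show False
      using hk(2) \<open>n = 0\<close> by simp
  qed
  then show ?thesis
    using hk(1) by blast
qed

text \<open>
  If a halfspace \<open>j\<close> separates \<open>a, c\<close> from \<open>a', c'\<close>, then the gates \<open>f\<close> and \<open>e\<close> below are different, and any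
  halfspace separating them also separates \<open>a, c\<close> from \<open>a', c'\<close>; so it can be taken to be thick.
\<close>

lemma thick_crossing:
  fixes h :: "'x set"
  assumes "halfspace j" "cuts j h" "cuts j k"
  shows "\<exists>j'. thick j' \<and> cuts j' h \<and> cuts j' k"
proof -
  obtain a c a' c' where ac: "a \<in> j" "a \<in> h" "c \<in> j" "c \<in> k" "a' \<notin> j" "a' \<in> h" "c' \<notin> j" "c' \<in> k"
    using assms(2,3) unfolding cuts_def by blast
  define f where "f = median a a' c'"
  define e where "e = median f a c"
  have "f \<notin> j" "e \<in> j"
    using ac assms(1) unfolding e_def f_def by (auto simp: halfspace_median)
  then have "e \<noteq> f"
    by blast
  then obtain H where H: "thick H" "e \<in> H" "f \<notin> H"
    using thick_separation[of e f] by (metis ComplD interior_subset median_same(1,2) subsetD)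
  have "a \<in> H" "c \<in> H"
    using H(2,3) thick_halfspace[OF H(1)] unfolding e_def by (auto simp: halfspace_median)
  moreover from this have "a' \<notin> H" "c' \<notin> H"
    using H(3) thick_halfspace[OF H(1)] unfolding f_def by (auto simp: halfspace_median)
  ultimately show ?thesis
    using H(1) ac unfolding cuts_def by blast
qed

lemma infinite_space: "infinite (UNIV :: 'x set)"
proof
  assume fin: "finite (UNIV :: 'x set)"
  fix x :: 'x
  have "roller_act act g (roller_embed x) = roller_embed (act g x)" for g
    by (auto simp: roller_act_def roller_embed_def act_median)
  then have "range (\<lambda>g. roller_act act g (roller_embed x)) \<subseteq> range roller_embed"
    by auto
  then have "finite (range (\<lambda>g. roller_act act g (roller_embed x)))"
    using fin finite_subset by blast
  then show False
    using nonelementary roller_embed_in[of x] unfolding roller_nonelementary_def by blast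
qed

text \<open>
  If \<open>h\<close> and \<open>k\<close> are complementary, one of them, \<open>S\<close>, is infinite. A thick halfspace separating two points of \<open>S\<close> is
  not transverse to \<open>h\<close>, so it or its complement is a proper subset of \<open>S\<close>, which can replace \<open>S\<close>.
\<close>

lemma strongly_separated_proper:
  "\<exists>h k :: 'x set. thick h \<and> thick k \<and> h \<union> k \<noteq> UNIV \<and> strongly_separated h k"
proof -
  obtain h k :: "'x set" where hk: "thick h" "thick k" "h \<inter> k = {}" "\<not> (\<exists>j. thick j \<and> cuts j h \<and> cuts j k)"
    using thick_uncrossed_pair by blast
  then have ss: "strongly_separated h k"
    unfolding strongly_separated_iff using thick_crossing by blast
  show ?thesis
  proof (cases "h \<union> k = UNIV")
    case True
    then have k: "k = - h"
      using hk(3) by blast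
    obtain S where S: "S = h \<or> S = - h" "infinite S"
      using infinite_space by (metis Compl_partition finite_UnI)
    then obtain x y where xy: "x \<in> S" "y \<in> S" "x \<noteq> y"
      by (metis finite.emptyI finite_insert insertI1 rev_finite_subset subsetI ex_in_conv)
    obtain w where w: "thick w" "x \<in> w" "y \<notin> w"
      using thick_separation[OF xy(3)] by (metis ComplD interior_subset median_same(1,2) subsetD)
    have "\<not> transverse w h"
      using ss w(1) thick_halfspace unfolding k strongly_separated_iff transverse_cuts by blast
    then have "\<not> transverse w S"
      using S(1) by auto
    then have "w \<subseteq> S \<or> - w \<subseteq> S"
      using xy(1,2) w(2,3) unfolding nontransverse_cases by blast
    then obtain v where v: "v = w \<or> v = - w" "v \<subseteq> S"
      by blast
    have "v \<union> - S \<noteq> UNIV"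
      using v(1) w xy by blast
    moreover have "thick v" "thick (- S)"
      using v(1) w(1) S(1) hk(1) by auto
    moreover have "strongly_separated v (- S)"
    proof (rule strongly_separated_mono[OF _ v(2) order_refl])
      show "strongly_separated S (- S)"
        using S(1) ss strongly_separated_sym[of h "- h"] unfolding k by auto
    qed
    ultimately show ?thesis
      by blast
  qed (use hk ss in blast)
qed

lemma strongly_separated_gap:
  obtains h k :: "'x set" and r where "thick h" "thick k" "h \<union> k \<noteq> UNIV" "strongly_separated h k"
    "r > 0" "\<And>a b. a \<in> h \<Longrightarrow> b \<in> k \<Longrightarrow> r \<le> dist a b"
proof -
  obtain h k :: "'x set" where hk: "thick h" "thick k" "h \<union> k \<noteq> UNIV" "strongly_separated h k"
    using strongly_separated_proper by blast
  obtain h' r where h': "thick h'" "h' \<subseteq> h" "r > 0" "\<And>a b. a \<notin> h \<Longrightarrow> b \<in> h' \<Longrightarrow> r \<le> dist a b"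
    using thick_shrink[OF hk(1)] by metis
  have "r \<le> dist a b" if "a \<in> h'" "b \<in> k" for a b
    using h'(4)[of b a] that hk(4) unfolding strongly_separated_def by (auto simp: dist_commute)
  moreover have "strongly_separated h' k" "h' \<union> k \<noteq> UNIV"
    using strongly_separated_mono[OF hk(4) h'(2) order_refl] hk(3) h'(2) by blast+
  ultimately show thesis
    using that h'(1,3) hk(2) by blast
qed

end

section \<open>Chains of strongly separated halfspaces and their ends\<close>

text \<open>
  The strict inclusion is needed because the space need not be connected: otherwise a halfspace at
  positive distance from its complement and transverse to no halfspace would form a constant chain.
\<close>

definition step :: "real \<Rightarrow> 'x::metric_space set \<Rightarrow> 'x set \<Rightarrow> bool" where
  "step r h k \<longleftrightarrow> thick h \<and> thick k \<and> k \<subset> h \<and> strongly_separated (- h) k \<and>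
     (\<forall>a b. a \<notin> h \<longrightarrow> b \<in> k \<longrightarrow> r \<le> dist a b)"

lemma step_mono:
  assumes "step r h k" "h \<subseteq> h'" "k' \<subseteq> k" "thick h'" "thick k'"
  shows "step r h' k'"
proof -
  have "strongly_separated (- h') k'"
    using assms strongly_separated_mono[of "- h" k "- h'" k'] unfolding step_def by auto
  then show ?thesis
    using assms unfolding step_def by (meson psubset_subset_trans subset_psubset_trans subsetD)
qed

lemma step_Compl: "step r h k \<Longrightarrow> step r (- k) (- h)"
proof -
  assume st: "step r h k"
  have "r \<le> dist a b" if "a \<notin> - k" "b \<in> - h" for a b
  proof -
    have "r \<le> dist b a"
      using st that unfolding step_def by blast
    then show ?thesis
      by (simp add: dist_commute)
  qed
  then show ?thesis
    using st strongly_separated_sym[of "- h" k] unfolding step_def by auto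
qed

lemma step_not_cuts: "step r h k \<Longrightarrow> halfspace j \<Longrightarrow> cuts j k \<Longrightarrow> \<not> cuts j (- h)"
  unfolding step_def strongly_separated_iff by blast

lemma step_sub: "step r h k \<Longrightarrow> k \<subseteq> h"
  unfolding step_def by blast

lemma steps_sub:
  assumes "\<And>i. i < n \<Longrightarrow> step r (k i) (k (Suc i))" "m \<le> n"
  shows "k n \<subseteq> k m"
  using assms(2,1)
proof (induction n rule: dec_induct)
  case (step n)
  then show ?case
    using step_sub[of r "k n" "k (Suc n)"] by (meson less_SucI lessI order_trans)
qed simp

definition chain :: "real \<Rightarrow> (nat \<Rightarrow> 'x::metric_space set) \<Rightarrow> bool" where
  "chain r k \<longleftrightarrow> (\<forall>i. step r (k i) (k (Suc i)))"

lemma chainD: "chain r k \<Longrightarrow> step r (k i) (k (Suc i))"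
  by (simp add: chain_def)

lemma chain_sub: "chain r k \<Longrightarrow> m \<le> n \<Longrightarrow> k n \<subseteq> k m"
  by (rule steps_sub) (rule chainD)

text \<open>Along a chain the coordinates do not just converge, each is eventually constant.\<close>

definition ends_at :: "(nat \<Rightarrow> 'x::metric_space set) \<Rightarrow> 'x roller \<Rightarrow> bool" where
  "ends_at k \<xi> \<longleftrightarrow> (\<forall>a c. \<exists>N. \<forall>y\<in>k N. median y a c = \<xi> (a, c))"

context finite_rank_median
begin

text \<open>
  The projection of \<open>b\<close> to the closure of the complement of \<open>k (2 * n + 1)\<close> lies in \<open>k (2 * n)\<close>, because
  \<open>k (2 * n)\<close> meets that complement. It cuts the way from \<open>a\<close> to \<open>b\<close> into two parts of which
  the second has length at least \<open>r\<close>.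
\<close>

lemma steps_dist:
  fixes a :: 'x
  assumes "\<And>i. i < 2 * n \<Longrightarrow> step r (k i) (k (Suc i))" "a \<notin> k 0" "b \<in> k (2 * n)"
  shows "n * r \<le> dist a b"
  using assms
proof (induction n arbitrary: b)
  case (Suc n)
  have st: "step r (k (2 * n)) (k (Suc (2 * n)))" "step r (k (Suc (2 * n))) (k (Suc (Suc (2 * n))))"
    using Suc.prems(1) by simp_all
  define C where "C = closure (- k (Suc (2 * n)))"
  have "halfspace (k (Suc (2 * n)))" "halfspace (k (2 * n))"
    using st(1) thick_halfspace unfolding step_def by blast+
  then have C: "closed C" "median_convex C" "C \<noteq> {}"
    unfolding C_def using closure_convex thick_nonempty[of "k (Suc (2 * n))"] st(1)
    by (auto simp: halfspace_def step_def)
  let ?y = "proj C b"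
  have "k (Suc (2 * n)) \<subseteq> k 0"
    using Suc.prems(1) by (intro steps_sub[of "Suc (2 * n)" r k 0]) auto
  then have "a \<in> C"
    using Suc.prems(2) closure_subset[of "- k (Suc (2 * n))"] unfolding C_def by blast
  then have "?y \<in> interval b a"
    by (rule proj(2)[OF C])
  then have "dist a b = dist a ?y + dist ?y b"
    by (auto dest: dist_interval simp: dist_commute)
  moreover have "r \<le> dist ?y b"
  proof (rule ccontr)
    assume "\<not> r \<le> dist ?y b"
    then obtain w where "w \<notin> k (Suc (2 * n))" and "dist w ?y < r - dist ?y b"
      using proj(1)[OF C, of b] unfolding C_def closure_approachable
      by (metis ComplD diff_gt_0_iff_gt not_le)
    moreover have "b \<in> k (Suc (Suc (2 * n)))"
      using Suc.prems(3) by simp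
    ultimately have "r \<le> dist w b"
      using st(2) unfolding step_def by blast
    then show False
      using \<open>dist w ?y < r - dist ?y b\<close> dist_triangle[of w b ?y] by simp
  qed
  moreover have "n * r \<le> dist a ?y"
  proof (rule Suc.IH)
    have "k (Suc (2 * n)) \<subset> k (2 * n)"
      using st(1) unfolding step_def by (elim conjE)
    then obtain w where w: "w \<in> k (2 * n)" "w \<notin> k (Suc (2 * n))"
      by blast
    then have "w \<in> C"
      using closure_subset[of "- k (Suc (2 * n))"] unfolding C_def by auto
    moreover have "b \<in> k (2 * n)"
      using Suc.prems(3) step_sub[OF st(1)] step_sub[OF st(2)] by auto
    ultimately show "?y \<in> k (2 * n)"
      using halfspace_interval(1)[OF \<open>halfspace (k (2 * n))\<close> proj(2)[OF C, of w b]] w(1) by blast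
  qed (use Suc.prems in auto)
  ultimately show ?case
    by (simp add: distrib_right)
qed simp

lemma chain_leaves:
  fixes a :: 'x
  assumes "chain r k" "r > 0"
  shows "\<exists>N. \<forall>n\<ge>N. a \<notin> k n"
proof -
  note st = chainD[OF assms(1)]
  obtain z where z: "z \<notin> k 0"
    using st[of 0] thick_nonempty unfolding step_def by blast
  obtain n :: nat where n: "dist z a < n * r"
    using reals_Archimedean3[OF assms(2)] by blast
  have "a \<notin> k (2 * n)"
    using steps_dist[of n r k z a, OF st z] n by auto
  then have "\<forall>m\<ge>2 * n. a \<notin> k m"
    using chain_sub[OF assms(1), of "2 * n"] by blast
  then show ?thesis
    by blast
qed

lemma ends_at_later:
  fixes a :: 'x
  assumes "chain r k" "ends_at k \<xi>"
  obtains N where "\<And>n y. n \<ge> N \<Longrightarrow> y \<in> k n \<Longrightarrow> median y a c = \<xi> (a, c)"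
proof -
  obtain N where "\<forall>y\<in>k N. median y a c = \<xi> (a, c)"
    using assms(2) unfolding ends_at_def by blast
  then show thesis
    using that[of N] chain_sub[OF assms(1), of N] by blast
qed

text \<open>
  Once \<open>k n\<close> contains neither \<open>a\<close> nor \<open>c\<close>, the projection to \<open>interval a c\<close> is constant on \<open>k (n + 1)\<close>: a
  halfspace separating two of its values would cut both \<open>k (n + 1)\<close> and the complement of \<open>k n\<close>.
\<close>

lemma ex_end:
  fixes k :: "nat \<Rightarrow> 'x set"
  assumes "chain r k" "r > 0"
  shows "\<exists>\<xi>. ends_at k \<xi>"
proof -
  have "\<exists>v N. \<forall>y\<in>k N. median y a c = v" for a c
  proof -
    obtain N1 N2 where "\<forall>n\<ge>N1. a \<notin> k n" "\<forall>n\<ge>N2. c \<notin> k n"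
      using chain_leaves[OF assms] by meson
    then have N: "a \<notin> k (max N1 N2)" "c \<notin> k (max N1 N2)"
      by auto
    let ?k = "k (max N1 N2)" and ?l = "k (Suc (max N1 N2))"
    have "median y a c = median y' a c" if y: "y \<in> ?l" "y' \<in> ?l" for y y'
    proof (rule median_eqI)
      fix j :: "'x set" assume j: "halfspace j"
      show "median y a c \<in> j \<longleftrightarrow> median y' a c \<in> j"
        using step_not_cuts[OF chainD[OF assms(1), of "max N1 N2"] j] y N unfolding cuts_def halfspace_median[OF j]
        by blast
    qed
    moreover obtain y where "y \<in> ?l"
      using chainD[OF assms(1), of "max N1 N2"] thick_nonempty unfolding step_def by blast
    ultimately show ?thesis
      by (intro exI[of _ "median y a c"] exI[of _ "Suc (max N1 N2)"]) blast
  qed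
  then have "\<forall>p. \<exists>v. \<exists>N. \<forall>y\<in>k N. median y (fst p) (snd p) = v"
    by blast
  then obtain \<xi> where "\<forall>p. \<exists>N. \<forall>y\<in>k N. median y (fst p) (snd p) = \<xi> p"
    by (rule choice[THEN exE])
  then show ?thesis
    unfolding ends_at_def by (intro exI[of _ \<xi>]) (metis fst_conv snd_conv)
qed

lemma end_in_compactification:
  fixes k :: "nat \<Rightarrow> 'x set"
  assumes "chain r k" "ends_at k \<xi>"
  shows "\<xi> \<in> roller_compactification"
  unfolding roller_compactification_iff
proof (intro allI impI)
  fix P :: "('x \<times> 'x) set" and e :: real assume P: "finite P" "e > 0"
  have "\<forall>p\<in>P. \<exists>N. \<forall>n\<ge>N. \<forall>y\<in>k n. median y (fst p) (snd p) = \<xi> p"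
    using ends_at_later[OF assms] by (metis prod.collapse)
  then obtain N where N: "\<And>p n y. p \<in> P \<Longrightarrow> n \<ge> N p \<Longrightarrow> y \<in> k n \<Longrightarrow> median y (fst p) (snd p) = \<xi> p"
    by metis
  obtain y where y: "y \<in> k (Max (insert 0 (N ` P)))"
    using chainD[OF assms(1)] thick_nonempty unfolding step_def by blast
  have "N p \<le> Max (insert 0 (N ` P))" if "p \<in> P" for p
    using P(1) that by simp
  then have "median y a b = \<xi> (a, b)" if "(a, b) \<in> P" for a b
    using N[OF that _ y] that by simp
  then show "\<exists>y. \<forall>(a, b)\<in>P. dist (median y a b) (\<xi> (a, b)) < e"
    using P(2) by (intro exI[of _ y]) auto
qed

text \<open>
  The end is not a point \<open>x\<close> of the space because \<open>x\<close> would be the projection of points deep in the chain to the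
  interval from \<open>x\<close> to a point of a member of the chain that misses \<open>x\<close>. The halved gap makes the inequality strict.
\<close>

lemma end_regular:
  fixes k :: "nat \<Rightarrow> 'x set"
  assumes k: "chain r k" "r > 0" and \<xi>: "ends_at k \<xi>"
  shows "\<xi> \<in> regular_boundary"
proof -
  have hs: "halfspace (k i)" and ne: "k i \<noteq> {}" "- k i \<noteq> {}" for i
    using chainD[OF k(1), of i] thick_halfspace thick_nonempty unfolding step_def by blast+
  have "\<xi> \<notin> range roller_embed"
  proof
    assume "\<xi> \<in> range roller_embed"
    then obtain x where x: "\<xi> = roller_embed x"
      by blast
    obtain N where N: "\<forall>n\<ge>N. x \<notin> k n"
      using chain_leaves[OF k] by blast
    obtain c where c: "c \<in> k N"
      using ne by blast
    obtain N' where N': "\<And>n y. n \<ge> N' \<Longrightarrow> y \<in> k n \<Longrightarrow> median y x c = \<xi> (x, c)"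
      using ends_at_later[OF k(1) \<xi>] by blast
    obtain y where y: "y \<in> k (max N N')"
      using ne by blast
    then have "y \<in> k N"
      using chain_sub[OF k(1), of N "max N N'"] by auto
    then have "median y x c \<in> k N"
      using c hs by (simp add: halfspace_median)
    moreover have "median y x c = x"
      using N'[OF _ y] x by (simp add: roller_embed_def)
    ultimately show False
      using N by auto
  qed
  then have "\<xi> \<in> roller_boundary"
    unfolding roller_boundary_def using end_in_compactification[OF k(1) \<xi>] by blast
  moreover have "\<xi> \<in> roller_halfspace (k i)" for i
    unfolding roller_halfspace_def
  proof (intro CollectI conjI ballI)
    show "\<xi> \<in> roller_compactification"
      by (rule end_in_compactification[OF k(1) \<xi>])
    fix a b assume ab: "a \<in> k i" "b \<in> - k i"
    obtain N where N: "\<And>n y. n \<ge> N \<Longrightarrow> y \<in> k n \<Longrightarrow> median y a b = \<xi> (a, b)"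
      using ends_at_later[OF k(1) \<xi>] by blast
    have "roller_median \<xi> (roller_embed a) (roller_embed b) p = roller_embed (\<xi> (a, b)) p" for p
    proof -
      obtain N' where N': "\<And>n y. n \<ge> N' \<Longrightarrow> y \<in> k n \<Longrightarrow> median y (fst p) (snd p) = \<xi> (fst p, snd p)"
        using ends_at_later[OF k(1) \<xi>] by blast
      obtain y where y: "y \<in> k (max N N')"
        using ne by blast
      have "median y a b = \<xi> (a, b)" "median y (fst p) (snd p) = \<xi> p"
        using N[OF _ y] N'[OF _ y] by simp_all
      then show ?thesis
        using gate_median[of y a b "fst p" "snd p"]
        by (simp add: roller_median_def roller_embed_def case_prod_beta)
    qed
    then have "roller_median \<xi> (roller_embed a) (roller_embed b) = roller_embed (\<xi> (a, b))"
      by blast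
    moreover have "\<xi> (a, b) \<in> k i"
    proof -
      obtain y where y: "y \<in> k (max N i)"
        using ne by blast
      then have "y \<in> k i"
        using chain_sub[OF k(1), of i "max N i"] by auto
      then have "median y a b \<in> k i"
        using ab(1) hs by (simp add: halfspace_median)
      then show ?thesis
        using N[OF _ y] by simp
    qed
    ultimately show "roller_median \<xi> (roller_embed a) (roller_embed b) \<in> roller_embed ` k i"
      by blast
  qed
  moreover have "setdist (- k i) (k (Suc i)) > r / 2" for i
  proof -
    have "r \<le> setdist (- k i) (k (Suc i))"
      using ne chainD[OF k(1), of i] by (intro le_setdistI) (auto simp: step_def)
    then show ?thesis
      using k(2) by simp
  qed
  moreover have "k (Suc i) \<subseteq> k i" "strongly_separated (- k i) (k (Suc i))" for i
    using chainD[OF k(1), of i] unfolding step_def by blast+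
  ultimately have "regular_point \<xi>"
    unfolding regular_point_def using k(2) hs
    by (intro conjI exI[of _ k] exI[of _ "r / 2"]) auto
  then show ?thesis
    by (simp add: regular_boundary_def)
qed

lemma distinct_ends_disjoint:
  fixes k :: "nat \<Rightarrow> 'x set"
  assumes "chain r k" "ends_at k \<xi>" and "chain r l" "ends_at l \<eta>" and "\<xi> \<noteq> \<eta>"
  shows "\<exists>N. \<forall>n\<ge>N. k n \<inter> l n = {}"
proof -
  obtain a c where ac: "\<xi> (a, c) \<noteq> \<eta> (a, c)"
    using assms(5) by fastforce
  obtain N where N: "\<And>n y. n \<ge> N \<Longrightarrow> y \<in> k n \<Longrightarrow> median y a c = \<xi> (a, c)"
    using ends_at_later[OF assms(1,2)] by blast
  obtain N' where N': "\<And>n y. n \<ge> N' \<Longrightarrow> y \<in> l n \<Longrightarrow> median y a c = \<eta> (a, c)"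
    using ends_at_later[OF assms(3,4)] by blast
  have "k n \<inter> l n = {}" if "n \<ge> max N N'" for n
    using N[of n] N'[of n] that ac by fastforce
  then show ?thesis
    by blast
qed

text \<open>
  A halfspace that cuts one of the sets \<open>u1, u2, u3\<close> does not cut the union of the other two. So it
  cannot separate the medians of two triples with one point in each of these sets.
\<close>

lemma facing_center:
  fixes u1 :: "'x set"
  assumes st: "step r v1 u1" "step r v2 u2" "step r v3 u3"
    and disj: "v1 \<inter> v2 = {}" "v1 \<inter> v3 = {}" "v2 \<inter> v3 = {}"
  shows "\<exists>z. \<forall>x1\<in>u1. \<forall>x2\<in>u2. \<forall>x3\<in>u3. median x1 x2 x3 = z"
proof -
  have "median x1 x2 x3 = median y1 y2 y3"
    if x: "x1 \<in> u1" "x2 \<in> u2" "x3 \<in> u3" and y: "y1 \<in> u1" "y2 \<in> u2" "y3 \<in> u3" for x1 x2 x3 y1 y2 y3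
  proof (rule median_eqI)
    fix j :: "'x set" assume j: "halfspace j"
    have sub: "u1 \<subseteq> v1" "u2 \<subseteq> v2" "u3 \<subseteq> v3"
      using st step_sub by blast+
    have out: "x1 \<in> - v2" "x1 \<in> - v3" "x2 \<in> - v1" "x2 \<in> - v3" "x3 \<in> - v1" "x3 \<in> - v2"
      "y1 \<in> - v2" "y1 \<in> - v3" "y2 \<in> - v1" "y2 \<in> - v3" "y3 \<in> - v1" "y3 \<in> - v2"
      using x y sub disj by blast+
    \<comment> \<open>if \<open>j\<close> cuts \<open>u1\<close>, then all points outside \<open>v1\<close> are on the same side of \<open>j\<close>\<close>
    have 1: "(x1 \<in> j \<longleftrightarrow> y1 \<in> j) \<or> (x2 \<in> j \<longleftrightarrow> x3 \<in> j) \<and> (x3 \<in> j \<longleftrightarrow> y2 \<in> j) \<and> (y2 \<in> j \<longleftrightarrow> y3 \<in> j)"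
      using step_not_cuts[OF st(1) j] x(1) y(1) out unfolding cuts_def by blast
    have 2: "(x2 \<in> j \<longleftrightarrow> y2 \<in> j) \<or> (x1 \<in> j \<longleftrightarrow> x3 \<in> j) \<and> (x3 \<in> j \<longleftrightarrow> y1 \<in> j) \<and> (y1 \<in> j \<longleftrightarrow> y3 \<in> j)"
      using step_not_cuts[OF st(2) j] x(2) y(2) out unfolding cuts_def by blast
    have 3: "(x3 \<in> j \<longleftrightarrow> y3 \<in> j) \<or> (x1 \<in> j \<longleftrightarrow> x2 \<in> j) \<and> (x2 \<in> j \<longleftrightarrow> y1 \<in> j) \<and> (y1 \<in> j \<longleftrightarrow> y2 \<in> j)"
      using step_not_cuts[OF st(3) j] x(3) y(3) out unfolding cuts_def by blast
    show "median x1 x2 x3 \<in> j \<longleftrightarrow> median y1 y2 y3 \<in> j"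
      unfolding halfspace_median[OF j] using 1 2 3 by argo
  qed
  moreover obtain a1 a2 a3 where "a1 \<in> u1" "a2 \<in> u2" "a3 \<in> u3"
    using st thick_nonempty unfolding step_def by (metis ex_in_conv)
  ultimately show ?thesis
    by (intro exI[of _ "median a1 a2 a3"]) blast
qed

text \<open>
  With \<open>p\<close> and \<open>q\<close> mutually closest points of the closures of \<open>- h\<close> and \<open>k\<close>, the projection to \<open>interval p q\<close>
  is constant on both sets.
\<close>

lemma bridge:
  fixes h :: "'x set"
  assumes "step r h k" "r > 0"
  obtains p q where "p \<noteq> q" "\<And>x. x \<in> k \<Longrightarrow> median x p q = q" "\<And>x. x \<notin> h \<Longrightarrow> median x p q = p"
proof -
  let ?C = "closure (- h)" and ?D = "closure k"
  have st: "thick h" "thick k" "\<And>a b. a \<notin> h \<Longrightarrow> b \<in> k \<Longrightarrow> r \<le> dist a b"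
    using assms(1) unfolding step_def by auto
  have C: "closed ?C" "median_convex ?C" "?C \<noteq> {}" and D: "closed ?D" "median_convex ?D" "?D \<noteq> {}"
    using closure_convex thick_nonempty[OF st(1)] thick_nonempty[OF st(2)]
      thick_halfspace[OF st(1)] thick_halfspace[OF st(2)] by (auto simp: halfspace_def)
  obtain y where y: "y \<in> ?D"
    using D(3) by (meson ex_in_conv)
  define p where "p = proj ?C y"
  define q where "q = proj ?D p"
  have p: "p \<in> ?C" "\<And>w. w \<in> ?C \<Longrightarrow> p \<in> interval y w"
    unfolding p_def using proj(1)[OF C] proj(2)[OF C] by blast+
  have q: "q \<in> ?D" "\<And>w. w \<in> ?D \<Longrightarrow> q \<in> interval p w"
    unfolding q_def using proj(1)[OF D] proj(2)[OF D] by blast+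
  have "p \<noteq> q"
  proof
    assume "p = q"
    obtain a where a: "a \<in> - h" "dist a p < r / 2"
      using p(1) assms(2) unfolding closure_approachable by (meson half_gt_zero)
    obtain b where b: "b \<in> k" "dist b p < r / 2"
      using q(1) assms(2) \<open>p = q\<close> unfolding closure_approachable by (meson half_gt_zero)
    show False
      using st(3)[of a b] a b dist_triangle2[of a b p] by simp
  qed
  moreover have "median x p q = q" if "x \<in> k" for x
    using q(2)[of x] closure_subset that by (intro median_unique) (auto simp: interval_commute)
  moreover have "median x p q = p" if "x \<notin> h" for x
  proof (rule ccontr)
    assume "median x p q \<noteq> p"
    then obtain H where H: "halfspace H" "p \<in> H" "median x p q \<notin> H"
      using separate_points by metis
    then have xq: "x \<notin> H" "q \<notin> H"
      by (auto simp: halfspace_median)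
    have "y \<notin> H"
      using q(2)[OF y] halfspace_interval(1)[OF H(1)] H(2) xq(2) by blast
    moreover have "p \<in> interval y x"
      using p(2) that closure_subset[of "- h"] by blast
    ultimately show False
      using halfspace_interval(2)[OF H(1)] xq(1) H(2) by blast
  qed
  ultimately show thesis
    using that by blast
qed

text \<open>
  Arbitrarily long chains of members of \<open>S\<close> starting at a fixed point can be spliced into an infinite one. Let \<open>k\<close>
  be a halfspace in \<open>S\<close> that does not contain \<open>z\<close>. It cuts the complement of each late member of a long chain, as this
  complement contains \<open>z\<close> and a given point of \<open>k\<close>. By strong separation it does not cut the next member, and as
  it meets this member, it contains it.
\<close>

lemma infinite_chain:
  fixes S :: "'x set set"
  assumes "r > 0"
    and meet: "\<And>h k. h \<in> S \<Longrightarrow> k \<in> S \<Longrightarrow> h \<inter> k \<noteq> {}"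
    and up: "\<And>h k. h \<in> S \<Longrightarrow> h \<subseteq> k \<Longrightarrow> k \<in> S"
    and long: "\<And>M. \<exists>k. (\<forall>i<M. step r (k i) (k (Suc i))) \<and> z \<notin> k 0 \<and> k M \<in> S"
  shows "\<exists>k :: nat \<Rightarrow> 'x set. chain r k \<and> (\<forall>i. k i \<in> S)"
proof -
  let ?P = "\<lambda>k. k \<in> S \<and> thick k \<and> z \<notin> k"
  have "\<exists>k. ?P k"
  proof -
    obtain k where k: "\<forall>i<1. step r (k i) (k (Suc i))" "z \<notin> k 0" "k (1 :: nat) \<in> S"
      using long[of 1] by blast
    then show ?thesis
      by (intro exI[of _ "k 1"]) (auto simp: step_def)
  qed
  moreover have "\<exists>l. ?P l \<and> step r k l" if k: "?P k" for k
  proof -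
    obtain b where b: "b \<in> k"
      using meet k by blast
    obtain n :: nat where n: "dist z b < n * r"
      using reals_Archimedean3[OF assms(1)] by blast
    let ?i = "2 * n"
    obtain k' where k': "\<And>i. i < ?i + 2 \<Longrightarrow> step r (k' i) (k' (Suc i))" "z \<notin> k' 0" "k' (?i + 2) \<in> S"
      using long[of "?i + 2"] by blast
    have sub: "k' m \<subseteq> k' i" if "i \<le> m" "m \<le> ?i + 2" for i m
      using that k'(1) by (intro steps_sub[of m r k' i]) auto
    have inS: "k' i \<in> S" if "i \<le> ?i + 2" for i
      using up[OF k'(3) sub[OF that order_refl]] .
    have z: "z \<notin> k' i" if "i \<le> ?i + 2" for i
      using sub[of 0 i] that k'(2) by blast
    have "b \<notin> k' ?i"
      using steps_dist[of n r k' z b] k'(1,2) n by fastforce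
    have "\<not> cuts k (k' (Suc ?i))"
    proof
      assume "cuts k (k' (Suc ?i))"
      then have "\<not> cuts k (- k' ?i)"
        using step_not_cuts[of r "k' ?i" "k' (Suc ?i)" k] k'(1)[of ?i] k thick_halfspace[of k] by simp
      then show False
        using b \<open>b \<notin> k' ?i\<close> z[of ?i] k unfolding cuts_def by auto
    qed
    then have "k' (Suc ?i) \<subseteq> k"
      using meet[of k "k' (Suc ?i)"] inS[of "Suc ?i"] k unfolding cuts_def by auto
    have st: "step r (k' (Suc ?i)) (k' (?i + 2))"
      using k'(1)[of "Suc ?i"] by simp
    have "step r k (k' (?i + 2))"
      using step_mono[OF st \<open>k' (Suc ?i) \<subseteq> k\<close> order_refl] k st unfolding step_def by blast
    moreover have "?P (k' (?i + 2))"
      using st k'(3) z[of "?i + 2"] unfolding step_def by auto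
    ultimately show ?thesis
      by blast
  qed
  ultimately show ?thesis
    using dependent_nat_choice[of "\<lambda>_. ?P" "\<lambda>_ k l. step r k l"] unfolding chain_def by auto
qed

end

context median_action
begin

lemma act_strongly_separated [simp]:
  "strongly_separated (act g ` h) (act g ` k) \<longleftrightarrow> strongly_separated h k"
proof -
  have "strongly_separated (act g ` h) (act g ` k)" if "strongly_separated h k" for g h k
    unfolding strongly_separated_def
  proof (intro conjI notI)
    show "act g ` h \<inter> act g ` k = {}"
      using that unfolding strongly_separated_def by (simp flip: act_image_Int)
    assume "\<exists>j. halfspace j \<and> transverse j (act g ` h) \<and> transverse j (act g ` k)"
    then obtain j where "halfspace j" "transverse j (act g ` h)" "transverse j (act g ` k)"
      by blast
    then have "halfspace (act (- g) ` j)" "transverse (act (- g) ` j) h" "transverse (act (- g) ` j) k"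
      using act_transverse[of g "act (- g) ` j"] by (simp_all add: act_image_comp)
    then show False
      using that unfolding strongly_separated_def by blast
  qed
  from this[of h k g] this[of "act g ` h" "act g ` k" "- g"] show ?thesis
    by (auto simp: act_image_comp)
qed

lemma act_step: "step r h k \<Longrightarrow> step r (act g ` h) (act g ` k)"
proof -
  assume st: "step r h k"
  have "act g ` k \<subset> act g ` h"
    using st act_image_mono unfolding step_def by blast
  moreover have "strongly_separated (- act g ` h) (act g ` k)"
    using st unfolding step_def by (simp flip: act_image_Compl)
  moreover have "r \<le> dist a b" if "a \<notin> act g ` h" "b \<in> act g ` k" for a b
  proof -
    have "r \<le> dist (act (- g) a) (act (- g) b)"
      using st that unfolding step_def in_act_image by blast
    then show ?thesis
      by simp
  qed
  ultimately show ?thesis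
    using st unfolding step_def by simp
qed

lemma act_ends_at: "ends_at k \<xi> \<Longrightarrow> ends_at (\<lambda>n. act g ` k n) (roller_act act g \<xi>)"
  unfolding ends_at_def
proof (intro allI)
  fix a c assume *: "\<forall>a c. \<exists>N. \<forall>y\<in>k N. median y a c = \<xi> (a, c)"
  then obtain N where N: "\<forall>y\<in>k N. median y (act (- g) a) (act (- g) c) = \<xi> (act (- g) a, act (- g) c)"
    by blast
  have "median (act g y) a c = roller_act act g \<xi> (a, c)" if "y \<in> k N" for y
  proof -
    have "median (act g y) a c = act g (median y (act (- g) a) (act (- g) c))"
      by (simp add: act_median)
    then show ?thesis
      using N that by (simp add: roller_act_def)
  qed
  then show "\<exists>N. \<forall>y\<in>act g ` k N. median y a c = roller_act act g \<xi> (a, c)"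
    by (intro exI[of _ N]) blast
qed

definition int_power :: "'g \<Rightarrow> int \<Rightarrow> 'g" where
  "int_power t i = (if i \<ge> 0 then iter t (nat i) else - iter t (nat (- i)))"

lemma int_power_step: "int_power t (i + 1) = t + int_power t i"
proof (cases "i \<ge> 0")
  case True
  then have "nat (i + 1) = Suc (nat i)"
    by simp
  then show ?thesis
    using True by (simp add: int_power_def)
next
  case False
  then obtain n where n: "i = - int (Suc n)"
    by (metis not_le zero_le_imp_eq_int minus_minus neg_0_less_iff_less Suc_pred of_nat_0_less_iff
        order_less_imp_le neg_le_0_iff_le linorder_not_le)
  have "iter t (Suc n) = iter t n + t"
    using iter_add[of t n 1] by simp
  moreover have "nat (- i) = Suc n" "nat (- (i + 1)) = n" "i + 1 \<ge> 0 \<longleftrightarrow> n = 0"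
    using n by auto
  moreover have "t + - (t + iter t n) = - iter t n" if "t + iter t n = iter t n + t"
    unfolding that minus_add by (simp only: add.assoc[symmetric] right_minus add_0)
  ultimately show ?thesis
    using n by (auto simp: int_power_def)
qed

end

context irreducible_minimal_action
begin

text \<open>
  If \<open>h\<close> and \<open>k\<close> are strongly separated and \<open>t (- k) \<subseteq> h\<close>, then \<open>- h \<subseteq> t k\<close>, so \<open>- h\<close> and \<open>t h\<close> are strongly separated
  with the same gap.
\<close>

lemma ex_ladder:
  obtains c :: "int \<Rightarrow> 'x set" and t r where "r > 0"
    "\<And>i. step r (c i) (c (i + 1))" "\<And>i. c (i + 1) = act t ` c i"
proof -
  obtain h k :: "'x set" and r where hk: "thick h" "thick k" "h \<union> k \<noteq> UNIV" "strongly_separated h k"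
    "r > 0" "\<And>a b. a \<in> h \<Longrightarrow> b \<in> k \<Longrightarrow> r \<le> dist a b"
    using strongly_separated_gap by metis
  have sub: "h \<subseteq> - k"
    using hk(4) unfolding strongly_separated_def by blast
  obtain t where t: "act t ` (- k) \<subseteq> h"
    using skewer[of h "- k"] hk(1,2) sub by auto
  have th: "act t ` h \<subseteq> act t ` (- k)"
    using sub by (rule image_mono)
  have tk: "- h \<subseteq> act t ` k"
    using t unfolding act_image_Compl by blast
  define c where "c i = act (int_power t i) ` h" for i
  have c1: "c (i + 1) = act t ` c i" for i
    unfolding c_def by (simp add: int_power_step act_image_comp)
  have "strongly_separated (- h) (act t ` h)"
    by (rule strongly_separated_mono[OF _ tk order_refl]) (simp add: hk(4) strongly_separated_sym[of k])
  moreover have "act t ` h \<subset> h"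
  proof -
    obtain z where "z \<notin> h" "z \<notin> k"
      using hk(3) by blast
    then have "act t z \<in> h" "act t z \<notin> act t ` h"
      using t by (auto simp: in_act_image)
    then show ?thesis
      using t th by blast
  qed
  moreover have "r \<le> dist a b" if ab: "a \<notin> h" "b \<in> act t ` h" for a b
  proof -
    have "a \<in> act t ` k"
      using ab(1) tk by blast
    then have "r \<le> dist (act (- t) b) (act (- t) a)"
      using ab(2) hk(6) unfolding in_act_image by blast
    then show ?thesis
      by (simp add: dist_commute)
  qed
  ultimately have st: "step r h (act t ` h)"
    unfolding step_def using hk(1) by auto
  have "step r (c i) (c (i + 1))" for i
  proof (induction i rule: int_induct[of _ 0])
    case base
    show ?case
      using st by (simp add: c1) (simp add: c_def int_power_def)
  next
    case (step1 i)
    then show ?case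
      using act_step[of r "c i" "c (i + 1)" t] by (simp only: c1)
  next
    case (step2 i)
    have "c i = act t ` c (i - 1)" "c (i + 1) = act t ` c (i - 1 + 1)"
      using c1[of "i - 1"] c1[of i] by simp_all
    then show ?case
      using act_step[OF step2(2), of "- t"] by (simp add: act_image_comp)
  qed
  then show thesis
    using that c1 hk(5) by blast
qed

text \<open>
  The two ends of a ladder cannot form an invariant set, as the action is non-elementary. A translate of one of
  them that is different from both provides the third direction.
\<close>

lemma ex_facing_ladder:
  obtains c :: "int \<Rightarrow> 'x set" and t r g n where "r > 0"
    "\<And>i. step r (c i) (c (i + 1))" "\<And>i. c (i + 1) = act t ` c i"
    "c n \<inter> - c (- n) = {}" "c n \<inter> act g ` c n = {}" "- c (- n) \<inter> act g ` c n = {}"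
proof -
  obtain c :: "int \<Rightarrow> 'x set" and t r where c: "r > 0"
    "\<And>i. step r (c i) (c (i + 1))" "\<And>i. c (i + 1) = act t ` c i"
    using ex_ladder by metis
  define k where "k n = c (int n)" for n
  define l where "l n = - c (- int n)" for n
  have k: "chain r k"
    using c(2)[of "int _"] unfolding chain_def k_def of_nat_Suc by (simp add: add.commute)
  have "step r (l n) (l (Suc n))" for n
    using step_Compl[OF c(2)[of "- int (Suc n)"]] by (simp add: l_def)
  then have l: "chain r l"
    by (simp add: chain_def)
  obtain \<xi> where \<xi>: "ends_at k \<xi>"
    using ex_end[OF k c(1)] by blast
  obtain \<eta> where \<eta>: "ends_at l \<eta>"
    using ex_end[OF l c(1)] by blast
  have "infinite (range (\<lambda>g. roller_act act g \<xi>))"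
    using nonelementary end_in_compactification[OF k \<xi>] unfolding roller_nonelementary_def by blast
  then have "\<not> range (\<lambda>g. roller_act act g \<xi>) \<subseteq> {\<xi>, \<eta>}"
    using finite_subset by blast
  then obtain g where g: "roller_act act g \<xi> \<noteq> \<xi>" "roller_act act g \<xi> \<noteq> \<eta>"
    by blast
  have gk: "chain r (\<lambda>n. act g ` k n)"
    using act_step chainD[OF k] by (simp add: chain_def)
  note gend = act_ends_at[OF \<xi>, of g]
  obtain N1 where N1: "\<forall>n\<ge>N1. k n \<inter> act g ` k n = {}"
    using distinct_ends_disjoint[OF k \<xi> gk gend] g(1) by auto
  obtain N2 where N2: "\<forall>n\<ge>N2. l n \<inter> act g ` k n = {}"
    using distinct_ends_disjoint[OF l \<eta> gk gend] g(2) by auto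
  define n where "n = max N1 N2"
  have "k n \<subseteq> k 0" "l n \<subseteq> l 0"
    using chain_sub[OF k, of 0 n] chain_sub[OF l, of 0 n] by auto
  then have "k n \<inter> l n = {}"
    unfolding k_def l_def by auto
  moreover have "k n \<inter> act g ` k n = {}" "l n \<inter> act g ` k n = {}"
    using N1 N2 unfolding n_def by auto
  ultimately show thesis
    using that[of r c t "int n" g] c unfolding k_def l_def by blast
qed

end

section \<open>Isometric ergodicity for separable metric spaces\<close>

text \<open>
  A point is coded by the set of basic balls that contain it.
\<close>

lemma inj_on_separable_real:
  fixes Z :: "'z::metric_space set"
  assumes "countable D" "\<And>z e. z \<in> Z \<Longrightarrow> e > 0 \<Longrightarrow> \<exists>w\<in>D. dist w z < e"
  shows "\<exists>\<iota> :: 'z \<Rightarrow> real. inj_on \<iota> Z"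
proof (cases "Z = {}")
  case False
  then have "D \<noteq> {}"
    using assms(2)[of _ 1] by auto
  then have q: "range (from_nat_into D) = D"
    using assms(1) by (rule range_from_nat_into)
  define code where "code z = prod_encode ` {(n, m). dist (from_nat_into D n) z < 1 / Suc m}" for z
  have code_iff: "prod_encode (n, m) \<in> code z \<longleftrightarrow> dist (from_nat_into D n) z < 1 / Suc m" for n m z
    unfolding code_def inj_image_mem_iff[OF inj_prod_encode] by simp
  have "inj_on code Z"
  proof (rule inj_onI, rule ccontr)
    fix z w assume zw: "z \<in> Z" "w \<in> Z" "code z = code w" "z \<noteq> w"
    then obtain m where m: "1 / Suc m < dist z w / 2"
      using reals_Archimedean[of "dist z w / 2"] by (auto simp: inverse_eq_divide)
    have "0 < 1 / real (Suc m)"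
      by simp
    then obtain v where v: "v \<in> D" "dist v z < 1 / Suc m"
      using assms(2)[OF zw(1)] by blast
    obtain n where n': "from_nat_into D n = v"
      using from_nat_into_surj[OF assms(1) v(1)] by blast
    have n: "dist (from_nat_into D n) z < 1 / Suc m"
      unfolding n' by (rule v(2))
    then have "dist (from_nat_into D n) w < 1 / Suc m"
      using code_iff[of n m z] code_iff[of n m w] zw(3) by simp
    then show False
      using n m dist_triangle3[of z w "from_nat_into D n"] by linarith
  qed
  moreover obtain h :: "nat set \<Rightarrow> real" where "inj h"
    using nat_sets_eqpoll_reals unfolding eqpoll_def bij_betw_def by blast
  ultimately have "inj_on (h \<circ> code) Z"
    by (meson comp_inj_on inj_on_subset subset_UNIV)
  then show ?thesis
    by blast
qed simp

text \<open>The metric is transported along an injection into the reals.\<close>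

lemma ergodic_constant:
  fixes Z :: "'z::metric_space set" and A :: "'g::topological_group_add \<Rightarrow> 'c \<Rightarrow> 'c"
    and \<rho> :: "'g \<Rightarrow> 'z \<Rightarrow> 'z"
  assumes erg: "isometrically_ergodic A M" and ne: "space M \<noteq> {}"
    and D: "countable D" "D \<subseteq> Z" "\<And>z e. z \<in> Z \<Longrightarrow> e > 0 \<Longrightarrow> \<exists>w\<in>D. dist w z < e"
    and \<rho>: "action_on \<rho> Z" "\<And>g z w. z \<in> Z \<Longrightarrow> w \<in> Z \<Longrightarrow> dist (\<rho> g z) (\<rho> g w) = dist z w"
      "\<And>g z e. z \<in> Z \<Longrightarrow> e > 0 \<Longrightarrow> \<exists>V. open V \<and> g \<in> V \<and> (\<forall>g'\<in>V. dist (\<rho> g' z) (\<rho> g z) < e)"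
    and f: "\<And>x. x \<in> space M \<Longrightarrow> f x \<in> Z" "\<And>w e. w \<in> Z \<Longrightarrow> {x \<in> space M. dist w (f x) < e} \<in> sets M"
      "\<And>g. AE x in M. f (A g x) = \<rho> g (f x)"
  shows "\<exists>z\<in>Z. AE x in M. f x = z"
proof -
  obtain \<iota> :: "'z \<Rightarrow> real" where \<iota>: "inj_on \<iota> Z"
    using inj_on_separable_real[OF D(1,3)] by blast
  define \<kappa> where "\<kappa> = the_inv_into Z \<iota>"
  have \<kappa>: "\<kappa> (\<iota> z) = z" if "z \<in> Z" for z
    unfolding \<kappa>_def using the_inv_into_f_f[OF \<iota> that] .
  define d where "d r s = dist (\<kappa> r) (\<kappa> s)" for r s
  let ?Z = "\<iota> ` Z"
  have MZ: "Metric_space ?Z d"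
    by unfold_locales (auto simp: d_def \<kappa> dist_commute dist_triangle inj_on_eq_iff[OF \<iota>])
  interpret MZ: Metric_space ?Z d
    by (rule MZ)
  have mball: "MZ.mball (\<iota> z) e = \<iota> ` {w \<in> Z. dist z w < e}" if "z \<in> Z" for z e
    using that by (auto simp: MZ.mball_def d_def \<kappa>)
  have "separable_space MZ.mtopology"
    unfolding separable_space_def
  proof (intro exI[of _ "\<iota> ` D"] conjI)
    have "\<exists>y\<in>\<iota> ` D. y \<in> MZ.mball x e" if x: "x \<in> ?Z" and e: "e > 0" for x e
    proof -
      obtain z where z: "x = \<iota> z" "z \<in> Z"
        using x by (elim imageE)
      obtain w where "w \<in> D" "dist w z < e"
        using D(3)[OF z(2) e] by (elim bexE)
      then show ?thesis
        using D(2) unfolding z(1) mball[OF z(2)] by (intro bexI[of _ "\<iota> w"]) (auto simp: dist_commute)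
    qed
    then show "MZ.mtopology closure_of \<iota> ` D = topspace MZ.mtopology"
      unfolding MZ.metric_closure_of MZ.topspace_mtopology by (intro equalityI subsetI CollectI) simp_all
    show "countable (\<iota> ` D)" "\<iota> ` D \<subseteq> topspace MZ.mtopology"
      using D(1,2) by (simp_all add: image_mono)
  qed
  moreover define \<rho>' where "\<rho>' g r = \<iota> (\<rho> g (\<kappa> r))" for g r
  have act: "\<rho> g z \<in> Z" "\<rho> 0 z = z" "\<rho> (g + h) z = \<rho> g (\<rho> h z)" if "z \<in> Z" for g h z
    using \<rho>(1) that unfolding action_on_def by auto
  have "continuous_isometric_action \<rho>' ?Z d"
    unfolding continuous_isometric_action_def
  proof (intro conjI)
    show "action_on \<rho>' ?Z"
      unfolding action_on_def by (auto simp: \<rho>'_def \<kappa> act)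
    show "\<forall>g. \<forall>x\<in>?Z. \<forall>y\<in>?Z. d (\<rho>' g x) (\<rho>' g y) = d x y"
      by (auto simp: \<rho>'_def d_def \<kappa> act \<rho>(2))
    show "continuous_map (prod_topology euclidean MZ.mtopology) MZ.mtopology (\<lambda>(g, x). \<rho>' g x)"
      unfolding MZ.continuous_map_to_metric
    proof (intro ballI allI impI)
      fix p and e :: real assume p: "p \<in> topspace (prod_topology (euclidean :: 'g topology) MZ.mtopology)" and e: "e > 0"
      then obtain g z where gz: "p = (g, \<iota> z)" "z \<in> Z"
        by auto
      obtain V where V: "open V" "g \<in> V" "\<And>g'. g' \<in> V \<Longrightarrow> dist (\<rho> g' z) (\<rho> g z) < e / 2"
        using \<rho>(3)[OF gz(2), of "e / 2" g] e by auto
      let ?U = "V \<times> MZ.mball (\<iota> z) (e / 2)"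
      have "openin (prod_topology euclidean MZ.mtopology) ?U"
        using V(1) by (simp add: openin_prod_Times_iff)
      moreover have "p \<in> ?U"
        using gz V(2) e by (auto simp: mball)
      moreover have "(case y of (g, x) \<Rightarrow> \<rho>' g x) \<in> MZ.mball (case p of (g, x) \<Rightarrow> \<rho>' g x) e" if y: "y \<in> ?U" for y
      proof -
        obtain g' w where w: "y = (g', \<iota> w)" "g' \<in> V" "w \<in> Z" "dist z w < e / 2"
          using y by (auto simp: mball[OF gz(2)])
        have "dist (\<rho> g z) (\<rho> g' w) \<le> dist (\<rho> g z) (\<rho> g' z) + dist (\<rho> g' z) (\<rho> g' w)"
          by (rule dist_triangle)
        also have "\<dots> < e"
          using V(3)[OF w(2)] w(3,4) \<rho>(2)[OF gz(2) w(3), of g'] by (simp add: dist_commute)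
        finally show ?thesis
          using w gz act(1) by (auto simp: \<rho>'_def \<kappa> mball)
      qed
      ultimately show "\<exists>U. openin (prod_topology euclidean MZ.mtopology) U \<and> p \<in> U \<and>
          (\<forall>y\<in>U. (case y of (g, x) \<Rightarrow> \<rho>' g x) \<in> MZ.mball (case p of (g, x) \<Rightarrow> \<rho>' g x) e)"
        by blast
    qed
  qed
  moreover define f' where "f' = \<iota> \<circ> f"
  have "f' \<in> measurable M (borel_of_topology MZ.mtopology)"
    unfolding borel_of_topology_def
  proof (rule measurable_measure_of)
    show "{U. openin MZ.mtopology U} \<subseteq> Pow (topspace MZ.mtopology)"
      using openin_subset[of MZ.mtopology] by blast
    show "f' \<in> space M \<rightarrow> topspace MZ.mtopology"
      using f(1) by (auto simp: f'_def)
    fix U assume "U \<in> {U. openin MZ.mtopology U}"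
    then have U: "U \<subseteq> ?Z" "\<And>x. x \<in> U \<Longrightarrow> \<exists>r>0. MZ.mball x r \<subseteq> U"
      unfolding MZ.openin_mtopology by auto
    let ?I = "{(w, m :: nat). w \<in> D \<and> MZ.mball (\<iota> w) (1 / Suc m) \<subseteq> U}"
    let ?S = "\<lambda>(w, m :: nat). {x \<in> space M. dist w (f x) < 1 / Suc m}"
    have "f' -` U \<inter> space M = (\<Union>i\<in>?I. ?S i)"
    proof (intro equalityI subsetI)
      fix x assume x: "x \<in> f' -` U \<inter> space M"
      then obtain e where e: "e > 0" "MZ.mball (\<iota> (f x)) e \<subseteq> U"
        using U(2)[of "\<iota> (f x)"] by (auto simp: f'_def)
      have fx: "f x \<in> Z"
        using f(1) x by blast
      obtain m where m: "1 / Suc m < e / 2"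
        using reals_Archimedean[of "e / 2"] e(1) by (auto simp: inverse_eq_divide)
      obtain w where w: "w \<in> D" "dist w (f x) < 1 / Suc m"
        using D(3)[OF fx, of "1 / Suc m"] by auto
      have "MZ.mball (\<iota> w) (1 / Suc m) \<subseteq> MZ.mball (\<iota> (f x)) e"
      proof -
        have "dist (f x) v < e" if "dist w v < 1 / Suc m" for v
          using that w(2) m dist_triangle3[of "f x" v w] by linarith
        then show ?thesis
          using w(1) D(2) fx by (auto simp: mball subset_iff)
      qed
      then show "x \<in> (\<Union>i\<in>?I. ?S i)"
        using w x e(2) by blast
    next
      fix x assume "x \<in> (\<Union>i\<in>?I. ?S i)"
      then obtain w m where w: "w \<in> D" "MZ.mball (\<iota> w) (1 / Suc m) \<subseteq> U" "x \<in> space M" "dist w (f x) < 1 / Suc m"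
        by blast
      then have "\<iota> (f x) \<in> MZ.mball (\<iota> w) (1 / Suc m)"
        unfolding mball[OF subsetD[OF D(2) w(1)]] using f(1) by blast
      then show "x \<in> f' -` U \<inter> space M"
        using w(2,3) by (auto simp: f'_def)
    qed
    moreover have "(\<Union>i\<in>?I. ?S i) \<in> sets M"
    proof (rule sets.countable_UN'')
      show "countable ?I"
      by (rule countable_subset[of _ "D \<times> UNIV"]) (use D(1) in auto)
      show "?S i \<in> sets M" if "i \<in> ?I" for i
        using f(2) D(2) that by (auto split: prod.splits)
    qed
    ultimately show "f' -` U \<inter> space M \<in> sets M"
      by (simp only:)
  qed
  moreover have "AE x in M. f' (A g x) = \<rho>' g (f' x)" for g
    using f(3)[of g] AE_space by eventually_elim (simp add: f'_def \<rho>'_def \<kappa> f(1))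
  ultimately have "\<exists>z\<in>?Z. AE x in M. f' x = z"
    using erg MZ unfolding isometrically_ergodic_def by blast
  then obtain z where z: "z \<in> Z" "AE x in M. f' x = \<iota> z"
    by blast
  have "AE x in M. f x = z"
    using z(2) AE_space by eventually_elim (use f(1) z(1) \<iota> in \<open>auto simp: f'_def inj_on_eq_iff\<close>)
  then show ?thesis
    using z(1) by blast
qed

lemma ergodic_constant_real:
  fixes A :: "'g::topological_group_add \<Rightarrow> 'c \<Rightarrow> 'c" and f :: "'c \<Rightarrow> real"
  assumes "isometrically_ergodic A M" "space M \<noteq> {}" "f \<in> borel_measurable M"
    and "\<And>g. AE x in M. f (A g x) = f x"
  shows "\<exists>z. AE x in M. f x = z"
proof -
  have "\<exists>w\<in>\<rat>. dist w z < e" if e: "e > 0" for z e :: real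
  proof -
    obtain w where "w \<in> \<rat>" "z < w" "w < z + e"
      using Rats_dense_in_real[of z "z + e"] e by auto
    then show ?thesis
      by (intro bexI[of _ w]) (auto simp: dist_real_def)
  qed
  moreover have "{x \<in> space M. dist w (f x) < e} \<in> sets M" for w e
    using assms(3) by measurable
  ultimately have "\<exists>z\<in>UNIV. AE x in M. f x = z"
    using assms(1,2,4)
    by (intro ergodic_constant[where D = \<rat> and \<rho> = "\<lambda>_. id" and A = A])
      (auto simp: action_on_def countable_rat intro!: exI[of _ UNIV])
  then show ?thesis
    by blast
qed

section \<open>Null sets for measure class preserving actions\<close>

lemma AE_action:
  assumes "measure_class_preserving_action a M" "AE x in M. P x"
  shows "AE x in M. P (a g x)"
proof -
  have a: "a g x \<in> space M" if "x \<in> space M" for x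
    using assms(1) that unfolding measure_class_preserving_action_def action_on_def by blast
  obtain N where N: "{x \<in> space M. \<not> P x} \<subseteq> N" "emeasure M N = 0" "N \<in> sets M"
    using assms(2) by (rule AE_E)
  have "emeasure M (a g -` N \<inter> space M) = 0"
    using assms(1) N(2,3) unfolding measure_class_preserving_action_def by blast
  moreover have "a g -` N \<inter> space M \<in> sets M"
  proof (rule measurable_sets[OF _ N(3)])
    have "(\<lambda>x. (g, x)) \<in> measurable M (borel \<Otimes>\<^sub>M M)"
      by simp
    from measurable_comp[OF this, of "\<lambda>(g, x). a g x" M] show "a g \<in> measurable M M"
      using assms(1) unfolding measure_class_preserving_action_def by (simp add: comp_def)
  qed
  moreover have "{x \<in> space M. \<not> P (a g x)} \<subseteq> a g -` N \<inter> space M"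
    using N(1) a by blast
  ultimately show ?thesis
    by (intro AE_I)
qed

lemma (in pair_sigma_finite) AE_pair_fst: "AE x in M1. P x \<Longrightarrow> AE (x, y) in M1 \<Otimes>\<^sub>M M2. P x"
proof -
  assume "AE x in M1. P x"
  then obtain N where N: "{x \<in> space M1. \<not> P x} \<subseteq> N" "emeasure M1 N = 0" "N \<in> sets M1"
    by (rule AE_E)
  have "emeasure (M1 \<Otimes>\<^sub>M M2) (N \<times> space M2) = 0"
    using N by (simp add: M2.emeasure_pair_measure_Times)
  moreover have "N \<times> space M2 \<in> sets (M1 \<Otimes>\<^sub>M M2)"
    using N(3) by simp
  moreover have "{p \<in> space (M1 \<Otimes>\<^sub>M M2). \<not> (case p of (x, y) \<Rightarrow> P x)} \<subseteq> N \<times> space M2"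
    using N(1) by (auto simp: space_pair_measure)
  ultimately show ?thesis
    by (intro AE_I)
qed

lemma (in pair_sigma_finite) AE_pair_snd: "AE y in M2. P y \<Longrightarrow> AE (x, y) in M1 \<Otimes>\<^sub>M M2. P y"
proof -
  assume "AE y in M2. P y"
  then obtain N where N: "{y \<in> space M2. \<not> P y} \<subseteq> N" "emeasure M2 N = 0" "N \<in> sets M2"
    by (rule AE_E)
  have "emeasure (M1 \<Otimes>\<^sub>M M2) (space M1 \<times> N) = 0"
    using N by (simp add: M2.emeasure_pair_measure_Times)
  moreover have "space M1 \<times> N \<in> sets (M1 \<Otimes>\<^sub>M M2)"
    using N(3) by simp
  moreover have "{p \<in> space (M1 \<Otimes>\<^sub>M M2). \<not> (case p of (x, y) \<Rightarrow> P y)} \<subseteq> space M1 \<times> N"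
    using N(1) by (auto simp: space_pair_measure)
  ultimately show ?thesis
    by (intro AE_I)
qed

section \<open>Means\<close>

text \<open>The Gromov product of \<open>x\<close> and \<open>q\<close> at \<open>p\<close>.\<close>

definition gprod :: "'x::metric_space \<Rightarrow> 'x \<Rightarrow> 'x \<Rightarrow> real" where
  "gprod p q x = dist p (median x p q)"

text \<open>
  A mean assigns numbers to the functions \<^term>\<open>gprod p q\<close> as integration against a probability measure on
  the Roller compactification would. Positivity on the linear span of these functions and the
  constants is all that is required.
\<close>

definition mean :: "('x::metric_space \<Rightarrow> 'x \<Rightarrow> real) \<Rightarrow> bool" where
  "mean \<nu> \<longleftrightarrow> (\<forall>n a p q c. (\<forall>x. (\<Sum>i<n. a i * gprod (p i) (q i) x) \<le> c) \<longrightarrow>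
     (\<Sum>i<(n :: nat). a i * \<nu> (p i) (q i)) \<le> c)"

lemma mean_le_sum:
  assumes "mean \<nu>" "\<And>x. (\<Sum>i<n. a i * gprod (p i) (q i) x) \<le> c"
  shows "(\<Sum>i<(n :: nat). a i * \<nu> (p i) (q i)) \<le> c"
  using assms unfolding mean_def by blast

lemma mean_le1:
  assumes "mean \<nu>" "\<And>x. a * gprod p q x \<le> c"
  shows "a * \<nu> p q \<le> c"
  using mean_le_sum[OF assms(1), where n = 1 and a = "\<lambda>_. a" and p = "\<lambda>_. p" and q = "\<lambda>_. q" and c = c] assms(2) by simp

lemma mean_le2:
  assumes "mean \<nu>" "\<And>x. a * gprod p q x + b * gprod p' q' x \<le> c"
  shows "a * \<nu> p q + b * \<nu> p' q' \<le> c"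
  using mean_le_sum[OF assms(1), where n = 2 and a = "\<lambda>i. if i = 0 then a else b"
      and p = "\<lambda>i. if i = 0 then p else p'" and q = "\<lambda>i. if i = 0 then q else q'" and c = c]
    assms(2) by (simp add: numeral_2_eq_2)

text \<open>
  The function \<open>gprod p q\<close> vanishes outside \<open>h\<close> and is at most \<open>dist p q\<close>. A mean that nevertheless has the
  value \<open>dist p q\<close> is concentrated on \<open>h\<close>.
\<close>

definition sees :: "('x::metric_space \<Rightarrow> 'x \<Rightarrow> real) \<Rightarrow> 'x set \<Rightarrow> bool" where
  "sees \<nu> h \<longleftrightarrow> (\<exists>p q. p \<noteq> q \<and> (\<forall>x. x \<notin> h \<longrightarrow> median x p q = p) \<and> \<nu> p q = dist p q)"

lemma sees_mono: "sees \<nu> h \<Longrightarrow> h \<subseteq> k \<Longrightarrow> sees \<nu> k"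
  unfolding sees_def by blast

context median_metric
begin

lemma gprod_eq: "gprod p q x = (dist p q + dist p x - dist q x) / 2" for p :: 'x
  unfolding gprod_def by (rule dist_median)

lemma gprod_nonneg: "0 \<le> gprod p q x" for p :: 'x
  by (simp add: gprod_def)

lemma gprod_le: "gprod p q x \<le> dist p q" for p :: 'x
  unfolding gprod_eq using dist_triangle[of p x q] by simp

lemma gprod_swap: "gprod q p x = dist p q - gprod p q x" for p :: 'x
  unfolding gprod_eq by (simp add: dist_commute field_simps)

lemma gprod_lipschitz: "gprod p q x - gprod p' q' x \<le> dist p p' + dist q q'" for p :: 'x
proof -
  have "dist p q \<le> dist p' q' + dist p p' + dist q q'"
    using dist_triangle[of p q p'] dist_triangle[of p' q q'] by (simp add: dist_commute)
  moreover have "dist p x \<le> dist p p' + dist p' x"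
    by (rule dist_triangle)
  moreover have "dist q' x \<le> dist q q' + dist q x"
    using dist_triangle[of q' x q] by (simp add: dist_commute)
  ultimately show ?thesis
    unfolding gprod_eq by (simp add: field_simps)
qed

lemma mean_nonneg: "mean \<nu> \<Longrightarrow> 0 \<le> \<nu> p q" for p :: 'x
  using mean_le1[of \<nu> "- 1" p q 0] gprod_nonneg by simp

lemma mean_le: "mean \<nu> \<Longrightarrow> \<nu> p q \<le> dist p q" for p :: 'x
  using mean_le1[of \<nu> 1 p q "dist p q"] gprod_le by simp

lemma mean_lipschitz:
  fixes p :: 'x
  assumes "mean \<nu>"
  shows "\<bar>\<nu> p q - \<nu> p' q'\<bar> \<le> dist p p' + dist q q'"
proof -
  have "\<nu> p q - \<nu> p' q' \<le> dist p p' + dist q q'" for p q p' q' :: 'x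
    using mean_le2[OF assms, of 1 p q "- 1" p' q'] gprod_lipschitz[of p q _ p' q'] by simp
  from this[of p q p' q'] this[of p' q' p q] show ?thesis
    by (simp add: abs_le_iff dist_commute)
qed

lemma mean_swap:
  fixes p :: 'x
  assumes "mean \<nu>"
  shows "\<nu> q p = dist p q - \<nu> p q"
proof -
  have *: "gprod p q x + gprod q p x = dist p q" for x
    unfolding gprod_swap[of q p x] by simp
  have "1 * \<nu> p q + 1 * \<nu> q p \<le> dist p q"
    by (rule mean_le2[OF assms]) (simp add: *)
  moreover have "- 1 * \<nu> p q + - 1 * \<nu> q p \<le> - dist p q"
    by (rule mean_le2[OF assms]) (use * in \<open>simp add: algebra_simps\<close>)
  ultimately show ?thesis
    by simp
qed

lemma mean_prod_bounds:
  fixes p p' :: 'x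
  assumes "mean \<nu>" "mean \<nu>'"
  shows "0 \<le> \<nu> p q * \<nu>' p' q'" "\<nu> p q * \<nu>' p' q' \<le> dist p q * dist p' q'"
  using mean_nonneg[OF assms(1), of p q] mean_nonneg[OF assms(2), of p' q'] mean_le[OF assms(1), of p q]
    mean_le[OF assms(2), of p' q'] by (auto intro!: mult_mono)

text \<open>
  For disjoint \<open>h\<close> and \<open>k\<close> the sum of the two normalized test functions would be at most 1, while its mean is 2.
\<close>

lemma sees_meet:
  fixes h :: "'x set"
  assumes "mean \<nu>" "sees \<nu> h" "sees \<nu> k"
  shows "h \<inter> k \<noteq> {}"
proof
  assume hk: "h \<inter> k = {}"
  obtain p q where p: "p \<noteq> q" "\<And>x. x \<notin> h \<Longrightarrow> median x p q = p" "\<nu> p q = dist p q"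
    using assms(2) unfolding sees_def by blast
  obtain p' q' where p': "p' \<noteq> q'" "\<And>x. x \<notin> k \<Longrightarrow> median x p' q' = p'" "\<nu> p' q' = dist p' q'"
    using assms(3) unfolding sees_def by blast
  have "(1 / dist p q) * \<nu> p q + (1 / dist p' q') * \<nu> p' q' \<le> 1"
  proof (rule mean_le2[OF assms(1)])
    fix x
    have *: "gprod p q x / dist p q \<le> 1" "gprod p' q' x / dist p' q' \<le> 1"
      using gprod_le[of p q x] gprod_le[of p' q' x] p(1) p'(1) by simp_all
    show "1 / dist p q * gprod p q x + 1 / dist p' q' * gprod p' q' x \<le> 1"
    proof (cases "x \<in> h")
      case True
      then have "gprod p' q' x = 0"
        using p'(2)[of x] hk unfolding gprod_def by fastforce
      then show ?thesis
        using * by simp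
    next
      case False
      then have "gprod p q x = 0"
        using p(2)[of x] unfolding gprod_def by simp
      then show ?thesis
        using * by simp
    qed
  qed
  then show False
    using p(1,3) p'(1,3) by simp
qed

text \<open>
  Up to a multiple of the defect of the test function of \<open>h\<close>, which has mean zero, \<open>gprod p q\<close> is the
  constant \<open>dist p v\<close>. Hence a mean that sees all members of a chain is the evaluation at its end.
\<close>

lemma sees_const:
  fixes p :: 'x
  assumes "mean \<nu>" "sees \<nu> h" "\<And>x. x \<in> h \<Longrightarrow> median x p q = v"
  shows "\<nu> p q = dist p v"
proof -
  obtain a b where a: "a \<noteq> b" "\<And>x. x \<notin> h \<Longrightarrow> median x a b = a" "\<nu> a b = dist a b"
    using assms(2) unfolding sees_def by blast
  have h: "h \<noteq> {}"
    using sees_meet[OF assms(1,2,2)] by blast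
  then have v: "v \<in> interval p q"
    using assms(3) median_in(3) by (metis ex_in_conv)
  then have vb: "0 \<le> dist p v" "dist p v \<le> dist p q"
    by (auto dest: dist_interval)
  define c where "c = dist p q / dist a b"
  have c: "c \<ge> 0" "c * dist a b = dist p q"
    using a(1) by (simp_all add: c_def)
  have bound: "\<bar>gprod p q x - dist p v\<bar> \<le> dist p q - c * gprod a b x" for x
  proof (cases "x \<in> h")
    case True
    have "c * gprod a b x \<le> c * dist a b"
      using gprod_le[of a b x] c(1) by (rule mult_left_mono)
    then show ?thesis
      using assms(3)[OF True] c(2) by (simp add: gprod_def)
  next
    case False
    then have "c * gprod a b x = 0"
      using a(2) by (simp add: gprod_def)
    then show ?thesis
      using gprod_nonneg[of p q x] gprod_le[of p q x] vb by linarith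
  qed
  have 1: "1 * gprod p q x + c * gprod a b x \<le> dist p q + dist p v"
    and 2: "- 1 * gprod p q x + c * gprod a b x \<le> dist p q - dist p v" for x
    using bound[of x] by linarith+
  have "1 * \<nu> p q + c * \<nu> a b \<le> dist p q + dist p v"
    by (rule mean_le2[OF assms(1) 1])
  moreover have "- 1 * \<nu> p q + c * \<nu> a b \<le> dist p q - dist p v"
    by (rule mean_le2[OF assms(1) 2])
  ultimately show ?thesis
    using c(2) a(3) by simp
qed

end

lemma (in median_action) gprod_act: "gprod (act g p) (act g q) x = gprod p q (act (- g) x)"
  unfolding gprod_eq by (metis act_dist act_minus(2))

lemma (in median_action) continuous_act: "continuous_on UNIV (\<lambda>g. act g x)"
proof -
  have "continuous_map (prod_topology euclidean euclidean) euclidean (\<lambda>(g, x). act g x)"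
    using action unfolding continuous_isometric_action_def by simp
  then have "continuous_on UNIV (\<lambda>(g, x). act g x)"
    by (simp flip: euclidean_product_topology)
  then have "continuous_on UNIV ((\<lambda>(g, x). act g x) \<circ> (\<lambda>g. (g, x)))"
    by (intro continuous_on_compose continuous_intros) (auto intro: continuous_on_subset)
  then show ?thesis
    by (simp add: comp_def)
qed

lemma (in median_action) continuous_mean_act:
  assumes "mean \<nu>"
  shows "continuous_on UNIV (\<lambda>g. \<nu> (act g p) (act g q))"
  unfolding continuous_on_def
proof (intro ballI)
  fix g
  have lim: "((\<lambda>h. act h x) \<longlongrightarrow> act g x) (at g)" for x
    using continuous_act unfolding continuous_on_def by blast
  have "((\<lambda>h. dist (act h p) (act g p) + dist (act h q) (act g q)) \<longlongrightarrow>
      dist (act g p) (act g p) + dist (act g q) (act g q)) (at g)"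
    by (intro tendsto_intros lim)
  then have *: "((\<lambda>h. dist (act h p) (act g p) + dist (act h q) (act g q)) \<longlongrightarrow> 0) (at g)"
    by simp
  show "((\<lambda>h. \<nu> (act h p) (act h q)) \<longlongrightarrow> \<nu> (act g p) (act g q)) (at g within UNIV)"
    unfolding LIM_zero_iff[symmetric, of _ "\<nu> (act g p) (act g q)"]
    by (rule Lim_null_comparison[OF _ *]) (simp add: mean_lipschitz[OF assms])
qed

section \<open>Suprema over the group\<close>

text \<open>
  By continuity the supremum may be taken over a countable dense set.
\<close>

lemma measurable_SUP_continuous:
  fixes f :: "'c \<Rightarrow> 'g::second_countable_topology \<Rightarrow> real"
  assumes "\<And>g. (\<lambda>x. f x g) \<in> borel_measurable M"
    and "\<And>x. x \<in> space M \<Longrightarrow> continuous_on UNIV (f x)"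
    and "\<And>x g. x \<in> space M \<Longrightarrow> f x g \<le> C"
  shows "(\<lambda>x. SUP g. f x g) \<in> borel_measurable M"
proof -
  obtain D :: "'g set" where D: "countable D" "\<And>U. open U \<Longrightarrow> U \<noteq> {} \<Longrightarrow> \<exists>d\<in>D. d \<in> U"
    using countable_dense_exists by blast
  have ne: "D \<noteq> {}"
    using D(2)[of UNIV] by auto
  have bdd: "bdd_above (f x ` S)" if "x \<in> space M" for x S
    using assms(3)[OF that] by (intro bdd_aboveI2[of _ _ C])
  have "(SUP g. f x g) = (SUP g\<in>D. f x g)" if x: "x \<in> space M" for x
  proof (rule antisym)
    show "(SUP g. f x g) \<le> (SUP g\<in>D. f x g)"
    proof (rule cSUP_least)
      fix g
      show "f x g \<le> (SUP g\<in>D. f x g)"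
      proof (rule ccontr)
        assume "\<not> f x g \<le> (SUP g\<in>D. f x g)"
        let ?U = "{h. (SUP g\<in>D. f x g) < f x h}"
        have "open ?U"
          using assms(2)[OF x] by (intro open_Collect_less continuous_on_const)
        moreover have "g \<in> ?U"
          using \<open>\<not> f x g \<le> (SUP g\<in>D. f x g)\<close> by simp
        ultimately obtain d where d: "d \<in> D" "d \<in> ?U"
          using D(2)[of ?U] by blast
        then show False
          using cSUP_upper[OF d(1) bdd[OF x]] by simp
      qed
    qed simp
    show "(SUP g\<in>D. f x g) \<le> (SUP g. f x g)"
      using ne bdd[OF x] by (intro cSUP_subset_mono) auto
  qed
  moreover have "(\<lambda>x. SUP g\<in>D. f x g) \<in> borel_measurable M"
    using bdd by (intro borel_measurable_cSUP[OF D(1) assms(1)])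
  ultimately show ?thesis
    by (simp cong: measurable_cong)
qed

lemma SUP_translate: "(SUP g. f (k + g)) = (SUP g. f g)" for f :: "'g::group_add \<Rightarrow> real"
proof -
  have "range (\<lambda>g. f (k + g)) = range f"
  proof (intro equalityI subsetI)
    fix y assume "y \<in> range f"
    then obtain g where "y = f g"
      by blast
    then have "y = f (k + (- k + g))"
      by (simp flip: add.assoc)
    then show "y \<in> range (\<lambda>g. f (k + g))"
      by (rule range_eqI)
  qed auto
  then show ?thesis
    by simp
qed

section \<open>A separable space of functions\<close>

text \<open>
  Families of weighted points of which only finitely many have large weight are encoded as
  uniform limits of finite maxima of weighted tents. In the supremum norm these functions form a separable
  metric space, on which the group acts continuously by isometries.
\<close>

definition tent :: "'x::metric_space \<Rightarrow> 'x \<Rightarrow> real" where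
  "tent z y = max 0 (1 - dist z y)"

lemma tent_bounds: "0 \<le> tent z y" "tent z y \<le> 1"
  by (auto simp: tent_def)

lemma tent_lipschitz: "tent z y \<le> tent z' y' + dist z z' + dist y y'"
  using dist_triangle[of z' y' z] dist_triangle[of z y' y] zero_le_dist[of z z'] zero_le_dist[of y y']
  unfolding tent_def by (simp add: dist_commute max_def)

primrec bump :: "(real \<times> 'x::metric_space) list \<Rightarrow> 'x \<Rightarrow> real" where
  "bump [] z = 0"
| "bump (p # xs) z = max (fst p * tent z (snd p)) (bump xs z)"

definition weights :: "(real \<times> 'x::metric_space) list \<Rightarrow> bool" where
  "weights xs \<longleftrightarrow> (\<forall>p\<in>set xs. 0 \<le> fst p \<and> fst p \<le> 1)"

lemma bump_ge: "p \<in> set xs \<Longrightarrow> fst p * tent z (snd p) \<le> bump xs z"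
  by (induction xs) auto

lemma bump_le: "0 \<le> B \<Longrightarrow> (\<And>p. p \<in> set xs \<Longrightarrow> fst p * tent z (snd p) \<le> B) \<Longrightarrow> bump xs z \<le> B"
  by (induction xs) auto

lemma bump_nonneg: "0 \<le> bump xs z"
  by (induction xs) auto

lemma bump_le_1: "weights xs \<Longrightarrow> bump xs z \<le> 1"
  using tent_bounds by (intro bump_le) (auto simp: weights_def intro!: mult_le_one)

lemma bump_perturb:
  assumes "weights xs" "e \<ge> 0"
    and "\<And>p. p \<in> set xs \<Longrightarrow> \<bar>fst p - fst (f p)\<bar> + dist (snd p) (snd (f p)) + dist z z' \<le> e"
  shows "bump xs z \<le> bump (map f xs) z' + e"
proof (rule bump_le)
  show "0 \<le> bump (map f xs) z' + e"
    using assms(2) bump_nonneg by (intro add_nonneg_nonneg)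
  fix p assume p: "p \<in> set xs"
  let ?c = "fst p" and ?y = "snd p" and ?c' = "fst (f p)" and ?y' = "snd (f p)"
  have c: "0 \<le> ?c" "?c \<le> 1"
    using assms(1) p by (auto simp: weights_def)
  have "?c * tent z ?y \<le> ?c * (tent z' ?y' + (dist z z' + dist ?y ?y'))"
    using tent_lipschitz[of z ?y z' ?y'] c by (intro mult_left_mono) auto
  also have "\<dots> \<le> ?c * tent z' ?y' + (dist z z' + dist ?y ?y')"
    using c mult_right_mono[of ?c 1 "dist z z' + dist ?y ?y'"] by (simp add: distrib_left)
  also have "?c * tent z' ?y' \<le> ?c' * tent z' ?y' + \<bar>?c - ?c'\<bar>"
  proof -
    have "(?c - ?c') * tent z' ?y' \<le> \<bar>?c - ?c'\<bar> * 1"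
      using tent_bounds by (intro mult_mono) auto
    then show ?thesis
      by (simp add: algebra_simps)
  qed
  also have "?c' * tent z' ?y' \<le> bump (map f xs) z'"
    using p by (intro bump_ge) simp
  finally show "?c * tent z ?y \<le> bump (map f xs) z' + e"
    using assms(3)[OF p] by simp
qed

lemma bump_map_close:
  assumes "weights xs" "weights (map f xs)" "e \<ge> 0"
    and "\<And>p. p \<in> set xs \<Longrightarrow> \<bar>fst p - fst (f p)\<bar> + dist (snd p) (snd (f p)) \<le> e"
  shows "\<bar>bump xs z - bump (map f xs) z\<bar> \<le> e"
proof -
  have "bump xs z \<le> bump (map f xs) z + e"
    using bump_perturb[OF assms(1,3), of f z z] assms(4) by simp
  moreover have "bump (map f xs) z \<le> bump xs z + e"
  proof (rule bump_le)
    show "0 \<le> bump xs z + e"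
      using assms(3) bump_nonneg by (intro add_nonneg_nonneg)
    fix p assume "p \<in> set (map f xs)"
    then obtain p' where p': "p' \<in> set xs" "p = f p'"
      by auto
    have "bump [p] z \<le> bump (map (\<lambda>_. p') [p]) z + e"
      using assms(2,4) p' by (intro bump_perturb[OF _ assms(3)])
        (auto simp: weights_def dist_commute abs_minus_commute)
    moreover have "bump [p'] z \<le> bump xs z"
      using bump_ge[OF p'(1), of z] bump_nonneg[of xs z] by simp
    moreover have "fst p * tent z (snd p) \<le> bump [p] z"
      by simp
    ultimately show "fst p * tent z (snd p) \<le> bump xs z + e"
      by simp linarith
  qed
  ultimately show ?thesis
    by (simp add: abs_le_iff)
qed

lemma bump_lipschitz: "weights xs \<Longrightarrow> \<bar>bump xs z - bump xs z'\<bar> \<le> dist z z'"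
  using bump_perturb[of xs "dist z z'" id z z'] bump_perturb[of xs "dist z z'" id z' z]
  by (simp add: abs_le_iff dist_commute)

lemma bcontfun_lipschitzI:
  fixes f :: "'x::metric_space \<Rightarrow> real"
  assumes "\<And>z z'. \<bar>f z - f z'\<bar> \<le> dist z z'" "\<And>z. \<bar>f z\<bar> \<le> 1"
  shows "f \<in> bcontfun"
proof (rule bcontfun_normI)
  have "1-lipschitz_on UNIV f"
    using assms(1) by (intro lipschitz_onI) (auto simp: dist_real_def)
  then show "continuous_on UNIV f"
    by (rule lipschitz_on_continuous_on)
  show "norm (f x) \<le> 1" for x
    using assms(2) by simp
qed

lemma bump_bcontfun: "weights xs \<Longrightarrow> bump xs \<in> bcontfun"
  by (rule bcontfun_lipschitzI[OF bump_lipschitz]) (simp_all add: bump_nonneg bump_le_1)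

definition bump_limits :: "('x::metric_space \<Rightarrow>\<^sub>C real) set" where
  "bump_limits = {F. \<forall>e>0. \<exists>xs. weights xs \<and> (\<forall>z. \<bar>apply_bcontfun F z - bump xs z\<bar> \<le> e)}"

lemma bump_limitsD:
  "F \<in> bump_limits \<Longrightarrow> e > 0 \<Longrightarrow> \<exists>xs. weights xs \<and> (\<forall>z. \<bar>apply_bcontfun F z - bump xs z\<bar> \<le> e)"
  by (simp add: bump_limits_def)

text \<open>
  The maxima of tents with rational weights and centres in a countable dense set are dense.
\<close>

lemma bump_limits_separable:
  obtains D :: "('x::{metric_space, second_countable_topology} \<Rightarrow>\<^sub>C real) set"
  where "countable D" "D \<subseteq> bump_limits" "\<And>F e. F \<in> bump_limits \<Longrightarrow> e > 0 \<Longrightarrow> \<exists>G\<in>D. dist G F < e"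
proof -
  obtain Q :: "'x set" where Q: "countable Q" "\<And>U. open U \<Longrightarrow> U \<noteq> {} \<Longrightarrow> \<exists>d\<in>Q. d \<in> U"
    using countable_dense_exists by blast
  let ?L = "{xs \<in> lists (\<rat> \<times> Q). weights xs}"
  define D where "D = (\<lambda>xs. Bcontfun (bump xs)) ` ?L"
  have app: "apply_bcontfun (Bcontfun (bump xs)) = bump xs" if "weights xs" for xs :: "(real \<times> 'x) list"
    using bump_bcontfun[OF that] by (rule Bcontfun_inverse)
  have "countable (lists (\<rat> \<times> Q))"
    using Q(1) by (intro countable_lists countable_SIGMA countable_rat)
  then have "countable D"
    unfolding D_def by (intro countable_image) (rule countable_subset[rotated], auto)
  moreover have "D \<subseteq> bump_limits"
  proof
    fix F assume "F \<in> D"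
    then obtain xs where "weights xs" "F = Bcontfun (bump xs)"
      unfolding D_def by blast
    then show "F \<in> bump_limits"
      unfolding bump_limits_def by (auto simp: app intro!: exI[of _ xs])
  qed
  moreover have "\<exists>G\<in>D. dist G F < e" if F: "F \<in> bump_limits" and e: "e > 0" for F :: "'x \<Rightarrow>\<^sub>C real" and e
  proof -
    have e4: "e / 4 > 0"
      using e by simp
    obtain xs where xs: "weights xs" "\<And>z. \<bar>F z - bump xs z\<bar> \<le> e / 4"
      using bump_limitsD[OF F e4] by blast
    have "\<exists>q. q \<in> \<rat> \<times> Q \<and> 0 \<le> fst q \<and> fst q \<le> 1 \<and> \<bar>fst p - fst q\<bar> + dist (snd p) (snd q) \<le> e / 2"
      if p: "0 \<le> fst p" "fst p \<le> 1" for p :: "real \<times> 'x"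
    proof -
      have "\<exists>r\<in>\<rat>. 0 \<le> r \<and> r \<le> 1 \<and> \<bar>fst p - r\<bar> \<le> e / 4"
      proof (cases "fst p = 0")
        case True
        then show ?thesis
          using e by (intro bexI[of _ 0]) auto
      next
        case False
        then obtain r where "r \<in> \<rat>" "max 0 (fst p - e / 4) < r" "r < fst p"
          using Rats_dense_in_real[of "max 0 (fst p - e / 4)" "fst p"] p(1) e by auto
        then show ?thesis
          using p(2) by (intro bexI[of _ r]) auto
      qed
      then obtain r where r: "r \<in> \<rat>" "0 \<le> r" "r \<le> 1" "\<bar>fst p - r\<bar> \<le> e / 4"
        by blast
      obtain y where "y \<in> Q" "y \<in> ball (snd p) (e / 4)"
        using Q(2)[of "ball (snd p) (e / 4)"] e4 by auto
      then show ?thesis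
        using r by (intro exI[of _ "(r, y)"]) auto
    qed
    then obtain f where f: "\<And>p :: real \<times> 'x. 0 \<le> fst p \<Longrightarrow> fst p \<le> 1 \<Longrightarrow> f p \<in> \<rat> \<times> Q \<and>
        0 \<le> fst (f p) \<and> fst (f p) \<le> 1 \<and> \<bar>fst p - fst (f p)\<bar> + dist (snd p) (snd (f p)) \<le> e / 2"
      by metis
    have fx: "f p \<in> \<rat> \<times> Q" "0 \<le> fst (f p)" "fst (f p) \<le> 1"
      "\<bar>fst p - fst (f p)\<bar> + dist (snd p) (snd (f p)) \<le> e / 2" if "p \<in> set xs" for p
      using f[of p] xs(1) that by (auto simp: weights_def)
    let ?ys = "map f xs"
    have ys: "weights ?ys"
      unfolding weights_def using fx(2,3) by simp
    have "set ?ys \<subseteq> \<rat> \<times> Q"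
      using fx(1) by (simp only: set_map image_subset_iff) blast
    then have ysL: "?ys \<in> ?L"
      using ys by (simp only: lists_eq_set mem_Collect_eq)
    have "dist (Bcontfun (bump ?ys)) F \<le> e / 2 + e / 4"
    proof (rule dist_bound)
      fix z
      have "\<bar>bump xs z - bump ?ys z\<bar> \<le> e / 2"
        using fx(4) e by (intro bump_map_close[OF xs(1) ys]) auto
      then show "dist (Bcontfun (bump ?ys) z) (F z) \<le> e / 2 + e / 4"
        using xs(2)[of z] unfolding app[OF ys] dist_real_def by linarith
    qed
    also have "\<dots> < e"
      using e by simp
    finally show ?thesis
      using ysL unfolding D_def by blast
  qed
  ultimately show thesis
    by (rule that)
qed

context median_action
begin

definition push :: "'g \<Rightarrow> ('x \<Rightarrow>\<^sub>C real) \<Rightarrow> ('x \<Rightarrow>\<^sub>C real)" where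
  "push g F = Bcontfun (\<lambda>z. F (act (- g) z))"

lemma push_apply: "push g F z = F (act (- g) z)"
proof -
  have "1-lipschitz_on UNIV (act (- g))"
    by (intro lipschitz_onI) auto
  then have "continuous_on UNIV (act (- g))"
    by (rule lipschitz_on_continuous_on)
  then have "continuous_on UNIV (\<lambda>z. F (act (- g) z))"
    by (intro continuous_on_compose2[OF continuous_on_apply_bcontfun]) auto
  moreover obtain b where "\<And>z. norm (F z) \<le> b"
    using norm_bounded by blast
  ultimately have "(\<lambda>z. F (act (- g) z)) \<in> bcontfun"
    by (intro bcontfun_normI) auto
  then show ?thesis
    unfolding push_def by (simp add: Bcontfun_inverse)
qed

lemma bump_push: "bump (map (\<lambda>p. (fst p, act g (snd p))) xs) z = bump xs (act (- g) z)"
proof -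
  have "tent z (act g y) = tent (act (- g) z) y" for y
    unfolding tent_def using act_dist[of "- g" z "act g y"] by simp
  then show ?thesis
    by (induction xs) auto
qed

lemma push_action: "action_on push bump_limits"
  unfolding action_on_def
proof (intro conjI allI ballI)
  fix g h and F :: "'x \<Rightarrow>\<^sub>C real" assume F: "F \<in> bump_limits"
  show "push 0 F = F"
    by (rule bcontfun_eqI) (simp add: push_apply)
  show "push (g + h) F = push g (push h F)"
    by (rule bcontfun_eqI) (simp add: push_apply minus_add act_add del: add_uminus_conv_diff)
  show "push g F \<in> bump_limits"
    unfolding bump_limits_def
  proof (intro CollectI allI impI)
    fix e :: real assume "e > 0"
    then obtain xs where xs: "weights xs" "\<And>z. \<bar>F z - bump xs z\<bar> \<le> e"
      using bump_limitsD[OF F] by blast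
    then show "\<exists>xs. weights xs \<and> (\<forall>z. \<bar>push g F z - bump xs z\<bar> \<le> e)"
      by (intro exI[of _ "map (\<lambda>p. (fst p, act g (snd p))) xs"])
        (auto simp: weights_def push_apply bump_push)
  qed
qed

lemma push_isometric: "dist (push g F) (push g G) = dist F G"
proof -
  have le: "dist (push g F) (push g G) \<le> dist F G" for g F G
    by (rule dist_bound) (simp add: push_apply dist_bounded)
  moreover have "push (- g) (push g F) = F" for F
    by (rule bcontfun_eqI) (simp add: push_apply)
  ultimately show ?thesis
    using le[of "- g" "push g F" "push g G"] le[of g F G] by simp
qed

lemma push_continuous:
  fixes F :: "'x \<Rightarrow>\<^sub>C real"
  assumes F: "F \<in> bump_limits" and e: "e > 0"
  shows "\<exists>V. open V \<and> g \<in> V \<and> (\<forall>g'\<in>V. dist (push g' F) (push g F) < e)"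
proof -
  have e4: "e / 4 > 0"
    using e by simp
  obtain xs where xs: "weights xs" "\<And>z. \<bar>F z - bump xs z\<bar> \<le> e / 4"
    using bump_limitsD[OF F e4] by blast
  let ?V = "\<Inter>p\<in>set xs. {g'. dist (act g' (snd p)) (act g (snd p)) < e / 4}"
  have "open ?V"
    by (intro open_INT finite_set ballI open_Collect_less continuous_intros continuous_act)
  moreover have "g \<in> ?V"
    using e by simp
  moreover have "dist (push g' F) (push g F) < e" if g': "g' \<in> ?V" for g'
  proof -
    let ?m = "\<lambda>g. map (\<lambda>p. (fst p, act g (snd p))) xs"
    have "dist (push g' F) (push g F) \<le> 3 * (e / 4)"
    proof (rule dist_bound)
      fix z
      have "?m g = map (\<lambda>p. (fst p, act g (act (- g') (snd p)))) (?m g')"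
        by simp
      moreover have "weights (?m g')" "weights (?m g)"
        using xs(1) by (auto simp: weights_def)
      ultimately have "\<bar>bump (?m g') z - bump (?m g) z\<bar> \<le> e / 4"
        using g' e by (simp only:) (rule bump_map_close, auto intro: less_imp_le)
      then have "\<bar>bump xs (act (- g') z) - bump xs (act (- g) z)\<bar> \<le> e / 4"
        by (simp add: bump_push)
      then show "dist (push g' F z) (push g F z) \<le> 3 * (e / 4)"
        using xs(2)[of "act (- g') z"] xs(2)[of "act (- g) z"]
        unfolding push_apply dist_real_def by linarith
    qed
    then show ?thesis
      using e by simp
  qed
  ultimately show ?thesis
    by blast
qed

text \<open>The function that encodes the orbit of \<open>y\<close> with weights \<open>w\<close>.\<close>

definition envelope :: "'x \<Rightarrow> ('g \<Rightarrow> real) \<Rightarrow> 'x \<Rightarrow> real" where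
  "envelope y w z = (SUP g. w g * tent z (act g y))"

context
  fixes w :: "'g \<Rightarrow> real"
  assumes w: "\<And>g. 0 \<le> w g" "\<And>g. w g \<le> 1"
begin

lemma envelope_bdd: "bdd_above (range (\<lambda>g. w g * tent z (act g y)))"
  using w tent_bounds by (intro bdd_aboveI2[of _ _ 1] mult_le_one)

lemma envelope_ge: "w g * tent z (act g y) \<le> envelope y w z"
  unfolding envelope_def by (rule cSUP_upper[OF UNIV_I envelope_bdd])

lemma envelope_nonneg: "0 \<le> envelope y w z"
  using envelope_ge[of 0 z y] w tent_bounds(1)[of z "act 0 y"] by (meson mult_nonneg_nonneg order_trans)

lemma envelope_le_1: "envelope y w z \<le> 1"
  unfolding envelope_def by (intro cSUP_least mult_le_one w tent_bounds) simp

lemma envelope_lipschitz: "\<bar>envelope y w z - envelope y w z'\<bar> \<le> dist z z'"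
proof -
  have "envelope y w z \<le> envelope y w z' + dist z z'" for z z'
    unfolding envelope_def[of y w z]
  proof (rule cSUP_least)
    fix g
    have "w g * tent z (act g y) \<le> w g * (tent z' (act g y) + dist z z')"
      using tent_lipschitz[of z "act g y" z' "act g y"] w by (intro mult_left_mono) auto
    also have "\<dots> \<le> w g * tent z' (act g y) + dist z z'"
      using mult_right_mono[OF w(2), of "dist z z'" g] by (simp add: distrib_left)
    also have "\<dots> \<le> envelope y w z' + dist z z'"
      using envelope_ge[of g z' y] by simp
    finally show "w g * tent z (act g y) \<le> envelope y w z' + dist z z'" .
  qed simp
  from this[of z z'] this[of z' z] show ?thesis
    by (simp add: abs_le_iff dist_commute)
qed

lemma envelope_bcontfun: "envelope y w \<in> bcontfun"
  by (rule bcontfun_lipschitzI[OF envelope_lipschitz]) (simp add: envelope_nonneg envelope_le_1)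

text \<open>
  Weights below \<open>e\<close> change the function by at most \<open>e\<close>.
\<close>

lemma envelope_limit:
  assumes fin: "\<And>e. e > 0 \<Longrightarrow> finite {act g y | g. w g > e}"
  shows "Bcontfun (envelope y w) \<in> bump_limits"
  unfolding bump_limits_def
proof (intro CollectI allI impI)
  fix e :: real assume e: "e > 0"
  let ?S = "{act g y | g. w g > e}"
  obtain ys where ys: "set ys = ?S"
    using finite_list[OF fin[OF e]] by blast
  \<comment> \<open>the group elements that map \<open>y\<close> to the same point share the largest of their weights\<close>
  define c where "c v = (SUP g\<in>{g. act g y = v}. w g)" for v
  have bdd: "bdd_above (w ` A)" for A
    using w(2) by (intro bdd_aboveI2)
  have c_ge: "w g \<le> c (act g y)" for g
    unfolding c_def by (intro cSUP_upper bdd) simp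
  have S: "{g. act g y = v} \<noteq> {}" if "v \<in> ?S" for v
    using that by blast
  have c_le: "c v \<le> B" if "v \<in> ?S" "\<And>g. act g y = v \<Longrightarrow> w g \<le> B" for v B
    unfolding c_def using S[OF that(1)] that(2) by (intro cSUP_least) auto
  let ?xs = "map (\<lambda>v. (c v, v)) ys"
  have "0 \<le> c v \<and> c v \<le> 1" if v: "v \<in> ?S" for v
  proof -
    obtain g where "v = act g y"
      using v by blast
    then show ?thesis
      using c_ge[of g] w(1)[of g] c_le[OF v, of 1] w(2) by simp
  qed
  then have "weights ?xs"
    using ys by (auto simp: weights_def)
  moreover have "\<bar>envelope y w z - bump ?xs z\<bar> \<le> e" for z
  proof -
    have "bump ?xs z \<le> envelope y w z"
    proof (rule bump_le[OF envelope_nonneg])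
      fix p assume "p \<in> set ?xs"
      then obtain v where v: "p = (c v, v)" "v \<in> ?S"
        using ys by auto
      show "fst p * tent z (snd p) \<le> envelope y w z"
      proof (cases "tent z v = 0")
        case True
        then show ?thesis
          using envelope_nonneg v(1) by simp
      next
        case False
        then have t: "tent z v > 0"
          using tent_bounds(1)[of z v] by simp
        have "c v \<le> envelope y w z / tent z v"
          using t envelope_ge[of _ z y] by (intro c_le[OF v(2)]) (auto simp: pos_le_divide_eq)
        then show ?thesis
          using t v(1) by (simp add: pos_le_divide_eq)
      qed
    qed
    moreover have "envelope y w z \<le> bump ?xs z + e"
      unfolding envelope_def
    proof (rule cSUP_least)
      fix g
      show "w g * tent z (act g y) \<le> bump ?xs z + e"
      proof (cases "w g > e")
        case True
        then have "(c (act g y), act g y) \<in> set ?xs"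
          using ys by auto
        then have "c (act g y) * tent z (act g y) \<le> bump ?xs z"
          using bump_ge by fastforce
        then show ?thesis
          using mult_right_mono[OF c_ge[of g] tent_bounds(1)[of z "act g y"]] e by linarith
      next
        case False
        then have "w g * tent z (act g y) \<le> e * 1"
          using tent_bounds e by (intro mult_mono) auto
        then show ?thesis
          using bump_nonneg[of ?xs z] by simp
      qed
    qed simp
    ultimately show ?thesis
      by (simp add: abs_le_iff)
  qed
  ultimately show "\<exists>xs. weights xs \<and> (\<forall>z. \<bar>Bcontfun (envelope y w) z - bump xs z\<bar> \<le> e)"
    using envelope_bcontfun[of y] by (intro exI[of _ ?xs]) (simp add: Bcontfun_inverse)
qed

end

end

lemma sum_at_most_one:
  fixes f :: "nat \<Rightarrow> real"
  assumes "D \<ge> 0" "\<And>i. i < n \<Longrightarrow> f i \<le> D" "\<And>i j. i < n \<Longrightarrow> j < n \<Longrightarrow> f i \<noteq> 0 \<Longrightarrow> f j \<noteq> 0 \<Longrightarrow> i = j"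
  shows "(\<Sum>i<n. f i) \<le> D"
proof (cases "\<exists>i<n. f i \<noteq> 0")
  case True
  then obtain i where i: "i < n" "f i \<noteq> 0"
    by blast
  have "(\<Sum>j<n. f j) = (\<Sum>j\<in>{i}. f j)"
    using i assms(3) by (intro sum.mono_neutral_right) auto
  then show ?thesis
    using assms(2)[OF i(1)] by simp
qed (use assms(1) in simp)

text \<open>
  If the products of three functions are supported on pairwise disjoint sets, then their sum is bounded, and
  so is the sum of the products of their means: the means can be taken in one variable after the other.
\<close>

lemma mean_triple_sum:
  fixes n :: nat
  assumes "mean \<nu>1" "mean \<nu>2" "mean \<nu>3"
    and "\<And>x y z. (\<Sum>i<n. gprod (p1 i) (q1 i) x * gprod (p2 i) (q2 i) y * gprod (p3 i) (q3 i) z) \<le> D"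
  shows "(\<Sum>i<n. \<nu>1 (p1 i) (q1 i) * \<nu>2 (p2 i) (q2 i) * \<nu>3 (p3 i) (q3 i)) \<le> D"
proof -
  have 1: "(\<Sum>i<n. (gprod (p2 i) (q2 i) y * gprod (p3 i) (q3 i) z) * \<nu>1 (p1 i) (q1 i)) \<le> D" for y z
  proof (rule mean_le_sum[OF assms(1)])
    show "(\<Sum>i<n. (gprod (p2 i) (q2 i) y * gprod (p3 i) (q3 i) z) * gprod (p1 i) (q1 i) x) \<le> D" for x
      using assms(4)[of x y z] by (simp add: mult_ac)
  qed
  have 2: "(\<Sum>i<n. (\<nu>1 (p1 i) (q1 i) * gprod (p3 i) (q3 i) z) * \<nu>2 (p2 i) (q2 i)) \<le> D" for z
  proof (rule mean_le_sum[OF assms(2)])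
    show "(\<Sum>i<n. (\<nu>1 (p1 i) (q1 i) * gprod (p3 i) (q3 i) z) * gprod (p2 i) (q2 i) y) \<le> D" for y
      using 1[of y z] by (simp add: mult_ac)
  qed
  have "(\<Sum>i<n. (\<nu>1 (p1 i) (q1 i) * \<nu>2 (p2 i) (q2 i)) * \<nu>3 (p3 i) (q3 i)) \<le> D"
  proof (rule mean_le_sum[OF assms(3)])
    show "(\<Sum>i<n. (\<nu>1 (p1 i) (q1 i) * \<nu>2 (p2 i) (q2 i)) * gprod (p3 i) (q3 i) z) \<le> D" for z
      using 2[of z] by (simp add: mult_ac)
  qed
  then show ?thesis .
qed

section \<open>Equivariant families of means\<close>

text \<open>
  Besides the family provided by amenability, this covers the evaluations at the values of an
  equivariant boundary map and averages of such families.
\<close>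

locale mean_family = irreducible_minimal_action X_type act
  for X_type :: "'x::polish_space itself"
    and act :: "'g::{topological_group_add, second_countable_topology} \<Rightarrow> 'x \<Rightarrow> 'x" +
  fixes actB :: "'g \<Rightarrow> 'b \<Rightarrow> 'b" and B :: "'b measure" and \<nu> :: "'b \<Rightarrow> 'x \<Rightarrow> 'x \<Rightarrow> real"
  assumes prob: "prob_space B"
    and class_preserving: "measure_class_preserving_action actB B"
    and ergodic: "isometrically_ergodic (diagonal_action actB) (B \<Otimes>\<^sub>M B)"
    and mean_family: "\<And>b. b \<in> space B \<Longrightarrow> mean (\<nu> b)"
    and mean_measurable: "\<And>p q. (\<lambda>b. \<nu> b p q) \<in> borel_measurable B"
    and mean_equivariant: "\<And>g. AE b in B. \<forall>p q. \<nu> (actB g b) (act g p) (act g q) = \<nu> b p q"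
begin

abbreviation BB :: "('b \<times> 'b) measure" where
  "BB \<equiv> B \<Otimes>\<^sub>M B"

lemma pair_prob: "pair_prob_space B B"
  using prob by (simp add: pair_prob_space_def pair_sigma_finite_def prob_space_imp_sigma_finite)

lemma prob_BB: "prob_space BB"
proof -
  interpret pair_prob_space B B
    by (rule pair_prob)
  show ?thesis
    by unfold_locales
qed

lemma space_BB: "x \<in> space BB \<longleftrightarrow> fst x \<in> space B \<and> snd x \<in> space B"
  by (cases x) (simp add: space_pair_measure)

lemma not_AE_False: "\<not> (AE b in B. False)" "\<not> (AE x in BB. False)"
  using prob_space.AE_False[OF prob] prob_space.AE_False[OF prob_BB] by simp_all

lemma AE_fst: "AE b in B. P b \<Longrightarrow> AE x in BB. P (fst x)"
  and AE_snd: "AE b in B. P b \<Longrightarrow> AE x in BB. P (snd x)"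
  using pair_sigma_finite.AE_pair_fst[of B B P] pair_sigma_finite.AE_pair_snd[of B B P] pair_prob
  by (simp_all add: pair_prob_space_def case_prod_beta)

lemma AE_iterate: "AE x in BB. P x \<Longrightarrow> AE b in B. AE b' in B. P (b, b')"
  using pair_prob by (intro pair_sigma_finite.AE_pair) (simp_all add: pair_prob_space_def)

lemma mean_product_measurable [measurable]:
  "(\<lambda>x. \<nu> (fst x) p q) \<in> borel_measurable BB" "(\<lambda>x. \<nu> (snd x) p q) \<in> borel_measurable BB"
  using mean_measurable by (auto intro: measurable_compose[OF measurable_fst] measurable_compose[OF measurable_snd])

lemma diagonal_equivariant:
  "AE x in BB. \<forall>p q. \<nu> (fst (diagonal_action actB g x)) (act g p) (act g q) = \<nu> (fst x) p q \<and>
     \<nu> (snd (diagonal_action actB g x)) (act g p) (act g q) = \<nu> (snd x) p q"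
  using AE_fst[OF mean_equivariant[of g]] AE_snd[OF mean_equivariant[of g]]
  by eventually_elim (simp add: diagonal_action_def case_prod_beta)

text \<open>
  Only the action on the factors preserves null sets by assumption; the diagonal action is treated one coordinate at a time.
\<close>

lemma AE_diagonal:
  assumes "AE x in BB. P x"
  shows "AE x in BB. P (diagonal_action actB g x)"
proof -
  obtain N where N: "{x \<in> space BB. \<not> P x} \<subseteq> N" "emeasure BB N = 0" "N \<in> sets BB"
    using assms by (rule AE_E)
  have actB [measurable]: "actB g \<in> measurable B B"
  proof -
    have "(\<lambda>x. (g, x)) \<in> measurable B (borel \<Otimes>\<^sub>M B)"
      by simp
    from measurable_comp[OF this, of "\<lambda>(g, x). actB g x" B] show "actB g \<in> measurable B B"
      using class_preserving unfolding measure_class_preserving_action_def by (simp add: comp_def)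
  qed
  have "AE x in BB. x \<notin> N"
    using N(2,3) by (intro AE_not_in) auto
  then have 1: "AE b in B. AE b' in B. (b, b') \<notin> N"
    by (rule AE_iterate)
  have 2: "AE b in B. AE b' in B. (actB g b, actB g b') \<notin> N"
    using AE_action[OF class_preserving 1, of g]
    by eventually_elim (rule AE_action[OF class_preserving])
  have "{x \<in> space BB. case x of (b, b') \<Rightarrow> (actB g b, actB g b') \<notin> N} \<in> sets BB"
    using N(3) by measurable
  then have "AE x in BB. case x of (b, b') \<Rightarrow> (actB g b, actB g b') \<notin> N"
    using 2 pair_prob by (intro pair_sigma_finite.AE_pair_measure) (simp_all add: pair_prob_space_def)
  moreover have "AE x in BB. diagonal_action actB g x \<in> space BB"
  proof (rule AE_I2)
    fix x assume "x \<in> space BB"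
    then show "diagonal_action actB g x \<in> space BB"
      using measurable_space[OF actB, of "fst x"] measurable_space[OF actB, of "snd x"]
      unfolding space_BB diagonal_action_def case_prod_beta by simp
  qed
  ultimately show ?thesis
  proof eventually_elim
    case (elim x)
    have "diagonal_action actB g x \<notin> N"
      using elim(1) unfolding diagonal_action_def by (simp add: case_prod_beta)
    then show ?case
      using elim(2) N(1) by blast
  qed
qed

text \<open>
  The supremum over the group is invariant, hence almost everywhere constant, and the constant is positive unless \<open>f x 0\<close>
  vanishes almost everywhere.
\<close>

lemma positive_translate:
  fixes f :: "'b \<times> 'b \<Rightarrow> 'g \<Rightarrow> real"
  assumes "\<And>g. (\<lambda>x. f x g) \<in> borel_measurable BB"
    and "\<And>x. x \<in> space BB \<Longrightarrow> continuous_on UNIV (f x)"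
    and C: "\<And>x g. x \<in> space BB \<Longrightarrow> f x g \<le> C"
    and nonneg: "\<And>x g. x \<in> space BB \<Longrightarrow> 0 \<le> f x g"
    and inv: "\<And>k. AE x in BB. \<forall>g. f (diagonal_action actB k x) (k + g) = f x g"
    and nz: "\<not> (AE x in BB. f x 0 = 0)"
  shows "AE x in BB. \<exists>g. f x g > 0"
proof -
  have "AE x in BB. (SUP g. f (diagonal_action actB k x) g) = (SUP g. f x g)" for k
    using inv[of k]
  proof eventually_elim
    case (elim x)
    have "(SUP g. f (diagonal_action actB k x) g) = (SUP g. f (diagonal_action actB k x) (k + g))"
      by (rule SUP_translate[symmetric])
    then show ?case
      using elim by simp
  qed
  moreover have "space BB \<noteq> {}"
    using prob_BB by (rule prob_space.not_empty)
  ultimately obtain z where z: "AE x in BB. (SUP g. f x g) = z"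
    using ergodic_constant_real[OF ergodic _ measurable_SUP_continuous[OF assms(1-3)]] by blast
  have bdd: "bdd_above (range (f x))" if "x \<in> space BB" for x
    using C[OF that] by (intro bdd_aboveI2[of _ _ C])
  have "z > 0"
  proof (rule ccontr)
    assume nz': "\<not> z > 0"
    have "AE x in BB. f x 0 = 0"
      using z AE_space
    proof eventually_elim
      case (elim x)
      then show ?case
        using cSUP_upper[OF UNIV_I bdd[OF elim(2)], of 0] nonneg[OF elim(2), of 0] nz' by simp
    qed
    then show False
      using nz by blast
  qed
  show ?thesis
    using z AE_space
  proof eventually_elim
    case (elim x)
    then show ?case
      using \<open>z > 0\<close> less_cSUP_iff[OF _ bdd[OF elim(2)], of 0] by auto
  qed
qed

text \<open>
  As \<open>- k\<close> can be flipped off itself, \<open>k\<close> and a translate of \<open>k\<close> cover the space. So every mean is positive on \<open>gprod p q\<close>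
  or on its translate, and translating preserves null sets.
\<close>

lemma not_null_mean:
  fixes p :: 'x
  assumes k: "thick k" and pq: "p \<noteq> q" "\<And>x. x \<in> k \<Longrightarrow> median x p q = q"
  shows "\<not> (AE b in B. \<nu> b p q = 0)"
proof
  assume null: "AE b in B. \<nu> b p q = 0"
  obtain g where g: "act g ` (- k) \<inter> - k = {}"
    using flip[of "- k"] k thick_nonempty[OF k] by (auto simp: thick_def halfspace_Compl)
  have ge: "dist p q \<le> \<mu> p q + \<mu> (act g p) (act g q)" if \<mu>: "mean \<mu>" for \<mu>
  proof -
    have "- 1 * \<mu> p q + - 1 * \<mu> (act g p) (act g q) \<le> - dist p q"
    proof (rule mean_le2[OF \<mu>])
      fix x
      have "x \<in> k \<or> act (- g) x \<in> k"
        using g unfolding act_image_Compl set_eq_iff by (auto simp: in_act_image)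
      then have "gprod p q x = dist p q \<or> gprod (act g p) (act g q) x = dist p q"
        using pq(2) unfolding gprod_act by (auto simp: gprod_def)
      then show "- 1 * gprod p q x + - 1 * gprod (act g p) (act g q) x \<le> - dist p q"
        using gprod_nonneg[of p q x] gprod_nonneg[of "act g p" "act g q" x] by auto
    qed
    then show ?thesis
      by simp
  qed
  have "AE b in B. \<nu> (actB (- g) b) p q = 0"
    using null by (rule AE_action[OF class_preserving])
  then have "AE b in B. False"
    using null mean_equivariant[of "- g"] AE_space
  proof eventually_elim
    case (elim b)
    have "\<nu> (actB (- g) b) (act (- g) (act g p)) (act (- g) (act g q)) = \<nu> b (act g p) (act g q)"
      using elim(3) by blast
    then show ?case
      using ge[OF mean_family[OF elim(4)]] elim(1,2) pq(1) by simp
  qed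
  then show False
    using not_AE_False by blast
qed

text \<open>
  By Fubini the product of the two values is not almost everywhere zero.
\<close>

lemma common_translate:
  fixes p p' :: 'x
  assumes "thick k" "p \<noteq> q" "\<And>x. x \<in> k \<Longrightarrow> median x p q = q"
    and "thick k'" "p' \<noteq> q'" "\<And>x. x \<in> k' \<Longrightarrow> median x p' q' = q'"
  shows "AE x in BB. \<exists>g. \<nu> (fst x) (act g p) (act g q) > 0 \<and> \<nu> (snd x) (act g p') (act g q') > 0"
proof -
  let ?f = "\<lambda>x g. \<nu> (fst x) (act g p) (act g q) * \<nu> (snd x) (act g p') (act g q')"
  have mean: "mean (\<nu> (fst x))" "mean (\<nu> (snd x))" if "x \<in> space BB" for x
    using that mean_family by (simp_all add: space_BB)
  have "AE x in BB. \<exists>g. ?f x g > 0"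
  proof (rule positive_translate)
    show "(\<lambda>x. ?f x g) \<in> borel_measurable BB" for g
      by measurable
    show "continuous_on UNIV (?f x)" if "x \<in> space BB" for x
      using mean[OF that] by (intro continuous_on_mult continuous_mean_act)
    show "?f x g \<le> dist p q * dist p' q'" "0 \<le> ?f x g" if "x \<in> space BB" for x g
      using mean_prod_bounds[OF mean[OF that], of "act g p" "act g q" "act g p'" "act g q'"] by simp_all
    show "AE x in BB. \<forall>g. ?f (diagonal_action actB k x) (k + g) = ?f x g" for k
      using diagonal_equivariant[of k] by eventually_elim (simp add: act_add)
    show "\<not> (AE x in BB. ?f x 0 = 0)"
    proof
      assume "AE x in BB. ?f x 0 = 0"
      from AE_iterate[OF this] have "AE b in B. AE b' in B. \<nu> b p q = 0 \<or> \<nu> b' p' q' = 0"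
        by simp
      then have "AE b in B. \<nu> b p q = 0"
      proof eventually_elim
        case (elim b)
        then show ?case
          using not_null_mean[OF assms(4-6)] by (cases "\<nu> b p q = 0") auto
      qed
      then show False
        using not_null_mean[OF assms(1-3)] by blast
    qed
  qed
  then show ?thesis
    using AE_space
  proof eventually_elim
    case (elim x)
    then obtain g where "?f x g > 0"
      by blast
    then show ?case
      using mean_nonneg[OF mean(1)[OF elim(2)], of "act g p" "act g q"]
        mean_nonneg[OF mean(2)[OF elim(2)], of "act g p'" "act g q'"]
      by (auto simp: zero_less_mult_iff)
  qed
qed

end

lemma (in irreducible_minimal_action) ladder_shift:
  fixes c :: "int \<Rightarrow> 'x set"
  assumes "\<And>i. c (i + 1) = act t ` c i"
  shows "c (i + int n) = act (iter t n) ` c i"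
proof (induction n)
  case (Suc n)
  have "c (i + int (Suc n)) = act t ` c (i + int n)"
    using assms[of "i + int n"] by (simp add: add_ac)
  then show ?case
    by (simp add: Suc act_image_comp)
qed simp

text \<open>
  The translations along a ladder move a point across arbitrarily many rungs.
\<close>

lemma (in irreducible_minimal_action) unbounded_orbit: "\<exists>g. R < dist z (act g z)"
proof -
  obtain c :: "int \<Rightarrow> 'x set" and t r where c: "r > 0"
    "\<And>i. step r (c i) (c (i + 1))" "\<And>i. c (i + 1) = act t ` c i"
    using ex_ladder by metis
  have "chain r (\<lambda>n. c (int n))"
    unfolding chain_def
  proof
    show "step r (c (int n)) (c (int (Suc n)))" for n
      using c(2)[of "int n"] by (simp add: add.commute)
  qed
  then obtain N where N: "z \<notin> c (int N)"
    using chain_leaves[OF _ c(1)] by blast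
  have "chain r (\<lambda>n. - c (- int n))"
    unfolding chain_def
  proof
    fix n
    show "step r (- c (- int n)) (- c (- int (Suc n)))"
      using step_Compl[OF c(2)[of "- int (Suc n)"]] by simp
  qed
  then obtain N' where N': "z \<in> c (- int N')"
    using chain_leaves[OF _ c(1)] by blast
  obtain n where n: "R < real n * r"
    using c(1) reals_Archimedean3 by blast
  have "act (iter t (N' + N + 2 * n)) z \<in> c (- int N' + int (N' + N + 2 * n))"
    unfolding ladder_shift[of c t, OF c(3)] using N' by (rule imageI)
  moreover have "step r (c (int N + int i)) (c (int N + int (Suc i)))" for i
    using c(2)[of "int N + int i"] by (simp add: ac_simps)
  ultimately have "real n * r \<le> dist z (act (iter t (N' + N + 2 * n)) z)"
    using N by (intro steps_dist[of n r "\<lambda>i. c (int N + int i)"]) (simp_all add: add.assoc add.commute)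
  then show ?thesis
    using n by (intro exI[of _ "iter t (N' + N + 2 * n)"]) simp
qed

text \<open>
  An invariant function is constant along the orbit of \<open>z\<close>, while a finite maximum of tents vanishes outside
  finitely many unit balls.
\<close>

lemma (in mean_family) no_invariant_function:
  assumes F: "F \<in> bump_limits" and inv: "\<And>g. push g F = F"
  shows "F z \<le> 0"
proof (rule ccontr)
  assume "\<not> F z \<le> 0"
  then have pos: "F z / 2 > 0"
    by simp
  then obtain xs where xs: "\<And>z'. \<bar>F z' - bump xs z'\<bar> \<le> F z / 2"
    using bump_limitsD[OF F] by blast
  have "bounded (snd ` set xs)"
    by (intro finite_imp_bounded) simp
  then obtain R where R: "\<And>y. y \<in> snd ` set xs \<Longrightarrow> dist z y \<le> R"
    unfolding bounded_any_center[of _ z] by blast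
  obtain g where g: "R + 1 < dist z (act g z)"
    using unbounded_orbit by blast
  have "F (act g z) = F z"
    using push_apply[of "- g" F z] inv[of "- g"] by simp
  moreover have "bump xs (act g z) \<le> 0"
  proof (rule bump_le)
    fix p assume "p \<in> set xs"
    then have "dist z (snd p) \<le> R"
      using R by blast
    then have "tent (act g z) (snd p) = 0"
      using g dist_triangle2[of z "act g z" "snd p"] unfolding tent_def by simp
    then show "fst p * tent (act g z) (snd p) \<le> 0"
      by simp
  qed simp
  ultimately show False
    using xs[of "act g z"] pos by simp
qed

text \<open>
  Weigh the translate \<open>act g z\<close> of the centre \<open>z\<close> of a facing triple by the product of the masses that two
  means give to the translates of the three sides. For distinct centres the products have disjoint
  supports, so there are only finitely many translates of large weight, and the weights define a function in a separable
  space that depends equivariantly on the pair of means. By isometric ergodicity it is constant, hence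
  invariant, hence zero because orbits are unbounded.
\<close>

lemma (in mean_family) no_splitting:
  assumes st: "step r v1 u1" "step r v2 u2" "step r v3 u3" and k3: "thick k3"
    and disj: "v1 \<inter> v2 = {}" "v1 \<inter> v3 = {}" "v2 \<inter> v3 = {}"
    and ne: "p1 \<noteq> q1" "p2 \<noteq> q2" "p3 \<noteq> q3"
    and out: "\<And>x. x \<notin> u1 \<Longrightarrow> median x p1 q1 = p1" "\<And>x. x \<notin> u2 \<Longrightarrow> median x p2 q2 = p2"
      "\<And>x. x \<notin> u3 \<Longrightarrow> median x p3 q3 = p3"
    and q3: "\<And>x. x \<in> k3 \<Longrightarrow> median x p3 q3 = q3"
  shows "AE b in B. \<nu> b p1 q1 * \<nu> b p2 q2 = 0"
proof -
  obtain z0 where z0: "\<And>x1 x2 x3. x1 \<in> u1 \<Longrightarrow> x2 \<in> u2 \<Longrightarrow> x3 \<in> u3 \<Longrightarrow> median x1 x2 x3 = z0"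
    using facing_center[OF st disj] by blast
  define D where "D = dist p1 q1 * dist p2 q2 * dist p3 q3"
  have D: "D > 0"
    using ne by (simp add: D_def)
  define w where "w x g = \<nu> (fst x) (act g p1) (act g q1) * \<nu> (fst x) (act g p2) (act g q2) *
    \<nu> (snd x) (act g p3) (act g q3) / D" for x g
  have mean: "mean (\<nu> (fst x))" "mean (\<nu> (snd x))" if "x \<in> space BB" for x
    using that mean_family by (simp_all add: space_BB)
  have w: "0 \<le> w x g" "w x g \<le> 1" if x: "x \<in> space BB" for x g
  proof -
    have bounds: "0 \<le> \<mu> (act g p) (act g q)" "\<mu> (act g p) (act g q) \<le> dist p q" if "mean \<mu>" for \<mu> p q
      using mean_nonneg[OF that] mean_le[OF that, of "act g p" "act g q"] by simp_all
    note bounds = bounds[OF mean(1)[OF x]] bounds[OF mean(2)[OF x]]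
    show "0 \<le> w x g"
      unfolding w_def by (intro divide_nonneg_pos mult_nonneg_nonneg bounds D)
    have "\<nu> (fst x) (act g p1) (act g q1) * \<nu> (fst x) (act g p2) (act g q2) * \<nu> (snd x) (act g p3) (act g q3) \<le> D"
      unfolding D_def by (intro mult_mono mult_nonneg_nonneg bounds zero_le_dist)
    then show "w x g \<le> 1"
      unfolding w_def using D by simp
  qed
  \<comment> \<open>\<open>N\<close> distinct centres of weight above \<open>e\<close> give \<open>N * e \<le> 1\<close>\<close>
  have fin: "finite {act g z0 | g. w x g > e}" if x: "x \<in> space BB" and e: "e > 0" for x and e :: real
  proof (rule ccontr)
    assume inf: "infinite {act g z0 | g. w x g > e}"
    obtain N where N: "1 < real N * e"
      using reals_Archimedean3[OF e] by blast
    obtain T where T: "T \<subseteq> {act g z0 | g. w x g > e}" "finite T" "card T = N"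
      using infinite_arbitrarily_large[OF inf] by blast
    obtain y where y: "bij_betw y {..<N} T"
      using ex_bij_betw_nat_finite[OF T(2)] T(3) by (auto simp: atLeast0LessThan)
    have "\<forall>i. \<exists>g. i < N \<longrightarrow> y i = act g z0 \<and> w x g > e"
      using T(1) bij_betwE[OF y] by blast
    then obtain g where g: "\<And>i. i < N \<Longrightarrow> y i = act (g i) z0 \<and> w x (g i) > e"
      by metis
    let ?f = "\<lambda>x1 x2 x3 i. gprod (act (g i) p1) (act (g i) q1) x1 * gprod (act (g i) p2) (act (g i) q2) x2 *
      gprod (act (g i) p3) (act (g i) q3) x3"
    have "(\<Sum>i<N. \<nu> (fst x) (act (g i) p1) (act (g i) q1) * \<nu> (fst x) (act (g i) p2) (act (g i) q2) *
        \<nu> (snd x) (act (g i) p3) (act (g i) q3)) \<le> D"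
    proof (rule mean_triple_sum[OF mean(1)[OF x] mean(1)[OF x] mean(2)[OF x]])
      fix x1 x2 x3 :: 'x
      show "(\<Sum>i<N. ?f x1 x2 x3 i) \<le> D"
      proof (rule sum_at_most_one)
        show "D \<ge> 0"
          using D by simp
        show "?f x1 x2 x3 i \<le> D" for i
        proof -
          have "?f x1 x2 x3 i \<le> dist (act (g i) p1) (act (g i) q1) * dist (act (g i) p2) (act (g i) q2) *
              dist (act (g i) p3) (act (g i) q3)"
            by (intro mult_mono gprod_le mult_nonneg_nonneg gprod_nonneg zero_le_dist)
          then show ?thesis
            by (simp add: D_def)
        qed
        have center: "median x1 x2 x3 = y i" if i: "i < N" "?f x1 x2 x3 i \<noteq> 0" for i
        proof -
          let ?h = "- g i"
          have "act ?h x1 \<in> u1" "act ?h x2 \<in> u2" "act ?h x3 \<in> u3"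
            using i(2) out(1)[of "act ?h x1"] out(2)[of "act ?h x2"] out(3)[of "act ?h x3"]
            unfolding gprod_act by (fastforce simp: gprod_def)+
          then have "median (act ?h x1) (act ?h x2) (act ?h x3) = z0"
            by (rule z0)
          then have "act ?h (median x1 x2 x3) = z0"
            by (simp add: act_median)
          then have "median x1 x2 x3 = act (g i) z0"
            by (simp add: act_eq_iff)
          then show ?thesis
            using g[OF i(1)] by simp
        qed
        show "i = j" if "i < N" "j < N" "?f x1 x2 x3 i \<noteq> 0" "?f x1 x2 x3 j \<noteq> 0" for i j
          using center[OF that(1,3)] center[OF that(2,4)] y that(1,2) by (auto simp: bij_betw_def inj_on_eq_iff)
      qed
    qed
    then have "(\<Sum>i<N. w x (g i)) \<le> 1"
      unfolding w_def using D by (simp flip: sum_divide_distrib)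
    moreover have "(\<Sum>i<N. e) \<le> (\<Sum>i<N. w x (g i))"
      using g by (intro sum_mono) (auto intro: less_imp_le)
    ultimately show False
      using N by simp
  qed
  define F where "F x = Bcontfun (envelope z0 (w x))" for x
  have F_apply: "F x z = envelope z0 (w x) z" if "x \<in> space BB" for x z
    unfolding F_def using envelope_bcontfun[of "w x" z0] w[OF that] by (simp add: Bcontfun_inverse)
  have w_cont: "continuous_on UNIV (w x)" if "x \<in> space BB" for x
    unfolding w_def using mean[OF that] by (intro continuous_intros continuous_mean_act) (use D in auto)
  have F_meas: "(\<lambda>x. F x z) \<in> borel_measurable BB" for z
  proof -
    have "(\<lambda>x. SUP g. w x g * tent z (act g z0)) \<in> borel_measurable BB"
    proof (rule measurable_SUP_continuous)
      show "(\<lambda>x. w x g * tent z (act g z0)) \<in> borel_measurable BB" for g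
        unfolding w_def by measurable
      show "continuous_on UNIV (\<lambda>g. w x g * tent z (act g z0))" if "x \<in> space BB" for x
        unfolding tent_def by (intro continuous_intros w_cont[OF that] continuous_act)
      show "w x g * tent z (act g z0) \<le> 1" if "x \<in> space BB" for x g
        using w[OF that] tent_bounds by (intro mult_le_one)
    qed
    then show ?thesis
      by (simp add: F_apply envelope_def cong: measurable_cong)
  qed
  have F_in: "F x \<in> bump_limits" if "x \<in> space BB" for x
    unfolding F_def using w[OF that] fin[OF that] by (intro envelope_limit) auto
  have F_eq: "AE x in BB. F (diagonal_action actB k x) = push k (F x)" for k
  proof -
    have "AE x in BB. diagonal_action actB k x \<in> space BB"
      by (rule AE_diagonal) (rule AE_space)
    then show ?thesis
      using diagonal_equivariant[of k] AE_space
    proof eventually_elim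
      case (elim x)
      have wk: "w (diagonal_action actB k x) (k + g) = w x g" for g
        using elim(2) by (simp add: w_def act_add)
      show ?case
      proof (rule bcontfun_eqI)
        fix z
        have "F (diagonal_action actB k x) z =
            (SUP g. w (diagonal_action actB k x) (k + g) * tent z (act (k + g) z0))"
          unfolding F_apply[OF elim(1)] envelope_def
          by (rule SUP_translate[where f = "\<lambda>g. w (diagonal_action actB k x) g * tent z (act g z0)", symmetric])
        also have "\<dots> = (SUP g. w x g * tent (act (- k) z) (act g z0))"
        proof -
          have "tent z (act (k + g) z0) = tent (act (- k) z) (act g z0)" for g
            unfolding tent_def using act_dist[of "- k" z "act (k + g) z0"] by (simp add: act_add)
          then show ?thesis
            by (simp add: wk)
        qed
        finally show "F (diagonal_action actB k x) z = push k (F x) z"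
          by (simp add: push_apply F_apply[OF elim(3)] envelope_def)
      qed
    qed
  qed
  have F_ball: "{x \<in> space BB. dist G (F x) < e} \<in> sets BB" for G and e :: real
  proof -
    obtain Q :: "'x set" where Q: "countable Q" "\<And>U. open U \<Longrightarrow> U \<noteq> {} \<Longrightarrow> \<exists>d\<in>Q. d \<in> U"
      using countable_dense_exists by blast
    have le_iff: "dist G (F x) \<le> a \<longleftrightarrow> (\<forall>z\<in>Q. dist (G z) (F x z) \<le> a)" for x a
    proof
      assume *: "\<forall>z\<in>Q. dist (G z) (F x z) \<le> a"
      show "dist G (F x) \<le> a"
      proof (rule dist_bound, rule ccontr)
        fix z assume z: "\<not> dist (G z) (F x z) \<le> a"
        have "open {z. a < dist (G z) (F x z)}"
          by (intro open_Collect_less continuous_intros continuous_on_apply_bcontfun)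
        moreover have "z \<in> {z. a < dist (G z) (F x z)}"
          using z by simp
        ultimately obtain d where "d \<in> Q" "a < dist (G d) (F x d)"
          using Q(2) by blast
        then show False
          using * by (simp flip: not_le)
      qed
    next
      assume "dist G (F x) \<le> a"
      then show "\<forall>z\<in>Q. dist (G z) (F x z) \<le> a"
        using dist_bounded[of G _ "F x"] order_trans by blast
    qed
    have "(\<lambda>x. dist G (F x)) \<in> borel_measurable BB"
    proof (rule borel_measurableI_le)
      fix a
      note F_meas [measurable]
      have "{x \<in> space BB. \<forall>z\<in>Q. dist (G z) (F x z) \<le> a} \<in> sets BB"
        using Q(1) by measurable
      then show "{x \<in> space BB. dist G (F x) \<le> a} \<in> sets BB"
        by (simp add: le_iff)
    qed
    then show ?thesis
      by measurable
  qed
  obtain \<D> :: "('x \<Rightarrow>\<^sub>C real) set" where \<D>: "countable \<D>" "\<D> \<subseteq> bump_limits"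
    "\<And>F e. F \<in> bump_limits \<Longrightarrow> e > 0 \<Longrightarrow> \<exists>G\<in>\<D>. dist G F < e"
    using bump_limits_separable by metis
  have "space BB \<noteq> {}"
    using prob_BB by (rule prob_space.not_empty)
  then obtain F0 where F0: "F0 \<in> bump_limits" "AE x in BB. F x = F0"
    using ergodic_constant[OF ergodic _ \<D> push_action push_isometric push_continuous F_in F_ball F_eq] by blast
  have inv: "push k F0 = F0" for k
  proof -
    have "AE x in BB. push k F0 = F0"
      using F0(2) AE_diagonal[OF F0(2), of k] F_eq[of k] by eventually_elim simp
    then show ?thesis
      using not_AE_False(2) by (cases "push k F0 = F0") auto
  qed
  have "AE x in BB. w x 0 = 0"
    using F0(2) AE_space
  proof eventually_elim
    case (elim x)
    have "w x 0 * tent z0 (act 0 z0) \<le> F x z0"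
      unfolding F_apply[OF elim(2)] using w[OF elim(2)] by (intro envelope_ge)
    then have "w x 0 \<le> 0"
      using no_invariant_function[OF F0(1) inv, of z0] elim(1) by (simp add: tent_def)
    then show ?case
      using w(1)[OF elim(2), of 0] by simp
  qed
  from AE_iterate[OF this]
  have "AE b in B. AE b' in B. \<nu> b p1 q1 * \<nu> b p2 q2 = 0 \<or> \<nu> b' p3 q3 = 0"
    using D by (simp add: w_def)
  then show ?thesis
  proof eventually_elim
    case (elim b)
    then show ?case
      using not_null_mean[OF k3 ne(3) q3] by (cases "\<nu> b p1 q1 * \<nu> b p2 q2 = 0") auto
  qed
qed

context mean_family
begin

text \<open>
  The exceptional null set depends on the group element; a countable dense set of them suffices by continuity.
\<close>

lemma AE_all_translates:
  assumes "AE b in B. \<nu> b p q * \<nu> b p' q' = 0"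
  shows "AE b in B. \<forall>g. \<nu> b (act g p) (act g q) * \<nu> b (act g p') (act g q') = 0"
proof -
  obtain D :: "'g set" where D: "countable D" "\<And>U. open U \<Longrightarrow> U \<noteq> {} \<Longrightarrow> \<exists>d\<in>D. d \<in> U"
    using countable_dense_exists by blast
  have "AE b in B. \<nu> b (act g p) (act g q) * \<nu> b (act g p') (act g q') = 0" for g
    using AE_action[OF class_preserving assms, of "- g"] mean_equivariant[of "- g"]
  proof eventually_elim
    case (elim b)
    have "\<nu> (actB (- g) b) p q = \<nu> b (act g p) (act g q)" for p q
      using elim(2)[rule_format, of "act g p" "act g q"] by simp
    then show ?case
      using elim(1) by simp
  qed
  then have "AE b in B. \<forall>g\<in>D. \<nu> b (act g p) (act g q) * \<nu> b (act g p') (act g q') = 0"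
    using D(1) by (simp add: AE_ball_countable)
  then show ?thesis
    using AE_space
  proof eventually_elim
    case (elim b)
    let ?U = "{g. \<nu> b (act g p) (act g q) * \<nu> b (act g p') (act g q') \<noteq> 0}"
    have "open ?U"
      by (intro open_Collect_neq continuous_intros continuous_mean_act mean_family elim(2))
    then have "?U = {}"
      using D(2)[of ?U] elim(1) by blast
    then show ?case
      by blast
  qed
qed

text \<open>
  A ladder that is flanked by a third halfspace: by \<open>no_splitting\<close> the mass of almost every mean avoids
  one of the two sides of each translate, so for a rung that has positive mass on a side, the whole mass is on that side.
\<close>

lemma long_ladder:
  obtains r where "r > 0"
    "\<And>M. AE x in BB. \<exists>d :: nat \<Rightarrow> 'x set. (\<forall>i. step r (d i) (d (Suc i))) \<and>
       sees (\<nu> (fst x)) (d M) \<and> sees (\<nu> (snd x)) (- d 0)"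
proof -
  obtain c :: "int \<Rightarrow> 'x set" and t r g0 n where r: "r > 0"
    and st: "\<And>i. step r (c i) (c (i + 1))" and sh: "\<And>i. c (i + 1) = act t ` c i"
    and disj: "c n \<inter> - c (- n) = {}" "c n \<inter> act g0 ` c n = {}" "- c (- n) \<inter> act g0 ` c n = {}"
    using ex_facing_ladder by metis
  have st1: "step r (c n) (c (n + 1))" "step r (c (n + 1)) (c (n + 2))"
    using st[of n] st[of "n + 1"] by (simp_all add: add.assoc)
  have "- n - 2 + 1 = - n - 1" "- n - 1 + 1 = - n"
    by simp_all
  then have st2: "step r (- c (- n)) (- c (- n - 1))" "step r (- c (- n - 1)) (- c (- n - 2))"
    using step_Compl[OF st[of "- n - 1"]] step_Compl[OF st[of "- n - 2"]] by metis+
  obtain p q where pq: "p \<noteq> q" "\<And>x. x \<in> c (n + 2) \<Longrightarrow> median x p q = q" "\<And>x. x \<notin> c (n + 1) \<Longrightarrow> median x p q = p"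
    using bridge[OF st1(2) r] by metis
  obtain p' q' where pq': "p' \<noteq> q'" "\<And>x. x \<in> - c (- n - 2) \<Longrightarrow> median x p' q' = q'"
    "\<And>x. x \<notin> - c (- n - 1) \<Longrightarrow> median x p' q' = p'"
    using bridge[OF st2(2) r] by metis
  have st3: "step r (act g0 ` c n) (act g0 ` c (n + 1))" "step r (act g0 ` c (n + 1)) (act g0 ` c (n + 2))"
    using st1 by (simp_all add: act_step)
  obtain p3 q3 where pq3: "p3 \<noteq> q3" "\<And>x. x \<in> act g0 ` c (n + 2) \<Longrightarrow> median x p3 q3 = q3"
    "\<And>x. x \<notin> act g0 ` c (n + 1) \<Longrightarrow> median x p3 q3 = p3"
    using bridge[OF st3(2) r] by metis
  have th: "thick (c i)" for i
    using st[of i] by (simp add: step_def)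
  have "AE b in B. \<nu> b p q * \<nu> b p' q' = 0"
    by (rule no_splitting[OF st1(1) st2(1) st3(1) _ disj pq(1) pq'(1) pq3(1) pq(3) pq'(3) pq3(3,2)])
      (simp_all add: th)
  from AE_all_translates[OF this]
  have split: "AE b in B. \<forall>g. \<nu> b (act g p) (act g q) = 0 \<or> \<nu> b (act g p') (act g q') = 0"
    by simp
  \<comment> \<open>since \<open>\<mu>\<close> does not charge the side \<open>k\<close> of the bridge, it charges the other side fully\<close>
  have seesI: "sees \<mu> (act g ` (- k))"
    if "mean \<mu>" "\<mu> (act g a) (act g b) = 0" "a \<noteq> b" "\<And>x. x \<in> k \<Longrightarrow> median x a b = b" for \<mu> g k and a b :: 'x
    unfolding sees_def
  proof (intro exI conjI allI impI)
    show "act g b \<noteq> act g a"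
      using that(3) by (metis act_minus(1))
    show "\<mu> (act g b) (act g a) = dist (act g b) (act g a)"
      using mean_swap[OF that(1), of "act g b" "act g a"] that(2) by (simp add: dist_commute)
    fix x assume "x \<notin> act g ` (- k)"
    then have "median (act (- g) x) a b = b"
      by (intro that(4)) (simp add: in_act_image)
    then have "act (- g) (median x (act g b) (act g a)) = b"
      by (simp add: act_median median_swap23)
    then show "median x (act g b) (act g a) = act g b"
      by (simp add: act_eq_iff)
  qed
  have "AE x in BB. \<exists>d :: nat \<Rightarrow> 'x set. (\<forall>i. step r (d i) (d (Suc i))) \<and>
       sees (\<nu> (fst x)) (d M) \<and> sees (\<nu> (snd x)) (- d 0)" for M
  proof -
    \<comment> \<open>so that the rung \<open>- n - 2 + s\<close>, seen by the first mean, lies in the rung \<open>M + n + 2\<close>\<close>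
    define s where "s = M + nat (2 * n + 4)"
    let ?t = "iter t s"
    have ct: "act ?t ` c i = c (i + int s)" for i
      using ladder_shift[of c t, OF sh] by simp
    have "AE x in BB. \<exists>g. \<nu> (fst x) (act g (act ?t p)) (act g (act ?t q)) > 0 \<and> \<nu> (snd x) (act g p') (act g q') > 0"
    proof (rule common_translate)
      show "thick (c (n + 2 + int s))" "thick (- c (- n - 2))"
        using th by simp_all
      show "act ?t p \<noteq> act ?t q"
        using pq(1) by (metis act_minus(1))
      show "median x (act ?t p) (act ?t q) = act ?t q" if "x \<in> c (n + 2 + int s)" for x
      proof -
        have "median (act (- ?t) x) p q = q"
          using that unfolding ct[symmetric] in_act_image by (rule pq(2))
        then have "act (- ?t) (median x (act ?t p) (act ?t q)) = q"
          by (simp add: act_median)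
        then show ?thesis
          by (simp add: act_eq_iff)
      qed
    qed (use pq' in auto)
    then show ?thesis
      using AE_fst[OF split] AE_snd[OF split] AE_space
    proof eventually_elim
      case (elim x)
      then obtain g where g: "\<nu> (fst x) (act (g + ?t) p) (act (g + ?t) q) > 0" "\<nu> (snd x) (act g p') (act g q') > 0"
        by (auto simp: act_add)
      have mean: "mean (\<nu> (fst x))" "mean (\<nu> (snd x))"
        using elim(4) mean_family by (simp_all add: space_BB)
      have "\<nu> (fst x) (act (g + ?t) p') (act (g + ?t) q') = 0"
        using elim(2) g(1) by (metis less_irrefl)
      then have "sees (\<nu> (fst x)) (act (g + ?t) ` (- (- c (- n - 2))))"
        by (rule seesI[OF mean(1) _ pq'(1,2)])
      then have "sees (\<nu> (fst x)) (act (g + ?t) ` c (- n - 2))"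
        by simp
      then have 1: "sees (\<nu> (fst x)) (act g ` c (int M + n + 2))"
      proof (rule sees_mono)
        have "chain r (\<lambda>i. c (int M + n + 2 + int i))"
          unfolding chain_def
        proof
          show "step r (c (int M + n + 2 + int i)) (c (int M + n + 2 + int (Suc i)))" for i
            using st[of "int M + n + 2 + int i"] by (simp add: ac_simps)
        qed
        from chain_sub[OF this, of 0 "nat (- n - 2 + int s - (int M + n + 2))"]
        moreover have "int M + n + 2 + int (nat (- n - 2 + int s - (int M + n + 2))) = - n - 2 + int s"
          by (simp add: s_def)
        ultimately have "c (- n - 2 + int s) \<subseteq> c (int M + n + 2)"
          by (simp only: of_nat_0 add_0_right zero_le)
        then show "act (g + ?t) ` c (- n - 2) \<subseteq> act g ` c (int M + n + 2)"
          unfolding act_image_comp[symmetric] ct by (rule image_mono)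
      qed
      have "\<nu> (snd x) (act g p) (act g q) = 0"
        using elim(3) g(2) by (metis less_irrefl)
      then have "sees (\<nu> (snd x)) (act g ` (- c (n + 2)))"
        by (rule seesI[OF mean(2) _ pq(1,2)])
      then have 2: "sees (\<nu> (snd x)) (- act g ` c (n + 2))"
        by (simp add: act_image_Compl)
      show ?case
      proof (intro exI[of _ "\<lambda>i. act g ` c (int i + n + 2)"] conjI allI)
        show "step r (act g ` c (int i + n + 2)) (act g ` c (int (Suc i) + n + 2))" for i
          using act_step[OF st[of "int i + n + 2"]] by (simp add: ac_simps)
      qed (use 1 2 in simp_all)
    qed
  qed
  with r show thesis
    by (rule that)
qed

text \<open>
  Of two independent means, one sees a long initial piece of the ladder from the base point \<open>z\<close>, whichever side
  of the middle rung \<open>z\<close> is on. So almost every mean does, for every length, and it is the evaluation at the end of an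
  infinite chain.
\<close>

lemma mean_at_regular_point:
  "AE b in B. \<exists>\<xi>\<in>regular_boundary. \<forall>p q. \<nu> b p q = dist p (\<xi> (p, q))"
proof -
  obtain r where r: "r > 0" and ladder:
    "\<And>M. AE x in BB. \<exists>d :: nat \<Rightarrow> 'x set. (\<forall>i. step r (d i) (d (Suc i))) \<and>
       sees (\<nu> (fst x)) (d M) \<and> sees (\<nu> (snd x)) (- d 0)"
    using long_ladder by blast
  fix z :: 'x
  let ?D = "\<lambda>M b. \<exists>k. (\<forall>i<M. step r (k i) (k (Suc i))) \<and> z \<notin> k 0 \<and> sees (\<nu> b) (k M)"
  have "AE b in B. ?D M b" for M
  proof -
    have "AE x in BB. ?D M (fst x) \<or> ?D M (snd x)"
      using ladder[of "2 * M"]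
    proof eventually_elim
      case (elim x)
      then obtain d :: "nat \<Rightarrow> 'x set" where d: "\<And>i. step r (d i) (d (Suc i))"
        "sees (\<nu> (fst x)) (d (2 * M))" "sees (\<nu> (snd x)) (- d 0)"
        by blast
      show ?case
      proof (cases "z \<in> d M")
        case False
        then have "?D M (fst x)"
          using d(1,2) by (intro exI[of _ "\<lambda>i. d (M + i)"]) (simp add: mult_2)
        then show ?thesis ..
      next
        case True
        have "step r (- d (M - i)) (- d (M - Suc i))" if "i < M" for i
          using step_Compl[OF d(1)[of "M - Suc i"]] that by (simp add: Suc_diff_Suc)
        then have "?D M (snd x)"
          using True d(3) by (intro exI[of _ "\<lambda>i. - d (M - i)"]) simp
        then show ?thesis ..
      qed
    qed
    from AE_iterate[OF this] have *: "AE b in B. AE b' in B. ?D M b \<or> ?D M b'"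
      by (simp only: fst_conv snd_conv)
    show ?thesis
    proof (rule ccontr)
      assume not: "\<not> (AE b in B. ?D M b)"
      have "AE b in B. ?D M b"
        using *
      proof eventually_elim
        case (elim b)
        show ?case
        proof (rule ccontr)
          assume "\<not> ?D M b"
          then have "AE b' in B. ?D M b'"
            using elim by (simp only: simp_thms)
          then show False
            using not by blast
        qed
      qed
      then show False
        using not by blast
    qed
  qed
  then have "AE b in B. \<forall>M. ?D M b"
    by (simp only: AE_all_countable) blast
  then show ?thesis
    using AE_space
  proof eventually_elim
    case (elim b)
    have \<mu>: "mean (\<nu> b)"
      using mean_family[OF elim(2)] .
    obtain k :: "nat \<Rightarrow> 'x set" where k: "chain r k" "\<And>i. sees (\<nu> b) (k i)"
    proof -
      have "\<exists>k :: nat \<Rightarrow> 'x set. chain r k \<and> (\<forall>i. k i \<in> {h. sees (\<nu> b) h})"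
        by (rule infinite_chain[OF r, of _ z]) (use elim(1) sees_meet[OF \<mu>] sees_mono in \<open>simp_all, blast\<close>)
      then show thesis
        using that by blast
    qed
    obtain \<xi> where \<xi>: "ends_at k \<xi>"
      using ex_end[OF k(1) r] by blast
    have "\<nu> b p q = dist p (\<xi> (p, q))" for p q
    proof -
      obtain N where "\<forall>y\<in>k N. median y p q = \<xi> (p, q)"
        using \<xi> unfolding ends_at_def by blast
      then show ?thesis
        using sees_const[OF \<mu> k(2)[of N]] by blast
    qed
    then show ?case
      using end_regular[OF k(1) r \<xi>] by blast
  qed
qed

end

section \<open>Amenability and invariant states\<close>

lemma space_borel_of_topology [simp]: "space (borel_of_topology X) = topspace X"
  unfolding borel_of_topology_def by (intro space_measure_of) (auto dest: openin_subset)

lemma openin_borel_of_topology: "openin X U \<Longrightarrow> U \<in> sets (borel_of_topology X)"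
  unfolding borel_of_topology_def by (auto dest: openin_subset)

lemma closedin_borel_of_topology:
  assumes "closedin X C"
  shows "C \<in> sets (borel_of_topology X)"
proof -
  have "topspace X - C \<in> sets (borel_of_topology X)" "C \<subseteq> topspace X"
    using assms unfolding closedin_def by (auto intro: openin_borel_of_topology)
  then show ?thesis
    using sets.compl_sets[of "topspace X - C" "borel_of_topology X"] by (simp add: double_diff)
qed

lemma measurable_borel_of_topologyI:
  assumes "\<And>x. x \<in> space M \<Longrightarrow> f x \<in> topspace X"
    and "\<And>U. openin X U \<Longrightarrow> f -` U \<inter> space M \<in> sets M"
  shows "f \<in> measurable M (borel_of_topology X)"
  unfolding borel_of_topology_def
  by (rule measurable_measure_of) (use assms in \<open>auto dest: openin_subset\<close>)

lemma continuous_map_measurable_to: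
  assumes "continuous_map euclidean X f"
  shows "f \<in> measurable borel (borel_of_topology X)"
proof (rule measurable_borel_of_topologyI)
  show "f x \<in> topspace X" for x
    using assms by (auto simp: continuous_map_def)
  show "f -` U \<inter> space borel \<in> sets borel" if "openin X U" for U
  proof -
    have "open {x. f x \<in> U}"
      using openin_continuous_map_preimage[OF assms that] by simp
    then show ?thesis
      by (simp add: vimage_def)
  qed
qed

lemma continuous_map_measurable_from:
  fixes f :: "'a \<Rightarrow> 'c::topological_space"
  assumes "continuous_map X euclidean f"
  shows "f \<in> measurable (borel_of_topology X) borel"
proof (rule borel_measurableI)
  fix U :: "'c set" assume "open U"
  then have "openin X {x \<in> topspace X. f x \<in> U}"
    using openin_continuous_map_preimage[OF assms] by simp
  moreover have "{x \<in> topspace X. f x \<in> U} = f -` U \<inter> topspace X"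
    by blast
  ultimately show "f -` U \<inter> space (borel_of_topology X) \<in> sets (borel_of_topology X)"
    using openin_borel_of_topology by fastforce
qed

text \<open>
  Amenability for a cocycle that is constant on \<open>B\<close> and the constant field of the normalized functionals of norm one. The space \<open>U\<close> is
  transported into the bounded sequences by \<open>R\<close>.
\<close>

lemma amenable_invariant_states:
  fixes U :: "'v::{real_normed_vector, complete_space} set" and T :: "'g::topological_group_add \<Rightarrow> 'v \<Rightarrow> 'v" and R :: "'v \<Rightarrow> bounded_seq"
  assumes am: "zimmer_amenable actB B"
    and R: "bounded_linear R" "\<And>u. norm (R u) = norm u"
    and U: "subspace U" "closed U" and D: "countable D" "D \<subseteq> U" "U \<subseteq> closure D"
    and T: "\<And>g u. u \<in> U \<Longrightarrow> T g u \<in> U" "\<And>g u v. T g (u + v) = T g u + T g v" "\<And>g c u. T g (c *\<^sub>R u) = c *\<^sub>R T g u"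
      "\<And>g u. norm (T g u) = norm u" "\<And>u. T 0 u = u" "\<And>g h u. T (g + h) u = T g (T h u)"
      "\<And>u. u \<in> U \<Longrightarrow> continuous_on UNIV (\<lambda>g. T g u)"
    and e: "e \<in> U" "\<And>g. T g e = e"
    and state: "linear \<tau>" "\<And>u. \<bar>\<tau> u\<bar> \<le> norm u" "\<tau> e = 1"
  shows "\<exists>\<phi> :: 'b \<Rightarrow> 'v \<Rightarrow> real. (\<forall>u\<in>U. (\<lambda>b. \<phi> b u) \<in> borel_measurable B) \<and>
    (AE b in B. \<phi> b e = 1 \<and> (\<forall>u\<in>U. \<bar>\<phi> b u\<bar> \<le> norm u) \<and> (\<forall>u\<in>U. \<forall>v\<in>U. \<phi> b (u + v) = \<phi> b u + \<phi> b v) \<and>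
      (\<forall>c. \<forall>u\<in>U. \<phi> b (c *\<^sub>R u) = c * \<phi> b u)) \<and>
    (\<forall>g. AE b in B. \<forall>u\<in>U. \<phi> (actB g b) (T g u) = \<phi> b u)"
proof -
  interpret R: bounded_linear R
    by (rule R(1))
  have Uadd: "u + v \<in> U" and Uscale: "c *\<^sub>R u \<in> U" if "u \<in> U" "v \<in> U" for u v c
    using U(1) that by (simp_all add: subspace_def)
  have R_eq: "R u = R v \<longleftrightarrow> u = v" for u v
    using R(2)[of "u - v"] by (metis R.diff norm_eq_zero right_minus_eq)
  define V where "V = R ` U"
  define S where "S = inv_into U R"
  have SR: "S (R u) = u" if "u \<in> U" for u
    unfolding S_def using that by (intro inv_into_f_f inj_onI) (simp_all add: R_eq)
  define A where "A g = (\<lambda>v\<in>V. R (T g (S v)))" for g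
  have RV: "R u \<in> V" if "u \<in> U" for u
    using that by (simp add: V_def)
  have Vall: "(\<forall>v\<in>V. P v) \<longleftrightarrow> (\<forall>u\<in>U. P (R u))" for P
    by (simp add: V_def)
  have AR: "A g (R u) = R (T g u)" if "u \<in> U" for g u
    using that by (simp add: A_def RV SR)
  have TT: "T (- g) (T g u) = u" "T g (T (- g) u) = u" for g u
    using T(5) by (simp_all flip: T(6))
  have invA: "inv_into V (A g) (R u) = R (T (- g) u)" if u: "u \<in> U" for g u
  proof (rule inv_into_f_eq)
    show "inj_on (A g) V"
      unfolding V_def by (auto simp: inj_on_def AR R_eq) (metis TT(1))
    show "R (T (- g) u) \<in> V"
      using u by (intro RV T(1))
    show "A g (R (T (- g) u)) = R u"
      using u by (simp add: AR T(1) TT)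
  qed
  have isom: "A g \<in> linear_isometries V" for g
    unfolding linear_isometries_def linear_on_subspace_def
  proof (intro CollectI conjI)
    show "A g \<in> extensional V"
      by (simp add: A_def)
    show "\<forall>u\<in>V. \<forall>v\<in>V. A g (u + v) = A g u + A g v"
      unfolding Vall by (simp add: AR Uadd T(2) flip: R.add)
    show "\<forall>c. \<forall>v\<in>V. A g (c *\<^sub>R v) = c *\<^sub>R A g v"
      unfolding Vall by (simp add: AR Uscale T(3) flip: R.scaleR)
    show "\<forall>v\<in>V. norm (A g v) = norm v"
      unfolding Vall by (simp add: AR R(2) T(4))
    have "A g ` V \<subseteq> V"
      unfolding image_subset_iff Vall by (simp add: AR RV T(1))
    moreover have "R u \<in> A g ` V" if "u \<in> U" for u
    proof (rule image_eqI)
      show "R u = A g (R (T (- g) u))"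
        using that by (simp add: AR T(1) TT)
      show "R (T (- g) u) \<in> V"
        using that by (intro RV T(1))
    qed
    ultimately show "A g ` V = V"
      unfolding V_def by blast
  qed
  have sub: "subspace V"
    unfolding V_def using U(1) R.linear_axioms by (intro linear_subspace_image)
  have "complete V"
    unfolding V_def using U R by (intro complete_isometric_image[where e = 1]) (auto simp: complete_eq_closed)
  then have cl: "closed V"
    by (rule complete_imp_closed)
  have sep: "separable_space (top_of_set V)"
    unfolding separable_space_def
  proof (intro exI[of _ "R ` D"] conjI)
    show "countable (R ` D)" "R ` D \<subseteq> topspace (top_of_set V)"
      using D unfolding V_def by auto
    have "R ` closure D \<subseteq> closure (R ` D)"
      by (rule closure_bounded_linear_image_subset[OF R(1)])
    then have "V \<subseteq> closure (R ` D)"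
      using D(3) unfolding V_def by blast
    then show "top_of_set V closure_of R ` D = topspace (top_of_set V)"
      using D(2) unfolding V_def by (auto simp: closure_of_subtopology Int_absorb1 image_mono)
  qed
  have contA: "continuous_map euclidean (strong_operator_topology V) A"
    unfolding strong_operator_topology_def continuous_map_in_subtopology continuous_map_componentwise Vall
  proof (intro conjI ballI)
    show "A ` topspace euclidean \<subseteq> extensional V"
      by (auto simp: A_def)
    show "continuous_map euclidean euclidean (\<lambda>g. A g (R u))" if "u \<in> U" for u
      using that by (simp add: AR R.continuous_on T(7))
    show "(\<lambda>g. A g (R u)) \<in> topspace euclidean \<rightarrow> V" if "u \<in> U" for u
      using that by (simp add: AR RV T(1))
    show "A \<in> topspace euclidean \<rightarrow> linear_isometries V"
      using isom by blast
  qed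
  have cocycle: "isometry_cocycle actB B V (\<lambda>g s. A g)"
    unfolding isometry_cocycle_def Vall
  proof (intro conjI allI AE_I2 ballI)
    have "(\<lambda>x. A (fst x)) \<in> measurable (borel \<Otimes>\<^sub>M B) (borel_of_topology (strong_operator_topology V))"
      by (rule measurable_compose[OF measurable_fst continuous_map_measurable_to[OF contA]])
    then show "(\<lambda>(g, s). A g) \<in> measurable (borel \<Otimes>\<^sub>M B) (borel_of_topology (strong_operator_topology V))"
      by (simp add: case_prod_beta)
    show "A (g + h) (R u) = A g (A h (R u))" if "u \<in> U" for g h u
      using that by (simp add: AR T)
  qed
  define K where "K = {l \<in> dual_unit_ball V. l (R e) = 1}"
  let ?P = "product_topology (\<lambda>_. euclideanreal) V"
  let ?box = "PiE V (\<lambda>v. {- norm v .. norm v})"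
  have proj: "continuous_map ?P euclideanreal (\<lambda>l. l v)" if "v \<in> V" for v
    using that by (rule continuous_map_product_projection)
  have Vadd: "u + v \<in> V" "c *\<^sub>R v \<in> V" if "u \<in> V" "v \<in> V" for u v c
    using sub that by (simp_all add: subspace_def)
  have K_eq: "K = ?box \<inter> (\<Inter>u\<in>V. \<Inter>v\<in>V. {l \<in> topspace ?P. l (u + v) - (l u + l v) \<in> {0}}) \<inter>
      (\<Inter>c. \<Inter>v\<in>V. {l \<in> topspace ?P. l (c *\<^sub>R v) - c * l v \<in> {0}}) \<inter> {l \<in> topspace ?P. l (R e) - 1 \<in> {0}}"
    unfolding K_def dual_unit_ball_def linear_on_subspace_def
    by (auto simp: PiE_def Pi_def abs_le_iff) 
  have cbox: "compactin ?P ?box"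
    by (simp add: compactin_PiE)
  have Vne: "V \<noteq> {}"
    using RV[OF e(1)] by blast
  have "closedin ?P ?box"
    by (simp add: closedin_product_topology)
  then have closedK: "closedin ?P K"
    unfolding K_eq using Vne RV[OF e(1)]
    by (intro closedin_Int closedin_INT closedin_continuous_map_preimage[where Y = euclideanreal]
        continuous_map_diff continuous_map_add continuous_map_real_mult proj Vadd) auto
  have "compactin ?P K"
    by (rule closed_compactin[OF cbox _ closedK]) (auto simp: K_eq)
  then have compactK: "compactin (weak_star_ball V) K"
    unfolding weak_star_ball_def compactin_subtopology by (auto simp: K_def)
  have closedK': "closedin (weak_star_ball V) K"
    unfolding weak_star_ball_def using closedK by (rule closedin_subset_topspace) (auto simp: K_def)
  have KD: "l \<in> extensional V" "l (R e) = 1" "u \<in> U \<Longrightarrow> v \<in> U \<Longrightarrow> l (R (u + v)) = l (R u) + l (R v)"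
    "u \<in> U \<Longrightarrow> l (R (c *\<^sub>R u)) = c * l (R u)" "u \<in> U \<Longrightarrow> \<bar>l (R u)\<bar> \<le> norm u" if "l \<in> K" for l u v c
    using that unfolding K_def dual_unit_ball_def linear_on_subspace_def Vall
    by (auto simp: R(2) R.add R.scaleR)
  have KI: "l \<in> K" if "l \<in> extensional V" "l (R e) = 1" "\<And>u v. u \<in> U \<Longrightarrow> v \<in> U \<Longrightarrow> l (R (u + v)) = l (R u) + l (R v)"
    "\<And>c u. u \<in> U \<Longrightarrow> l (R (c *\<^sub>R u)) = c * l (R u)" "\<And>u. u \<in> U \<Longrightarrow> \<bar>l (R u)\<bar> \<le> norm u" for l
    using that unfolding K_def dual_unit_ball_def linear_on_subspace_def Vall
    by (simp add: R(2) flip: R.add R.scaleR)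
  have "(\<lambda>v\<in>V. \<tau> (S v)) \<in> K"
    using state by (intro KI) (auto simp: RV SR e Uadd Uscale linear_add linear_cmul)
  then have neK: "K \<noteq> {}"
    by blast
  have convK: "convex_functionals V K"
    unfolding convex_functionals_def
  proof (intro ballI)
    fix k l :: "bounded_seq \<Rightarrow> real" and t :: real assume kl: "k \<in> K" "l \<in> K" and t: "t \<in> {0..1}"
    have "\<bar>(1 - t) * k (R u) + t * l (R u)\<bar> \<le> norm u" if "u \<in> U" for u
    proof -
      have "\<bar>(1 - t) * k (R u) + t * l (R u)\<bar> \<le> (1 - t) * \<bar>k (R u)\<bar> + t * \<bar>l (R u)\<bar>"
        using t by (intro order_trans[OF abs_triangle_ineq]) (simp add: abs_mult)
      also have "\<dots> \<le> (1 - t) * norm u + t * norm u"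
        using KD(5)[OF kl(1) that] KD(5)[OF kl(2) that] t by (intro add_mono mult_left_mono) auto
      finally show ?thesis
        by (simp add: algebra_simps)
    qed
    then show "(\<lambda>v\<in>V. (1 - t) * k v + t * l v) \<in> K"
      using kl by (intro KI) (auto simp: RV KD e Uadd Uscale algebra_simps)
  qed
  define C where "C g l = contragredient V (A g) l" for g l
  have CR: "C g l (R u) = l (R (T (- g) u))" if "u \<in> U" for g l u
    using that by (simp add: C_def contragredient_def RV invA)
  have CK: "C g l \<in> K" if l: "l \<in> K" for g l
  proof (rule KI)
    show "C g l \<in> extensional V"
      by (simp add: C_def contragredient_def)
    show "\<bar>C g l (R u)\<bar> \<le> norm u" if "u \<in> U" for u
      using KD(5)[OF l T(1)[OF that, of "- g"]] that by (simp add: CR T(4))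
  qed (simp_all add: CR e KD[OF l] Uadd Uscale T)
  have CC: "C g (C (- g) l) = l" if l: "l \<in> K" for g l
  proof (rule extensionalityI)
    show "C g (C (- g) l) \<in> extensional V"
      by (simp add: C_def contragredient_def)
    show "l \<in> extensional V"
      by (rule KD(1)[OF l])
    fix v assume "v \<in> V"
    then obtain u where "v = R u" "u \<in> U"
      by (auto simp: V_def)
    then show "C g (C (- g) l) v = l v"
      using TT(2) by (simp add: CR T(1))
  qed
  have "C g ` K = K" for g
    using CK CC by (metis image_subset_iff subsetI subset_antisym image_eqI)
  then have field: "invariant_convex_field actB B V (\<lambda>g s. A g) (\<lambda>s. K)"
    unfolding invariant_convex_field_def
  proof (intro conjI ballI allI AE_I2)
    have "space B \<times> K \<in> sets (B \<Otimes>\<^sub>M borel_of_topology (weak_star_ball V))"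
      by (intro pair_measureI closedin_borel_of_topology closedK') simp
    moreover have "space B \<times> K = {(s, l). s \<in> space B \<and> l \<in> K}"
      by auto
    ultimately show "{(s, l). s \<in> space B \<and> l \<in> K} \<in> sets (B \<Otimes>\<^sub>M borel_of_topology (weak_star_ball V))"
      by (simp only:)
  qed (simp_all add: neK compactK convK C_def)
  obtain \<psi> where \<psi>: "\<psi> \<in> measurable B (borel_of_topology (weak_star_ball V))" "AE s in B. \<psi> s \<in> K"
    "\<And>g. AE s in B. \<psi> (actB g s) = contragredient V (A g) (\<psi> s)"
    using am cocycle field sub cl sep unfolding zimmer_amenable_def separable_banach_def by blast
  show ?thesis
  proof (rule exI[of _ "\<lambda>b u. \<psi> b (R u)"], intro conjI)
    show "\<forall>u\<in>U. (\<lambda>b. \<psi> b (R u)) \<in> borel_measurable B"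
    proof
      fix u assume "u \<in> U"
      then have "(\<lambda>l. l (R u)) \<in> borel_measurable (borel_of_topology (weak_star_ball V))"
        unfolding weak_star_ball_def
        by (intro continuous_map_measurable_from continuous_map_from_subtopology proj RV)
      then show "(\<lambda>b. \<psi> b (R u)) \<in> borel_measurable B"
        by (rule measurable_compose[OF \<psi>(1)])
    qed
    show "AE b in B. \<psi> b (R e) = 1 \<and> (\<forall>u\<in>U. \<bar>\<psi> b (R u)\<bar> \<le> norm u) \<and>
        (\<forall>u\<in>U. \<forall>v\<in>U. \<psi> b (R (u + v)) = \<psi> b (R u) + \<psi> b (R v)) \<and> (\<forall>c. \<forall>u\<in>U. \<psi> b (R (c *\<^sub>R u)) = c * \<psi> b (R u))"
      using \<psi>(2) by eventually_elim (simp add: KD)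
    show "\<forall>g. AE b in B. \<forall>u\<in>U. \<psi> (actB g b) (R (T g u)) = \<psi> b (R u)"
    proof
      show "AE b in B. \<forall>u\<in>U. \<psi> (actB g b) (R (T g u)) = \<psi> b (R u)" for g
        using \<psi>(3)[of g] by eventually_elim (simp add: CR[unfolded C_def] T(1) TT)
    qed
  qed
qed

text \<open>
  The linear combinations with rational coefficients.
\<close>

lemma countable_dense_span:
  fixes T :: "'v::real_normed_vector set"
  assumes "countable T"
  obtains D where "countable D" "D \<subseteq> span T" "closure (span T) \<subseteq> closure D"
proof -
  define comb :: "(real \<times> 'v) list \<Rightarrow> 'v" where "comb xs = (\<Sum>p\<leftarrow>xs. fst p *\<^sub>R snd p)" for xs
  define D where "D = comb ` lists (\<rat> \<times> T)"
  have "countable D"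
    unfolding D_def using assms by (intro countable_image countable_lists countable_SIGMA countable_rat)
  moreover have "comb xs \<in> span T" if "xs \<in> lists (\<rat> \<times> T)" for xs
    using that
  proof (induction rule: lists.induct)
    case (Cons p xs)
    then show ?case
      unfolding comb_def by (auto intro: span_add[OF span_scale[OF span_base]])
  qed (simp add: comb_def span_zero)
  then have "D \<subseteq> span T"
    unfolding D_def by blast
  moreover have "closure (span T) \<subseteq> closure D"
  proof (rule closure_minimal)
    have zero: "0 \<in> D"
      unfolding D_def by (rule image_eqI[of _ _ "[]"]) (simp_all add: comb_def)
    have add: "u + v \<in> D" if uv: "u \<in> D" "v \<in> D" for u v
    proof -
      obtain xs ys where "u = comb xs" "v = comb ys" "xs \<in> lists (\<rat> \<times> T)" "ys \<in> lists (\<rat> \<times> T)"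
        using uv unfolding D_def by blast
      then show ?thesis
        unfolding D_def by (intro image_eqI[of _ _ "xs @ ys"]) (simp_all add: comb_def)
    qed
    have scale: "r *\<^sub>R u \<in> D" if r: "r \<in> \<rat>" and u: "u \<in> D" for r u
    proof -
      obtain xs where xs: "u = comb xs" "xs \<in> lists (\<rat> \<times> T)"
        using u unfolding D_def by blast
      have "r *\<^sub>R comb xs = comb (map (\<lambda>p. (r * fst p, snd p)) xs)"
        unfolding comb_def by (induction xs) (simp_all add: scaleR_add_right)
      moreover have "map (\<lambda>p. (r * fst p, snd p)) xs \<in> lists (\<rat> \<times> T)"
        using xs(2) r by (induction rule: lists.induct) (auto intro!: Rats_mult)
      ultimately show ?thesis
        unfolding D_def xs(1) by blast
    qed
    have rat: "\<exists>r. (\<forall>n. r n \<in> \<rat>) \<and> r \<longlonglongrightarrow> c" for c :: real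
      using closure_sequential[of c \<rat>] Rats_closure_real by simp
    have sub: "subspace (closure D)"
    proof (rule subspaceI)
      show "0 \<in> closure D"
        using zero closure_subset by blast
      fix u assume "u \<in> closure D"
      then obtain x where x: "\<And>n. x n \<in> D" "x \<longlonglongrightarrow> u"
        unfolding closure_sequential by blast
      show "u + v \<in> closure D" if v: "v \<in> closure D" for v
      proof -
        obtain y where y: "\<And>n. y n \<in> D" "y \<longlonglongrightarrow> v"
          using v unfolding closure_sequential by blast
        have "(\<lambda>n. x n + y n) \<longlonglongrightarrow> u + v"
          by (rule tendsto_add[OF x(2) y(2)])
        then show ?thesis
          unfolding closure_sequential by (intro exI[of _ "\<lambda>n. x n + y n"]) (simp add: add[OF x(1) y(1)])
      qed
      show "c *\<^sub>R u \<in> closure D" for c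
      proof -
        obtain r where r: "\<And>n. r n \<in> \<rat>" "r \<longlonglongrightarrow> c"
          using rat by blast
        have "(\<lambda>n. r n *\<^sub>R x n) \<longlonglongrightarrow> c *\<^sub>R u"
          by (rule tendsto_scaleR[OF r(2) x(2)])
        then show ?thesis
          unfolding closure_sequential by (intro exI[of _ "\<lambda>n. r n *\<^sub>R x n"]) (simp add: scale[OF r(1) x(1)])
      qed
    qed
    have "T \<subseteq> D"
    proof
      fix t assume "t \<in> T"
      then show "t \<in> D"
        unfolding D_def by (intro image_eqI[of _ _ "[(1, t)]"]) (auto simp: comb_def)
    qed
    then have "T \<subseteq> closure D"
      using closure_subset by blast
    then show "span T \<subseteq> closure D"
      by (rule span_minimal[OF _ sub])
  qed simp
  ultimately show thesis
    by (rule that)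
qed

lemma subspace_closure:
  fixes S :: "'v::real_normed_vector set"
  assumes "subspace S"
  shows "subspace (closure S)"
proof (rule subspaceI)
  show "0 \<in> closure S"
    using subspace_0[OF assms] closure_subset by blast
  fix u assume "u \<in> closure S"
  then obtain x where x: "\<And>n. x n \<in> S" "x \<longlonglongrightarrow> u"
    unfolding closure_sequential by blast
  show "c *\<^sub>R u \<in> closure S" for c
  proof -
    have "(\<lambda>n. c *\<^sub>R x n) \<longlonglongrightarrow> c *\<^sub>R u"
      by (rule tendsto_scaleR[OF tendsto_const x(2)])
    then show ?thesis
      unfolding closure_sequential
      by (intro exI[of _ "\<lambda>n. c *\<^sub>R x n"]) (simp add: subspace_scale[OF assms x(1)])
  qed
  fix v assume "v \<in> closure S"
  then obtain y where y: "\<And>n. y n \<in> S" "y \<longlonglongrightarrow> v"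
    unfolding closure_sequential by blast
  have "(\<lambda>n. x n + y n) \<longlonglongrightarrow> u + v"
    by (rule tendsto_add[OF x(2) y(2)])
  then show "u + v \<in> closure S"
    unfolding closure_sequential
    by (intro exI[of _ "\<lambda>n. x n + y n"]) (simp add: subspace_add[OF assms x(1) y(1)])
qed

text \<open>The supremum norm of a continuous function can be computed on a dense sequence.\<close>

lemma restrict_to_dense_sequence:
  obtains R :: "('x::{metric_space, second_countable_topology} \<Rightarrow>\<^sub>C real) \<Rightarrow> bounded_seq"
  where "bounded_linear R" "\<And>f. norm (R f) = norm f"
proof -
  obtain Q :: "'x set" where Q: "countable Q" "\<And>U. open U \<Longrightarrow> U \<noteq> {} \<Longrightarrow> \<exists>d\<in>Q. d \<in> U"
    using countable_dense_exists by blast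
  have "Q \<noteq> {}"
    using Q(2)[of UNIV] by auto
  then have range: "range (from_nat_into Q) = Q"
    using Q(1) by (rule range_from_nat_into)
  define R where "R f = Bcontfun (\<lambda>n. apply_bcontfun f (from_nat_into Q n))" for f :: "'x \<Rightarrow>\<^sub>C real"
  have R_apply: "R f n = f (from_nat_into Q n)" for f n
  proof -
    have "(\<lambda>n. apply_bcontfun f (from_nat_into Q n)) \<in> bcontfun"
      by (rule bcontfun_normI[of _ "norm f"]) (use norm_bounded[of f] in simp_all)
    then show ?thesis
      by (simp add: R_def Bcontfun_inverse)
  qed
  have norm_R: "norm (R f) = norm f" for f
  proof (rule antisym)
    show "norm (R f) \<le> norm f"
      by (rule norm_bound) (use norm_bounded[of f] in \<open>simp add: R_apply\<close>)
    show "norm f \<le> norm (R f)"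
    proof (rule norm_bound, rule ccontr)
      fix x assume x: "\<not> norm (f x) \<le> norm (R f)"
      have "open {x. norm (R f) < norm (f x)}"
        by (intro open_Collect_less continuous_intros continuous_on_apply_bcontfun)
      moreover have "x \<in> {x. norm (R f) < norm (f x)}"
        using x by simp
      ultimately obtain q where q: "q \<in> Q" "norm (R f) < norm (f q)"
        using Q(2) by blast
      obtain n where "q = from_nat_into Q n"
        using q(1) range by blast
      then show False
        using q(2) norm_bounded[of "R f" n] by (simp add: R_apply)
    qed
  qed
  have "bounded_linear R"
    by (rule bounded_linear_intro[where K = 1]) (auto intro!: bcontfun_eqI simp: R_apply norm_R)
  then show thesis
    using norm_R by (rule that)
qed

context median_action
begin

definition gprod_fun :: "'x \<Rightarrow> 'x \<Rightarrow> ('x \<Rightarrow>\<^sub>C real)" where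
  "gprod_fun p q = Bcontfun (gprod p q)"

lemma gprod_fun_apply [simp]: "gprod_fun p q x = gprod p q x"
proof -
  have "gprod p q \<in> bcontfun"
  proof (rule bcontfun_normI[of _ "dist p q"])
    show "continuous_on UNIV (gprod p q)"
      unfolding gprod_eq[abs_def] by (intro continuous_intros) simp
    show "norm (gprod p q x) \<le> dist p q" for x
      using gprod_nonneg[of p q x] gprod_le[of p q x] by simp
  qed
  then show ?thesis
    by (simp add: gprod_fun_def Bcontfun_inverse)
qed

lemma gprod_fun_lipschitz: "dist (gprod_fun p q) (gprod_fun p' q') \<le> dist p p' + dist q q'"
proof (rule dist_bound)
  fix x
  show "dist (gprod_fun p q x) (gprod_fun p' q' x) \<le> dist p p' + dist q q'"
    using gprod_lipschitz[of p q x p' q'] gprod_lipschitz[of p' q' x p q]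
    unfolding gprod_fun_apply dist_real_def dist_commute[of p' p] dist_commute[of q' q] by linarith
qed

lemma push_gprod_fun: "push g (gprod_fun p q) = gprod_fun (act g p) (act g q)"
  by (rule bcontfun_eqI) (simp add: push_apply gprod_act)

lemma push_linear: "push g (u + v) = push g u + push g v" "push g (c *\<^sub>R u) = c *\<^sub>R push g u"
  by (auto intro!: bcontfun_eqI simp: push_apply)

lemma push_norm: "norm (push g u) = norm u"
proof -
  have "push g 0 = 0"
    by (rule bcontfun_eqI) (simp add: push_apply)
  then show ?thesis
    using push_isometric[of g u 0] by simp
qed

text \<open>
  A normalized functional of norm one is positive: if \<open>0 \<le> h \<le> m\<close> then \<open>m - h\<close> has norm at most \<open>m\<close>.
\<close>

lemma state_mean:
  assumes U: "subspace U" "const_bcontfun 1 \<in> U" "\<And>p q. gprod_fun p q \<in> U"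
    and \<phi>: "\<phi> (const_bcontfun 1) = 1" "\<And>u. u \<in> U \<Longrightarrow> \<bar>\<phi> u\<bar> \<le> norm u"
      "\<And>u v. u \<in> U \<Longrightarrow> v \<in> U \<Longrightarrow> \<phi> (u + v) = \<phi> u + \<phi> v" "\<And>c u. u \<in> U \<Longrightarrow> \<phi> (c *\<^sub>R u) = c * \<phi> u"
  shows "mean (\<lambda>p q. \<phi> (gprod_fun p q))"
  unfolding mean_def
proof (intro allI impI)
  fix n :: nat and a and p q :: "nat \<Rightarrow> 'x" and c :: real
  assume c: "\<forall>x. (\<Sum>i<n. a i * gprod (p i) (q i) x) \<le> c"
  define f where "f n = (\<Sum>i<n. a i *\<^sub>R gprod_fun (p i) (q i))" for n :: nat
  have fU: "f n \<in> U" for n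
    unfolding f_def using U by (intro subspace_sum subspace_scale)
  have \<phi>f: "\<phi> (f n) = (\<Sum>i<n. a i * \<phi> (gprod_fun (p i) (q i)))" for n
  proof (induction n)
    case 0
    show ?case
      using \<phi>(4)[OF U(2), of 0] by (simp add: f_def)
  next
    case (Suc n)
    have "f (Suc n) = f n + a n *\<^sub>R gprod_fun (p n) (q n)"
      by (simp add: f_def)
    then show ?case
      using Suc fU U by (simp add: \<phi>(3,4) subspace_scale)
  qed
  have f_apply: "f n x = (\<Sum>i<n. a i * gprod (p i) (q i) x)" for n x
    by (induction n) (simp_all add: f_def)
  let ?one = "const_bcontfun 1 :: 'x \<Rightarrow>\<^sub>C real"
  define h where "h = c *\<^sub>R ?one + (- 1) *\<^sub>R f n"
  have h_apply: "h x = c - f n x" for x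
    by (simp add: h_def const_bcontfun.rep_eq)
  have hU: "h \<in> U"
    unfolding h_def using U fU by (intro subspace_add subspace_scale)
  have "norm (norm h *\<^sub>R ?one + (- 1) *\<^sub>R h) \<le> norm h"
  proof (rule norm_bound)
    fix x
    have "0 \<le> h x" "h x \<le> norm h"
      using c norm_bounded[of h x] by (simp_all add: h_apply f_apply)
    then show "norm ((norm h *\<^sub>R ?one + (- 1) *\<^sub>R h) x) \<le> norm h"
      by (simp add: const_bcontfun.rep_eq)
  qed
  moreover have "\<phi> (norm h *\<^sub>R ?one + (- 1) *\<^sub>R h) = norm h - \<phi> h"
    using \<phi>(1) \<phi>(3)[of "norm h *\<^sub>R ?one" "(- 1) *\<^sub>R h"] \<phi>(4)[of h "- 1"] \<phi>(4)[of ?one "norm h"] U hU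
    by (simp add: subspace_scale subspace_neg)
  moreover have "\<phi> h = c - \<phi> (f n)"
    unfolding h_def
    using \<phi>(1) \<phi>(3)[of "c *\<^sub>R ?one" "(- 1) *\<^sub>R f n"] \<phi>(4)[of "f n" "- 1"] \<phi>(4)[of ?one c] U fU
    by (simp add: subspace_scale subspace_neg)
  moreover have "norm h *\<^sub>R ?one + (- 1) *\<^sub>R h \<in> U"
    using U hU by (intro subspace_add subspace_scale)
  ultimately show "(\<Sum>i<n. a i * \<phi> (gprod_fun (p i) (q i))) \<le> c"
    using \<phi>(2)[of "norm h *\<^sub>R ?one + (- 1) *\<^sub>R h"] \<phi>f[of n] by simp
qed

text \<open>
  The separable Banach space is the closed span of the constants and the functions \<open>gprod p q\<close>, with the group acting by
  translations. On the null set where the invariant functional fails to be a mean, it is replaced by the evaluation at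
  a point of the space.
\<close>

lemma amenable_means:
  assumes cp: "measure_class_preserving_action actB B" and am: "zimmer_amenable actB B"
  obtains \<nu> :: "'b \<Rightarrow> 'x \<Rightarrow> 'x \<Rightarrow> real"
  where "\<And>b. mean (\<nu> b)" "\<And>p q. (\<lambda>b. \<nu> b p q) \<in> borel_measurable B"
    "\<And>g. AE b in B. \<forall>p q. \<nu> (actB g b) (act g p) (act g q) = \<nu> b p q"
proof -
  obtain Q :: "'x set" where Q: "countable Q" "\<And>U. open U \<Longrightarrow> U \<noteq> {} \<Longrightarrow> \<exists>d\<in>Q. d \<in> U"
    using countable_dense_exists by blast
  let ?one = "const_bcontfun 1 :: 'x \<Rightarrow>\<^sub>C real"
  define E where "E = insert ?one ((\<lambda>(p, q). gprod_fun p q) ` (Q \<times> Q))"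
  define U where "U = closure (span E)"
  have "countable E"
    unfolding E_def using Q(1) by simp
  then obtain D where D: "countable D" "D \<subseteq> span E" "U \<subseteq> closure D"
    unfolding U_def by (rule countable_dense_span)
  have sub: "subspace U"
    unfolding U_def by (intro subspace_closure subspace_span)
  have min: "U \<subseteq> P" if "E \<subseteq> P" "subspace P" "closed P" for P
    unfolding U_def using span_minimal[OF that(1,2)] that(3) by (rule closure_minimal)
  have EU: "E \<subseteq> U"
    unfolding U_def using span_superset closure_subset by (rule order_trans)
  have one: "?one \<in> U"
    using EU by (simp add: E_def)
  have gU: "gprod_fun p q \<in> U" for p q
  proof -
    have "\<exists>u\<in>U. dist u (gprod_fun p q) < e" if e: "e > 0" for e
    proof -
      obtain p' q' where "p' \<in> Q" "dist p p' < e / 2" "q' \<in> Q" "dist q q' < e / 2"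
        using Q(2)[of "ball p (e / 2)"] Q(2)[of "ball q (e / 2)"] e by auto
      then have "gprod_fun p' q' \<in> U" "dist (gprod_fun p' q') (gprod_fun p q) < e"
        using EU gprod_fun_lipschitz[of p' q' p q] by (auto simp: E_def dist_commute)
      then show ?thesis
        by blast
    qed
    then have "gprod_fun p q \<in> closure U"
      unfolding closure_approachable by blast
    then show ?thesis
      by (simp add: U_def)
  qed
  have push_one: "push g ?one = ?one" for g
    by (rule bcontfun_eqI) (simp add: push_apply const_bcontfun.rep_eq)
  have cont_push: "continuous_on UNIV (push g)" for g
    by (rule lipschitz_on_continuous_on[of 1]) (intro lipschitz_onI; simp add: push_isometric)
  have inv: "push g u \<in> U" if "u \<in> U" for g u
  proof -
    have "U \<subseteq> push g -` U"
    proof (rule min)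
      show "E \<subseteq> push g -` U"
        using gU one by (auto simp: E_def push_gprod_fun push_one)
      show "subspace (push g -` U)"
        using sub push_linear(2)[of g 0] by (auto intro!: subspaceI simp: push_linear subspace_0 subspace_add subspace_scale)
      show "closed (push g -` U)"
        by (intro closed_vimage cont_push) (simp add: U_def)
    qed
    then show ?thesis
      using that by blast
  qed
  have cont: "continuous_on UNIV (\<lambda>g. push g u)" if "u \<in> U" for u
  proof -
    have "U \<subseteq> {u. continuous_on UNIV (\<lambda>g. push g u)}"
    proof (rule min)
      have "continuous_on UNIV (\<lambda>g. gprod_fun (act g p) (act g q))" for p q
        unfolding continuous_on_def
      proof (intro ballI)
        fix g
        have lim: "((\<lambda>h. act h x) \<longlongrightarrow> act g x) (at g)" for x
          using continuous_act unfolding continuous_on_def by blast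
        have "((\<lambda>h. dist (act h p) (act g p) + dist (act h q) (act g q)) \<longlongrightarrow>
            dist (act g p) (act g p) + dist (act g q) (act g q)) (at g)"
          by (intro tendsto_intros lim)
        then have *: "((\<lambda>h. dist (act h p) (act g p) + dist (act h q) (act g q)) \<longlongrightarrow> 0) (at g)"
          by simp
        show "((\<lambda>h. gprod_fun (act h p) (act h q)) \<longlongrightarrow> gprod_fun (act g p) (act g q)) (at g within UNIV)"
          unfolding LIM_zero_iff[symmetric, of _ "gprod_fun (act g p) (act g q)"]
          by (rule Lim_null_comparison[OF _ *]) (simp add: gprod_fun_lipschitz flip: dist_norm)
      qed
      then show "E \<subseteq> {u. continuous_on UNIV (\<lambda>g. push g u)}"
        by (auto simp: E_def push_gprod_fun push_one)
      have "push g 0 = 0" for g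
        using push_linear(2)[of g 0] by simp
      then show "subspace {u. continuous_on UNIV (\<lambda>g. push g u)}"
        by (intro subspaceI) (simp_all add: push_linear continuous_on_add continuous_on_scaleR)
      show "closed {u. continuous_on UNIV (\<lambda>g. push g u)}"
        unfolding closed_sequential_limits
      proof (intro allI impI, elim conjE)
        fix x l assume x: "\<forall>n. x n \<in> {u. continuous_on UNIV (\<lambda>g. push g u)}" "x \<longlonglongrightarrow> l"
        have "uniform_limit UNIV (\<lambda>n g. push g (x n)) (\<lambda>g. push g l) sequentially"
          unfolding uniform_limit_iff push_isometric using x(2) by (simp add: tendsto_iff)
        then have "continuous_on UNIV (\<lambda>g. push g l)"
          by (rule uniform_limit_theorem[rotated]) (use x(1) in simp_all)
        then show "l \<in> {u. continuous_on UNIV (\<lambda>g. push g u)}"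
          by simp
      qed
    qed
    then show ?thesis
      using that by blast
  qed
  obtain R :: "('x \<Rightarrow>\<^sub>C real) \<Rightarrow> bounded_seq" where R: "bounded_linear R" "\<And>f. norm (R f) = norm f"
    using restrict_to_dense_sequence by blast
  fix o' :: 'x
  have lin: "linear (\<lambda>f :: 'x \<Rightarrow>\<^sub>C real. f o')"
    by (rule linearI) simp_all
  have bd: "\<bar>f o'\<bar> \<le> norm f" for f :: "'x \<Rightarrow>\<^sub>C real"
    using norm_bounded[of f o'] by simp
  have one_o: "?one o' = 1"
    by (simp add: const_bcontfun.rep_eq)
  have clU: "closed U"
    by (simp add: U_def)
  have DU: "D \<subseteq> U"
    using D(2) closure_subset unfolding U_def by (rule order_trans)
  have push_add: "push 0 F = F" "push (g + h) F = push g (push h F)" for g h F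
    by (rule bcontfun_eqI; simp add: push_apply minus_add act_add del: add_uminus_conv_diff)+
  obtain \<phi> :: "'b \<Rightarrow> ('x \<Rightarrow>\<^sub>C real) \<Rightarrow> real" where \<phi>:
    "\<And>u. u \<in> U \<Longrightarrow> (\<lambda>b. \<phi> b u) \<in> borel_measurable B"
    "AE b in B. \<phi> b ?one = 1 \<and> (\<forall>u\<in>U. \<bar>\<phi> b u\<bar> \<le> norm u) \<and> (\<forall>u\<in>U. \<forall>v\<in>U. \<phi> b (u + v) = \<phi> b u + \<phi> b v) \<and>
      (\<forall>c. \<forall>u\<in>U. \<phi> b (c *\<^sub>R u) = c * \<phi> b u)"
    "\<And>g. AE b in B. \<forall>u\<in>U. \<phi> (actB g b) (push g u) = \<phi> b u"
    using amenable_invariant_states[OF am R sub clU D(1) DU D(3) inv push_linear push_norm push_add cont one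
        push_one lin bd one_o] by blast
  have "AE b in B. mean (\<lambda>p q. \<phi> b (gprod_fun p q))"
    using \<phi>(2) by eventually_elim (rule state_mean[OF sub one gU], simp_all)
  then obtain N where N: "{b \<in> space B. \<not> mean (\<lambda>p q. \<phi> b (gprod_fun p q))} \<subseteq> N" "emeasure B N = 0" "N \<in> sets B"
    by (rule AE_E)
  have N0: "AE b in B. b \<notin> N"
    using N(2,3) by (intro AE_not_in) auto
  define \<nu> where "\<nu> b p q = (if b \<in> space B - N then \<phi> b (gprod_fun p q) else gprod p q o')" for b p q
  have "mean (\<lambda>p q. gprod p q o')"
    by (simp add: mean_def)
  then have "mean (\<nu> b)" for b
    using N(1) by (cases "b \<in> space B - N") (auto simp: \<nu>_def[abs_def])
  moreover have "(\<lambda>b. \<nu> b p q) \<in> borel_measurable B" for p q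
    unfolding \<nu>_def using N(3) \<phi>(1)[OF gU] by measurable
  moreover have "AE b in B. \<forall>p q. \<nu> (actB g b) (act g p) (act g q) = \<nu> b p q" for g
    using \<phi>(3)[of g] N0 AE_action[OF cp N0, of g] AE_action[OF cp AE_space, of g] AE_space
  proof eventually_elim
    case (elim b)
    then show ?case
      using gU by (simp add: \<nu>_def flip: push_gprod_fun)
  qed
  ultimately show thesis
    by (rule that)
qed

end

section \<open>Points of the Roller compactification as means\<close>

definition evaluation :: "'x::metric_space roller \<Rightarrow> 'x \<Rightarrow> 'x \<Rightarrow> real" where
  "evaluation \<xi> p q = dist p (\<xi> (p, q))"

context median_metric
begin

lemma roller_approx:
  fixes \<xi> :: "'x roller"
  assumes "\<xi> \<in> roller_compactification" "finite P" "e > 0"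
  obtains y where "\<And>a b. (a, b) \<in> P \<Longrightarrow> dist (median y a b) (\<xi> (a, b)) < e"
proof -
  obtain y where "\<forall>(a, b)\<in>P. dist (median y a b) (\<xi> (a, b)) < e"
    using assms(1)[unfolded roller_compactification_iff, rule_format, OF assms(2,3)] ..
  then show thesis
    by (intro that[of y]) auto
qed

text \<open>
  The evaluations at points of \<open>X\<close> are means by definition, and finitely many coordinates of \<open>\<xi>\<close> are approximated by
  such points.
\<close>

lemma evaluation_mean:
  fixes \<xi> :: "'x roller"
  assumes \<xi>: "\<xi> \<in> roller_compactification"
  shows "mean (evaluation \<xi>)"
  unfolding mean_def
proof (intro allI impI)
  fix n :: nat and a and p q :: "nat \<Rightarrow> 'x" and c :: real
  assume c: "\<forall>x. (\<Sum>i<n. a i * gprod (p i) (q i) x) \<le> c"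
  define S where "S = (\<Sum>i<n. \<bar>a i\<bar>) + 1"
  have S: "S > 0"
    unfolding S_def by (intro add_nonneg_pos sum_nonneg) auto
  show "(\<Sum>i<n. a i * evaluation \<xi> (p i) (q i)) \<le> c"
  proof (rule field_le_epsilon)
    fix e :: real assume e: "e > 0"
    then have eS: "e / S > 0"
      using S by simp
    have "finite ((\<lambda>i. (p i, q i)) ` {..<n})"
      by simp
    then obtain y where y: "\<And>a b. (a, b) \<in> (\<lambda>i. (p i, q i)) ` {..<n} \<Longrightarrow> dist (median y a b) (\<xi> (a, b)) < e / S"
      using roller_approx[OF \<xi> _ eS] by metis
    have "a i * evaluation \<xi> (p i) (q i) \<le> a i * gprod (p i) (q i) y + \<bar>a i\<bar> * (e / S)" if "i < n" for i
    proof -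
      have "dist (median y (p i) (q i)) (\<xi> (p i, q i)) < e / S"
        using that by (intro y) blast
      then have "\<bar>evaluation \<xi> (p i) (q i) - gprod (p i) (q i) y\<bar> \<le> e / S"
        using abs_dist_diff_le[of "\<xi> (p i, q i)" "p i" "median y (p i) (q i)"]
        unfolding evaluation_def gprod_def by (simp add: dist_commute)
      then have "\<bar>a i\<bar> * \<bar>evaluation \<xi> (p i) (q i) - gprod (p i) (q i) y\<bar> \<le> \<bar>a i\<bar> * (e / S)"
        by (intro mult_left_mono) simp_all
      then show ?thesis
        unfolding abs_mult[symmetric] by (simp add: abs_le_iff right_diff_distrib)
    qed
    then have "(\<Sum>i<n. a i * evaluation \<xi> (p i) (q i)) \<le> (\<Sum>i<n. a i * gprod (p i) (q i) y + \<bar>a i\<bar> * (e / S))"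
      by (intro sum_mono) simp
    also have "\<dots> = (\<Sum>i<n. a i * gprod (p i) (q i) y) + (\<Sum>i<n. \<bar>a i\<bar>) * (e / S)"
      by (simp add: sum.distrib sum_distrib_right sum_divide_distrib)
    also have "\<dots> \<le> c + S * (e / S)"
      using c[rule_format, of y] eS unfolding S_def by (intro add_mono mult_right_mono) (auto simp: S_def)
    finally show "(\<Sum>i<n. a i * evaluation \<xi> (p i) (q i)) \<le> c + e"
      using S by simp
  qed
qed

text \<open>
  For points of \<open>X\<close> this is the gate property of \<open>median x a c\<close>; it passes to limits.
\<close>

lemma evaluation_split:
  fixes \<xi> :: "'x roller"
  assumes \<xi>: "\<xi> \<in> roller_compactification" and e: "e \<in> interval a c"
  shows "dist e (\<xi> (a, c)) = evaluation \<xi> e a + evaluation \<xi> e c"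
proof -
  have point: "dist e (median x a c) = gprod e a x + gprod e c x" for x
  proof -
    have "dist x e = dist x (median x a c) + dist (median x a c) e"
      using gate[OF e, of x] by (rule dist_interval)
    moreover have "dist x a = dist x (median x a c) + dist (median x a c) a"
      "dist x c = dist x (median x a c) + dist (median x a c) c"
      "dist a c = dist a (median x a c) + dist (median x a c) c"
      by (intro dist_interval median_in)+
    moreover have "dist a c = dist a e + dist e c"
      using e by (rule dist_interval)
    ultimately show ?thesis
      unfolding gprod_eq by (simp add: dist_commute field_simps)
  qed
  have "\<bar>dist e (\<xi> (a, c)) - (evaluation \<xi> e a + evaluation \<xi> e c)\<bar> \<le> 0 + d" if d: "d > 0" for d
  proof -
    have "d / 3 > 0"
      using d by simp
    then obtain y where y: "\<And>b b'. (b, b') \<in> {(a, c), (e, a), (e, c)} \<Longrightarrow> dist (median y b b') (\<xi> (b, b')) < d / 3"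
      using roller_approx[OF \<xi>, of "{(a, c), (e, a), (e, c)}" "d / 3"] by auto
    have *: "\<bar>dist e (\<xi> (b, b')) - dist e (median y b b')\<bar> < d / 3" if "(b, b') \<in> {(a, c), (e, a), (e, c)}" for b b'
      using y[OF that] abs_dist_diff_le[of "\<xi> (b, b')" e "median y b b'"] by (simp add: dist_commute)
    have "\<bar>dist e (\<xi> (a, c)) - dist e (median y a c)\<bar> < d / 3" "\<bar>dist e (\<xi> (e, a)) - dist e (median y e a)\<bar> < d / 3"
      "\<bar>dist e (\<xi> (e, c)) - dist e (median y e c)\<bar> < d / 3"
      by (rule *, simp)+
    then show ?thesis
      using point[of y] unfolding evaluation_def gprod_def by linarith
  qed
  then show ?thesis
    using field_le_epsilon[of "\<bar>dist e (\<xi> (a, c)) - (evaluation \<xi> e a + evaluation \<xi> e c)\<bar>" 0] by simp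
qed

text \<open>
  Evaluated at \<open>e = \<zeta> (a, c)\<close>, the averages of the distances of \<open>e\<close> from the \<open>(a, c)\<close>-coordinates of \<open>\<xi>\<close> and \<open>\<eta>\<close> are
  the distance of \<open>e\<close> from that of \<open>\<zeta>\<close>, which is zero.
\<close>

lemma evaluation_average:
  fixes \<xi> \<eta> \<zeta> :: "'x roller"
  assumes X: "\<xi> \<in> roller_compactification" "\<eta> \<in> roller_compactification" "\<zeta> \<in> roller_compactification"
    and avg: "\<And>p q. evaluation \<zeta> p q = (evaluation \<xi> p q + evaluation \<eta> p q) / 2"
  shows "\<xi> = \<zeta>"
proof
  fix p :: "'x \<times> 'x"
  obtain a c where p: "p = (a, c)"
    by (cases p)
  let ?e = "\<zeta> (a, c)"
  have e: "?e \<in> interval a c"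
    using X(3) by (rule roller_compactification_in_interval)
  have "0 = evaluation \<zeta> ?e a + evaluation \<zeta> ?e c"
    using evaluation_split[OF X(3) e] by simp
  also have "\<dots> = (dist ?e (\<xi> (a, c)) + dist ?e (\<eta> (a, c))) / 2"
    unfolding avg evaluation_split[OF X(1) e] evaluation_split[OF X(2) e] by (simp add: field_simps)
  finally have "dist ?e (\<xi> (a, c)) + dist ?e (\<eta> (a, c)) = 0"
    by simp
  then show "\<xi> p = \<zeta> p"
    using zero_le_dist[of ?e "\<xi> (a, c)"] zero_le_dist[of ?e "\<eta> (a, c)"] unfolding p
    by (metis add_nonneg_eq_0_iff dist_eq_0_iff)
qed

lemma evaluation_inj:
  fixes \<xi> \<eta> :: "'x roller"
  assumes "\<xi> \<in> roller_compactification" "\<eta> \<in> roller_compactification" "\<And>p q. evaluation \<xi> p q = evaluation \<eta> p q"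
  shows "\<xi> = \<eta>"
  using assms(3) by (intro evaluation_average[OF assms(1,1,2)]) simp

lemma roller_lipschitz:
  fixes \<xi> :: "'x roller"
  assumes \<xi>: "\<xi> \<in> roller_compactification"
  shows "dist (\<xi> (a, b)) (\<xi> (a', b')) \<le> dist a a' + dist b b'"
proof (rule field_le_epsilon)
  fix e :: real assume "e > 0"
  then obtain y where y: "\<And>c d. (c, d) \<in> {(a, b), (a', b')} \<Longrightarrow> dist (median y c d) (\<xi> (c, d)) < e / 2"
    using roller_approx[OF \<xi>, of "{(a, b), (a', b')}" "e / 2"] by auto
  have "dist (median y a b) (median y a' b') \<le> dist a a' + dist b b'"
    using median_lipschitz3[of y a b y a' b'] by simp
  moreover have "dist (\<xi> (a, b)) (\<xi> (a', b')) \<le>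
      dist (median y a b) (\<xi> (a, b)) + dist (median y a b) (median y a' b') + dist (median y a' b') (\<xi> (a', b'))"
    using dist_triangle2[of "\<xi> (a, b)" "\<xi> (a', b')" "median y a' b'"]
      dist_triangle3[of "\<xi> (a, b)" "median y a' b'" "median y a b"] by (simp add: dist_commute)
  ultimately show "dist (\<xi> (a, b)) (\<xi> (a', b')) \<le> dist a a' + dist b b' + e"
    using y[of a b] y[of a' b'] by simp
qed

lemma topspace_roller_topology [simp]: "topspace roller_topology = (roller_compactification :: 'x roller set)"
  unfolding roller_topology_def roller_compactification_def topspace_subtopology
  by (rule Int_absorb1) (rule closure_of_subset_topspace)

lemma regular_boundary_subset: "regular_boundary \<subseteq> (roller_compactification :: 'x roller set)"
  by (auto simp: regular_boundary_def regular_point_def roller_boundary_def)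

lemma evaluation_measurable:
  "(\<lambda>\<xi>. evaluation \<xi> p q) \<in> borel_measurable (borel_of_topology roller_topology)" for p :: 'x
proof (rule continuous_map_measurable_from)
  have "continuous_map roller_product (top_of_set (interval p q)) (\<lambda>y. y (p, q))"
    unfolding roller_product_def
    using continuous_map_product_projection[of "(p, q)" UNIV "\<lambda>(a, b). top_of_set (interval a b)"] by simp
  then have "continuous_map roller_product euclidean (\<lambda>y. y (p, q))"
    by (rule continuous_map_into_fulltopology)
  then have "continuous_map roller_topology euclidean (\<lambda>y. y (p, q))"
    unfolding roller_topology_def by (rule continuous_map_from_subtopology)
  moreover have "continuous_map euclidean euclidean (dist p)"
    by (simp add: continuous_on_dist continuous_on_id continuous_on_const)
  ultimately have "continuous_map roller_topology euclidean (dist p \<circ> (\<lambda>y. y (p, q)))"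
    by (rule continuous_map_compose)
  then show "continuous_map roller_topology euclidean (\<lambda>\<xi>. evaluation \<xi> p q)"
    by (simp add: evaluation_def comp_def)
qed

end

text \<open>
  The Roller compactification is second countable: a point depends in a Lipschitz way on the pair of coordinates, so
  countably many coordinates suffice, with balls around the points \<open>median d a b\<close> for \<open>d\<close> in a countable dense
  set. The distance to such a centre is a sum of two evaluations.
\<close>

lemma (in finite_rank_median) roller_measurableI:
  fixes f :: "'b \<Rightarrow> 'x roller"
  assumes f: "\<And>b. b \<in> space M \<Longrightarrow> f b \<in> roller_compactification"
    and meas: "\<And>p q. (\<lambda>b. evaluation (f b) p q) \<in> borel_measurable M"
  shows "f \<in> measurable M (borel_of_topology roller_topology)"
proof (rule measurable_borel_of_topologyI)
  show "f b \<in> topspace roller_topology" if "b \<in> space M" for b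
    using f[OF that] by simp
  fix U :: "'x roller set" assume "openin roller_topology U"
  then obtain W where W: "openin roller_product W" "U = W \<inter> roller_compactification"
    unfolding roller_topology_def openin_subtopology by blast
  obtain Q :: "'x set" where Q: "countable Q" "\<And>V. open V \<Longrightarrow> V \<noteq> {} \<Longrightarrow> \<exists>d\<in>Q. d \<in> V"
    using countable_dense_exists by blast
  have near: "\<exists>q\<in>Q. dist x q < e" if "e > 0" for x e
    using Q(2)[of "ball x e"] that by auto
  define C where "C = (Q \<times> Q) \<times> Q \<times> (UNIV :: nat set)"
  define N where "N = (\<lambda>((q :: 'x, q'), d, m :: nat) x. dist (median d q q') (x (q, q')) < 1 / Suc m)"
  define I where "I = {F. finite F \<and> F \<subseteq> C \<and> {x \<in> roller_compactification. \<forall>i\<in>F. N i x} \<subseteq> U}"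
  have cover: "\<exists>F\<in>I. \<forall>i\<in>F. N i x" if x: "x \<in> U" for x
  proof -
    have xX: "x \<in> roller_compactification"
      using x W(2) by blast
    obtain P e where P: "finite P" "e > 0" "{y \<in> topspace roller_product. \<forall>p\<in>P. dist (y p) (x p) < e} \<subseteq> W"
      using openin_roller_basis[OF W(1), of x] x W(2) by blast
    obtain m where m: "1 / Suc m < e / 8"
      using reals_Archimedean[of "e / 8"] P(2) by (auto simp: inverse_eq_divide)
    have "\<exists>i\<in>C. N i x \<and> (\<forall>y\<in>roller_compactification. N i y \<longrightarrow> dist (y p) (x p) < e)" for p
    proof -
      obtain a b where p: "p = (a, b)"
        by (cases p)
      have "e / 8 > 0" "1 / real (Suc m) > 0"
        using P(2) by simp_all
      then obtain q q' d where q: "q \<in> Q" "dist a q < e / 8" "q' \<in> Q" "dist b q' < e / 8"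
        "d \<in> Q" "dist (x (q, q')) d < 1 / Suc m"
        using near by metis
      have "median (x (q, q')) q q' = x (q, q')"
        using roller_compactification_in_interval[OF xX, of q q'] by (simp add: median_eq_iff)
      then have d: "dist (median d q q') (x (q, q')) < 1 / Suc m"
        using median_lipschitz[of d q q' "x (q, q')"] q(6) by (simp add: dist_commute)
      have "dist (y (a, b)) (x (a, b)) < e"
        if y: "y \<in> roller_compactification" "dist (median d q q') (y (q, q')) < 1 / Suc m" for y
      proof -
        have "dist (y (a, b)) (y (q, q')) < e / 4" "dist (x (a, b)) (x (q, q')) < e / 4"
          using roller_lipschitz[OF y(1), of a b q q'] roller_lipschitz[OF xX, of a b q q'] q(2,4) by linarith+
        moreover have "dist (y (q, q')) (x (q, q')) < e / 4"
          using dist_triangle3[of "y (q, q')" "x (q, q')" "median d q q'"] y(2) d m by linarith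
        ultimately show ?thesis
          using dist_triangle[of "y (a, b)" "x (a, b)" "y (q, q')"]
            dist_triangle2[of "y (q, q')" "x (a, b)" "x (q, q')"] P(2) by linarith
      qed
      then show ?thesis
        using q(1,3,5) d unfolding p by (intro bexI[of _ "((q, q'), d, m)"]) (auto simp: C_def N_def)
    qed
    then obtain i where i: "\<And>p. i p \<in> C" "\<And>p. N (i p) x"
      "\<And>p y. y \<in> roller_compactification \<Longrightarrow> N (i p) y \<Longrightarrow> dist (y p) (x p) < e"
      by metis
    have "{y \<in> roller_compactification. \<forall>j\<in>i ` P. N j y} \<subseteq> U"
    proof
      fix y assume "y \<in> {y \<in> roller_compactification. \<forall>j\<in>i ` P. N j y}"
      then have y: "y \<in> roller_compactification" "\<And>p. p \<in> P \<Longrightarrow> dist (y p) (x p) < e"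
        using i(3) by auto
      moreover have "y \<in> topspace roller_product"
        unfolding topspace_roller using roller_compactification_in_interval[OF y(1)] by blast
      ultimately show "y \<in> U"
        using P(3) W(2) by blast
    qed
    then have "i ` P \<in> I"
      using P(1) i(1) by (auto simp: I_def)
    then show ?thesis
      using i(2) by blast
  qed
  have eq: "f -` U \<inter> space M = (\<Union>F\<in>I. {b \<in> space M. \<forall>i\<in>F. N i (f b)})"
  proof (intro equalityI subsetI)
    fix b assume b: "b \<in> f -` U \<inter> space M"
    then obtain F where "F \<in> I" "\<forall>i\<in>F. N i (f b)"
      using cover[of "f b"] by auto
    then show "b \<in> (\<Union>F\<in>I. {b \<in> space M. \<forall>i\<in>F. N i (f b)})"
      using b by auto
  next
    fix b assume "b \<in> (\<Union>F\<in>I. {b \<in> space M. \<forall>i\<in>F. N i (f b)})"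
    then obtain F where F: "F \<in> I" "b \<in> space M" "\<forall>i\<in>F. N i (f b)"
      by auto
    then have "f b \<in> {x \<in> roller_compactification. \<forall>i\<in>F. N i x}"
      using f by simp
    then show "b \<in> f -` U \<inter> space M"
      using F(1,2) unfolding I_def by auto
  qed
  have "countable I"
  proof (rule countable_subset)
    show "I \<subseteq> {F. finite F \<and> F \<subseteq> C}"
      by (auto simp: I_def)
    show "countable {F. finite F \<and> F \<subseteq> C}"
      using Q(1) by (intro countable_Collect_finite_subset) (simp add: C_def)
  qed
  moreover have "{b \<in> space M. \<forall>i\<in>F. N i (f b)} \<in> sets M" if F: "F \<in> I" for F
  proof (cases "F = {}")
    case False
    have "{b \<in> space M. N i (f b)} \<in> sets M" for i
    proof -
      obtain q q' d m where i: "i = ((q, q'), d, m)"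
        by (metis prod.exhaust)
      let ?w = "median d q q'"
      have "{b \<in> space M. evaluation (f b) ?w q + evaluation (f b) ?w q' < 1 / Suc m} \<in> sets M"
        using meas by measurable
      also have "{b \<in> space M. evaluation (f b) ?w q + evaluation (f b) ?w q' < 1 / Suc m} = {b \<in> space M. N i (f b)}"
        using evaluation_split[OF f median_in(3)] by (auto simp: N_def i)
      finally show ?thesis .
    qed
    then show ?thesis
      using F False by (intro sets.sets_Collect_finite_All') (auto simp: I_def)
  qed simp
  ultimately show "f -` U \<inter> space M \<in> sets M"
    unfolding eq by (rule sets.countable_UN'')
qed

lemma (in median_action) evaluation_roller_act:
  "evaluation (roller_act act g \<xi>) (act g p) (act g q) = evaluation \<xi> p q"
  by (simp add: evaluation_def roller_act_def)

lemma mean_average: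
  assumes "mean \<mu>" "mean \<nu>"
  shows "mean (\<lambda>p q. (\<mu> p q + \<nu> p q) / 2)"
  unfolding mean_def
proof (intro allI impI)
  fix n :: nat and a and p q :: "nat \<Rightarrow> 'a" and c :: real
  assume c: "\<forall>x. (\<Sum>i<n. a i * gprod (p i) (q i) x) \<le> c"
  have "(\<Sum>i<n. a i * ((\<mu> (p i) (q i) + \<nu> (p i) (q i)) / 2)) =
      ((\<Sum>i<n. a i * \<mu> (p i) (q i)) + (\<Sum>i<n. a i * \<nu> (p i) (q i))) / 2"
    by (simp add: sum.distrib sum_divide_distrib distrib_left add_divide_distrib)
  moreover have "(\<Sum>i<n. a i * \<mu> (p i) (q i)) \<le> c"
    by (rule mean_le_sum[OF assms(1)]) (simp add: c)
  moreover have "(\<Sum>i<n. a i * \<nu> (p i) (q i)) \<le> c"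
    by (rule mean_le_sum[OF assms(2)]) (simp add: c)
  ultimately show "(\<Sum>i<n. a i * ((\<mu> (p i) (q i) + \<nu> (p i) (q i)) / 2)) \<le> c"
    by simp
qed

section \<open>The boundary map\<close>

lemma (in irreducible_minimal_action) equivariant_map_evaluation:
  fixes \<phi> :: "'b \<Rightarrow> 'x roller"
  assumes "equivariant_regular_boundary_map actB B act \<phi>"
  shows "\<And>b. b \<in> space B \<Longrightarrow> \<phi> b \<in> regular_boundary"
    and "\<And>p q. (\<lambda>b. evaluation (\<phi> b) p q) \<in> borel_measurable B"
    and "\<And>g. AE b in B. \<forall>p q. evaluation (\<phi> (actB g b)) (act g p) (act g q) = evaluation (\<phi> b) p q"
proof -
  have m: "\<phi> \<in> measurable B (restrict_space (borel_of_topology roller_topology) regular_boundary)"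
    and eq: "\<And>g. AE b in B. \<phi> (actB g b) = roller_act act g (\<phi> b)"
    using assms unfolding equivariant_regular_boundary_map_def by auto
  show "\<phi> b \<in> regular_boundary" if "b \<in> space B" for b
    using measurable_space[OF m that] by (simp add: space_restrict_space)
  show "(\<lambda>b. evaluation (\<phi> b) p q) \<in> borel_measurable B" for p q
    by (rule measurable_compose[OF m measurable_restrict_space1[OF evaluation_measurable]])
  show "AE b in B. \<forall>p q. evaluation (\<phi> (actB g b)) (act g p) (act g q) = evaluation (\<phi> b) p q" for g
    using eq[of g] by eventually_elim (simp add: evaluation_roller_act)
qed

theorem theorem5:
  fixes act :: "'g::{topological_group_add, t2_space, second_countable_topology} \<Rightarrow>
                'x::polish_space \<Rightarrow> 'x"
    and B :: "'b measure"
    and actB :: "'g \<Rightarrow> 'b \<Rightarrow> 'b"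
  assumes "locally_compact_space (euclidean :: 'g topology)"
    and "median_space (UNIV :: 'x set) dist"
    and "irreducible_median_space (UNIV :: 'x set) dist"
    and "median_rank TYPE('x) < \<infinity>"
    and "continuous_isometric_action act (UNIV :: 'x set) dist"
    and "roller_nonelementary act"
    and "roller_minimal act"
    and "G_boundary actB B"
  shows "\<exists>\<phi>. equivariant_regular_boundary_map actB B act \<phi> \<and>
           (\<forall>\<psi>. equivariant_regular_boundary_map actB B act \<psi> \<longrightarrow> (AE b in B. \<phi> b = \<psi> b))"
proof -
  interpret irreducible_minimal_action "TYPE('x)" act
    by unfold_locales (use assms in auto)
  have B: "prob_space B" "measure_class_preserving_action actB B" "zimmer_amenable actB B"
    "isometrically_ergodic (diagonal_action actB) (B \<Otimes>\<^sub>M B)"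
    using assms(8) unfolding G_boundary_def by auto
  note cl = subsetD[OF regular_boundary_subset]
  have dirac: "AE b in B. \<exists>\<xi>\<in>regular_boundary. \<forall>p q. \<nu> b p q = evaluation \<xi> p q"
    if "\<And>b. b \<in> space B \<Longrightarrow> mean (\<nu> b)" "\<And>p q. (\<lambda>b. \<nu> b p q) \<in> borel_measurable B"
      "\<And>g. AE b in B. \<forall>p q. \<nu> (actB g b) (act g p) (act g q) = \<nu> b p q" for \<nu> :: "'b \<Rightarrow> 'x \<Rightarrow> 'x \<Rightarrow> real"
  proof -
    interpret mean_family "TYPE('x)" act actB B \<nu>
      by (intro mean_family.intro mean_family_axioms.intro irreducible_minimal_action_axioms) (fact B that)+
    show ?thesis
      unfolding evaluation_def by (rule mean_at_regular_point)
  qed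
  obtain \<nu> :: "'b \<Rightarrow> 'x \<Rightarrow> 'x \<Rightarrow> real" where \<nu>: "\<And>b. mean (\<nu> b)" "\<And>p q. (\<lambda>b. \<nu> b p q) \<in> borel_measurable B"
    "\<And>g. AE b in B. \<forall>p q. \<nu> (actB g b) (act g p) (act g q) = \<nu> b p q"
    using amenable_means[OF B(2,3)] by blast
  let ?D = "\<lambda>b \<xi>. \<xi> \<in> regular_boundary \<and> (\<forall>p q. \<nu> b p q = evaluation \<xi> p q)"
  have D: "AE b in B. \<exists>\<xi>. ?D b \<xi>"
    using dirac[OF \<nu>] by (simp add: Bex_def)
  then obtain N where N: "{b \<in> space B. \<not> (\<exists>\<xi>. ?D b \<xi>)} \<subseteq> N" "emeasure B N = 0" "N \<in> sets B"
    by (rule AE_E)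
  have N0: "AE b in B. b \<notin> N"
    using N(2,3) by (intro AE_not_in) auto
  \<comment> \<open>the value of \<open>\<phi>\<close> on the null set \<open>N\<close>\<close>
  obtain \<xi>0 :: "'x roller" where \<xi>0: "\<xi>0 \<in> regular_boundary"
  proof (rule ccontr)
    assume "\<not> thesis"
    then have "regular_boundary = ({} :: 'x roller set)"
      using that by blast
    then have "AE b in B. False"
      using D by simp
    then show False
      using prob_space.AE_False[OF B(1)] by simp
  qed
  define \<phi> where "\<phi> b = (if b \<in> space B - N then SOME \<xi>. ?D b \<xi> else \<xi>0)" for b
  have \<phi>D: "?D b (\<phi> b)" if "b \<in> space B - N" for b
  proof -
    have "\<exists>\<xi>. ?D b \<xi>"
      using that N(1) by blast
    then have "?D b (SOME \<xi>. ?D b \<xi>)"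
      by (rule someI_ex)
    moreover have "\<phi> b = (SOME \<xi>. ?D b \<xi>)"
      unfolding \<phi>_def using that by (rule if_P)
    ultimately show ?thesis
      by (rule back_subst[where P = "?D b", OF _ sym])
  qed
  have \<phi>0: "\<phi> b = \<xi>0" if "b \<notin> space B - N" for b
    unfolding \<phi>_def using that by (rule if_not_P)
  have reg: "\<phi> b \<in> regular_boundary" for b
    using \<phi>D[of b] \<phi>0[of b] \<xi>0 by (cases "b \<in> space B - N") simp_all
  have ev: "AE b in B. \<forall>p q. evaluation (\<phi> b) p q = \<nu> b p q"
    using N0 AE_space by eventually_elim (use \<phi>D in simp)
  have evm: "(\<lambda>b. evaluation (\<phi> b) p q) \<in> borel_measurable B" for p q
  proof -
    have "(\<lambda>b. if b \<in> space B - N then \<nu> b p q else evaluation \<xi>0 p q) \<in> borel_measurable B"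
      using N(3) \<nu>(2) by measurable
    also have "(\<lambda>b. if b \<in> space B - N then \<nu> b p q else evaluation \<xi>0 p q) = (\<lambda>b. evaluation (\<phi> b) p q)"
    proof
      show "(if b \<in> space B - N then \<nu> b p q else evaluation \<xi>0 p q) = evaluation (\<phi> b) p q" for b
        using \<phi>D[of b] \<phi>0[of b] by (cases "b \<in> space B - N") simp_all
    qed
    finally show ?thesis .
  qed
  have "AE b in B. \<phi> (actB g b) = roller_act act g (\<phi> b)" for g
    using ev AE_action[OF B(2) ev, of g] \<nu>(3)[of g]
  proof eventually_elim
    case (elim b)
    show ?case
    proof (rule evaluation_inj)
      show "\<phi> (actB g b) \<in> roller_compactification" "roller_act act g (\<phi> b) \<in> roller_compactification"
        using cl[OF reg] by (simp_all add: roller_act_in)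
      fix p q
      have "evaluation (\<phi> (actB g b)) p q = \<nu> b (act (- g) p) (act (- g) q)"
        using elim(2) elim(3)[rule_format, of "act (- g) p" "act (- g) q"] by simp
      also have "\<dots> = evaluation (roller_act act g (\<phi> b)) p q"
        using elim(1) evaluation_roller_act[of g "\<phi> b" "act (- g) p" "act (- g) q"] by simp
      finally show "evaluation (\<phi> (actB g b)) p q = evaluation (roller_act act g (\<phi> b)) p q" .
    qed
  qed
  moreover have "\<phi> \<in> measurable B (restrict_space (borel_of_topology roller_topology) regular_boundary)"
    using reg cl evm by (intro measurable_restrict_space2 roller_measurableI) auto
  ultimately have \<phi>: "equivariant_regular_boundary_map actB B act \<phi>"
    unfolding equivariant_regular_boundary_map_def by blast
  have "AE b in B. \<phi> b = \<psi> b" if \<psi>: "equivariant_regular_boundary_map actB B act \<psi>" for \<psi>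
  proof -
    note * = equivariant_map_evaluation[OF \<phi>] and ** = equivariant_map_evaluation[OF \<psi>]
    \<comment> \<open>the average of the two families of evaluations\<close>
    let ?\<mu> = "\<lambda>b p q. (evaluation (\<phi> b) p q + evaluation (\<psi> b) p q) / 2"
    have "AE b in B. \<exists>\<xi>\<in>regular_boundary. \<forall>p q. ?\<mu> b p q = evaluation \<xi> p q"
    proof (rule dirac)
      show "mean (?\<mu> b)" if "b \<in> space B" for b
        using *(1)[OF that] **(1)[OF that] by (intro mean_average evaluation_mean cl)
      show "(\<lambda>b. ?\<mu> b p q) \<in> borel_measurable B" for p q
        using *(2) **(2) by measurable
      show "AE b in B. \<forall>p q. ?\<mu> (actB g b) (act g p) (act g q) = ?\<mu> b p q" for g
        using *(3)[of g] **(3)[of g] by eventually_elim simp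
    qed
    then show ?thesis
      using AE_space
    proof eventually_elim
      case (elim b)
      then obtain \<xi> where \<xi>: "\<xi> \<in> regular_boundary" "\<And>p q. ?\<mu> b p q = evaluation \<xi> p q"
        by blast
      have X: "\<phi> b \<in> roller_compactification" "\<psi> b \<in> roller_compactification" "\<xi> \<in> roller_compactification"
        using *(1) **(1) \<xi>(1) elim(2) cl by blast+
      have "\<phi> b = \<xi>"
        by (rule evaluation_average[OF X]) (simp flip: \<xi>(2))
      moreover have "\<psi> b = \<xi>"
        by (rule evaluation_average[OF X(2,1,3)]) (simp add: add.commute flip: \<xi>(2))
      ultimately show ?case
        by simp
    qed
  qed
  with \<phi> show ?thesis
    by blast
qed

end
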